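(* Let $\mathsf{A}=(A_1,\ldots,A_M)\in M_d(\mathbb{R})^M$ be irreducible, where $M\geq2$, $d\geq1$, with $P(\mathsf{A},2)>-\infty$. Then the Kusuoka measure associated to $\mathsf{A}$ is precisely the equilibrium state of $(\mathsf{A},2)$.
   Context: $\Sigma_M:=\{1,\ldots,M\}^{\mathbb{N}}$ with the product topology; $\sigma$ is the shift $\sigma[(x_n)_{n=1}^\infty]=(x_{n+1})_{n=1}^\infty$; $\mathcal{M}_\sigma$ is the set of $\sigma$-invariant Borel probability measures on $\Sigma_M$; $h(\nu)$ is the metric entropy of $\nu\in\mathcal{M}_\sigma$; $[x_1\cdots x_n]:=\{y\in\Sigma_M\colon y_i=x_i,\ 1\leq i\leq n\}$. $M_d(\mathbb{R})$ is the set of real $d\times d$ matrices and $\|\cdot\|$ is the operator norm induced by the Euclidean norm. The top Lyapunov exponent is $\Lambda(\mathsf{A},\nu):=\lim_{n\to\infty}\frac1n\int_{\Sigma_M}\log\|A_{x_n}\cdots A_{x_1}\|\,d\nu(x)\in[-\infty,\infty)$ (with $\log0=-\infty$). The pressure is $P(\mathsf{A},s):=\lim_{n\to\infty}\frac1n\log\left(\sum_{i_1,\ldots,i_n=1}^M\|A_{i_n}\cdots A_{i_1}\|^s\right)$; it is known that $P(\mathsf{A},s)=\sup_{\nu\in\mathcal{M}_\sigma}\bigl(h(\nu)+s\Lambda(\mathsf{A},\nu)\bigr)$, and an equilibrium state of $(\mathsf{A},s)$ is a measure attaining this supremum. $\mathsf{A}$ is irreducible if there is no linear subspace $U\subset\mathbb{R}^d$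 with $0<\dim U<d$ and $A_iU\subseteq U$ for all $i$; if $\mathsf{A}$ is irreducible and $P(\mathsf{A},s)>-\infty$ (automatic when $d\geq2$) the equilibrium state is known to be unique. Kusuoka measure: let $M_d^S(\mathbb{R})$ be the space of real symmetric $d\times d$ matrices and define linear maps $L_{\mathsf{A}},\hat L_{\mathsf{A}}\colon M_d^S(\mathbb{R})\to M_d^S(\mathbb{R})$ by $L_{\mathsf{A}}B:=\sum_{i=1}^MA_i^TBA_i$ and $\hat L_{\mathsf{A}}B:=\sum_{i=1}^MA_iBA_i^T$. For irreducible $\mathsf{A}$ with $P(\mathsf{A},2)>-\infty$ there exist positive definite $Q,\hat Q\in M_d^S(\mathbb{R})$ with $L_{\mathsf{A}}Q=e^{P(\mathsf{A},2)}Q$, $\hat L_{\mathsf{A}}\hat Q=e^{P(\mathsf{A},2)}\hat Q$ and $\mathrm{tr}(Q\hat Q)=1$; each of $Q,\hat Q$ is unique up to scalar multiplication, so the following does not depend on the choice. The Kusuoka measure associated to $\mathsf{A}$ is the $\sigma$-invariant Borel probability measure $\mu$ on $\Sigma_M$ determined by \[\mu([x_1\cdots x_n]):=e^{-nP(\mathsf{A},2)}\,\mathrm{tr}\left(\hat Q(A_{x_n}\cdots A_{x_1})^TQA_{x_n}\cdots A_{x_1}\right)\] for all $n\geq1$ and $x_1,\ldots,x_n\in\{1,\ldots,M\}$. *)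

theory Defs
  imports "HOL-Probability.Probability"
begin

section \<open>The full shift and its invariant measures\<close>

text \<open>
  Sequences $(x_n)_{n \ge 1}$ over the alphabet $\{1,\ldots,M\}$ are functions on \<open>nat\<close>;
  the entry $x_n$ is \<open>x (n - 1)\<close>. The type \<open>nat \<Rightarrow> nat\<close> carries the product of the discrete
  topologies, so \<open>restrict_space borel\<close> below is the Borel \<open>\<sigma>\<close>-algebra of the product topology
  on the sequence space.
\<close>

definition full_shift :: "nat \<Rightarrow> (nat \<Rightarrow> nat) set" where
  "full_shift M = {x. \<forall>n. x n \<in> {1..M}}"

definition shift :: "(nat \<Rightarrow> nat) \<Rightarrow> (nat \<Rightarrow> nat)" where
  "shift x = (\<lambda>n. x (Suc n))"

definition shift_borel :: "nat \<Rightarrow> (nat \<Rightarrow> nat) measure" where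
  "shift_borel M = restrict_space borel (full_shift M)"

definition invariant_measures :: "nat \<Rightarrow> (nat \<Rightarrow> nat) measure set" where
  "invariant_measures M =
     {\<nu>. prob_space \<nu> \<and> sets \<nu> = sets (shift_borel M) \<and>
         (\<forall>B\<in>sets \<nu>. emeasure \<nu> (shift -` B \<inter> space \<nu>) = emeasure \<nu> B)}"

definition words :: "nat \<Rightarrow> nat \<Rightarrow> nat list set" where
  "words M n = {w. length w = n \<and> set w \<subseteq> {1..M}}"

definition cylinder :: "nat \<Rightarrow> nat list \<Rightarrow> (nat \<Rightarrow> nat) set" where
  "cylinder M w = {y \<in> full_shift M. \<forall>i<length w. y i = w ! i}"


section \<open>Metric (Kolmogorov--Sinai) entropy\<close>

definition finite_partitions :: "'a measure \<Rightarrow> 'a set set set" where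
  "finite_partitions \<nu> = {\<xi>. finite \<xi> \<and> \<xi> \<subseteq> sets \<nu> \<and> partition_on (space \<nu>) \<xi>}"

definition partition_entropy :: "'a measure \<Rightarrow> 'a set set \<Rightarrow> real" where
  "partition_entropy \<nu> \<xi> = - (\<Sum>C\<in>\<xi>. measure \<nu> C * ln (measure \<nu> C))"

text \<open>
  The join of $\xi, T^{-1}\xi, \ldots, T^{-(n-1)}\xi$. The empty set may occur as a member; it
  contributes $0$ to the entropy.
\<close>

definition iterated_join :: "('a \<Rightarrow> 'a) \<Rightarrow> 'a measure \<Rightarrow> 'a set set \<Rightarrow> nat \<Rightarrow> 'a set set" where
  "iterated_join T \<nu> \<xi> n =
     {{x \<in> space \<nu>. \<forall>i<n. (T ^^ i) x \<in> c i} | c. \<forall>i<n. c i \<in> \<xi>}"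

definition entropy_wrt :: "('a \<Rightarrow> 'a) \<Rightarrow> 'a measure \<Rightarrow> 'a set set \<Rightarrow> real" where
  "entropy_wrt T \<nu> \<xi> = lim (\<lambda>n. partition_entropy \<nu> (iterated_join T \<nu> \<xi> n) / real n)"

definition metric_entropy :: "('a \<Rightarrow> 'a) \<Rightarrow> 'a measure \<Rightarrow> ereal" where
  "metric_entropy T \<nu> = (SUP \<xi>\<in>finite_partitions \<nu>. ereal (entropy_wrt T \<nu> \<xi>))"


section \<open>Lyapunov exponent, pressure and equilibrium states\<close>

text \<open>The logarithm on $[0,\infty)$ with $\log 0 = -\infty$.\<close>

definition elog :: "real \<Rightarrow> ereal" where
  "elog t = (if t > 0 then ereal (ln t) else -\<infinity>)"

text \<open>
  The integral of an extended-real-valued function, as the integral of its positive part minus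
  that of its negative part (\<open>e2ennreal\<close> truncates negative values to $0$). It is applied only
  to functions that are bounded above, so \<open>\<infinity> - \<infinity>\<close> does not occur.
\<close>

definition ereal_integral :: "'a measure \<Rightarrow> ('a \<Rightarrow> ereal) \<Rightarrow> ereal" where
  "ereal_integral \<nu> f =
     enn2ereal (\<integral>\<^sup>+ x. e2ennreal (f x) \<partial>\<nu>) - enn2ereal (\<integral>\<^sup>+ x. e2ennreal (- f x) \<partial>\<nu>)"

definition mat_norm :: "real ^ 'd ^ 'd \<Rightarrow> real" where
  "mat_norm B = onorm (\<lambda>v. B *v v)"

text \<open>\<open>mat_prod A [x\<^sub>1, \<dots>, x\<^sub>n]\<close> is $A_{x_n} \cdots A_{x_1}$.\<close>

primrec mat_prod :: "(nat \<Rightarrow> real ^ 'd ^ 'd) \<Rightarrow> nat list \<Rightarrow> real ^ 'd ^ 'd" where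
  "mat_prod A [] = mat 1"
| "mat_prod A (i # w) = mat_prod A w ** A i"

definition lyapunov :: "(nat \<Rightarrow> real ^ 'd ^ 'd) \<Rightarrow> (nat \<Rightarrow> nat) measure \<Rightarrow> ereal" where
  "lyapunov A \<nu> =
     lim (\<lambda>n. ereal_integral \<nu> (\<lambda>x. elog (mat_norm (mat_prod A (map x [0..<n])))) / ereal (real n))"

definition pressure :: "nat \<Rightarrow> (nat \<Rightarrow> real ^ 'd ^ 'd) \<Rightarrow> real \<Rightarrow> ereal" where
  "pressure M A s =
     lim (\<lambda>n. elog (\<Sum>w\<in>words M n. mat_norm (mat_prod A w) powr s) / ereal (real n))"

definition equilibrium_state ::
    "nat \<Rightarrow> (nat \<Rightarrow> real ^ 'd ^ 'd) \<Rightarrow> real \<Rightarrow> (nat \<Rightarrow> nat) measure \<Rightarrow> bool" where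
  "equilibrium_state M A s \<nu> \<longleftrightarrow>
     \<nu> \<in> invariant_measures M \<and>
     metric_entropy shift \<nu> + ereal s * lyapunov A \<nu> =
       (SUP \<nu>'\<in>invariant_measures M. metric_entropy shift \<nu>' + ereal s * lyapunov A \<nu>')"

definition irreducible_tuple :: "nat \<Rightarrow> (nat \<Rightarrow> real ^ 'd ^ 'd) \<Rightarrow> bool" where
  "irreducible_tuple M A \<longleftrightarrow>
     \<not> (\<exists>U :: (real ^ 'd) set. subspace U \<and> 0 < dim U \<and> dim U < CARD('d) \<and>
          (\<forall>i\<in>{1..M}. (\<lambda>v. A i *v v) ` U \<subseteq> U))"


section \<open>The Kusuoka measure\<close>

definition positive_definite :: "real ^ 'd ^ 'd \<Rightarrow> bool" where
  "positive_definite B \<longleftrightarrow> transpose B = B \<and> (\<forall>v. v \<noteq> 0 \<longrightarrow> 0 < v \<bullet> (B *v v))"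

definition transfer_op :: "nat \<Rightarrow> (nat \<Rightarrow> real ^ 'd ^ 'd) \<Rightarrow> real ^ 'd ^ 'd \<Rightarrow> real ^ 'd ^ 'd" where
  "transfer_op M A B = (\<Sum>i=1..M. transpose (A i) ** B ** A i)"

definition dual_transfer_op ::
    "nat \<Rightarrow> (nat \<Rightarrow> real ^ 'd ^ 'd) \<Rightarrow> real ^ 'd ^ 'd \<Rightarrow> real ^ 'd ^ 'd" where
  "dual_transfer_op M A B = (\<Sum>i=1..M. A i ** B ** transpose (A i))"

text \<open>
  \<open>real_of_ereal\<close> is harmless under the standing hypothesis that the pressure is not \<open>-\<infinity>\<close>,
  since the pressure is never \<open>\<infinity>\<close>.
\<close>

definition is_kusuoka_measure ::
    "nat \<Rightarrow> (nat \<Rightarrow> real ^ 'd ^ 'd) \<Rightarrow> (nat \<Rightarrow> nat) measure \<Rightarrow> bool" where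
  "is_kusuoka_measure M A \<mu> \<longleftrightarrow>
     \<mu> \<in> invariant_measures M \<and>
     (let p = real_of_ereal (pressure M A 2) in
       \<exists>Q Q'. positive_definite Q \<and> positive_definite Q' \<and>
         transfer_op M A Q = exp p *\<^sub>R Q \<and> dual_transfer_op M A Q' = exp p *\<^sub>R Q' \<and>
         trace (Q ** Q') = 1 \<and>
         (\<forall>n\<ge>1. \<forall>w\<in>words M n.
            measure \<mu> (cylinder M w) =
              exp (- real n * p) * trace (Q' ** transpose (mat_prod A w) ** Q ** mat_prod A w)))"

end

theory Submission
  imports Defs
begin

text \<open>
  Write \<open>A\<^sub>w\<close> for the matrix product along a word \<open>w\<close>, \<open>P\<close> for the pressure and \<open>l = e\<^bsup>P\<^esup>\<close>. The
  argument compares an arbitrary invariant measure \<open>\<nu>\<close> with the Kusuoka measure \<open>\<mu>\<close> through relative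
  entropy on words of length \<open>n\<close>.

  To construct \<open>\<mu>\<close>, Brouwer's theorem on the cone of positive semidefinite matrices gives the eigenmatrices
  \<open>Q\<close> and \<open>Q'\<close> of the two transfer operators (\<open>perron_frobenius_pair\<close>); irreducibility makes them
  positive definite, and duality gives them the same eigenvalue \<open>l\<close>, whose logarithm is the pressure
  (\<open>pressure_eq\<close>). The eigenvalue equation of \<open>Q\<close> makes the prescribed cylinder masses consistent and
  that of \<open>Q'\<close> makes them shift invariant (\<open>exists_kusuoka_measure\<close>).

  The form \<open>tr (Q' X\<^sup>T Q X)\<close> is comparable to \<open>\<parallel>X\<parallel>\<^sup>2\<close>, so \<open>\<mu>[w]\<close> is comparable to
  \<open>l\<^bsup>-n\<^esup> \<parallel>A\<^sub>w\<parallel>\<^sup>2\<close> (\<open>kusuoka_gibbs\<close>). Hence, up to a bounded error,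
  \<open>H\<^sub>n(\<nu>) + 2 \<integral> ln \<parallel>A\<^sub>w\<parallel> d\<nu> - n P\<close> is minus the relative entropy of \<open>\<nu>\<close> with respect to \<open>\<mu>\<close> on words of
  length \<open>n\<close>, where \<open>H\<^sub>n\<close> is the entropy of the law of the initial word. Relative entropy is
  nonnegative and vanishes for \<open>\<nu> = \<mu>\<close>. Dividing by \<open>n\<close> gives \<open>h(\<nu>) + 2 \<Lambda>(\<nu>) \<le> P\<close> with equality for
  \<open>\<mu>\<close> (\<open>equilibrium_upper\<close>, \<open>equilibrium_gibbs\<close>). The passage from \<open>H\<^sub>n / n\<close> to the metric entropy, a
  supremum over all finite partitions, is the Kolmogorov--Sinai theorem
  (\<open>metric_entropy_generator\<close>).

  For uniqueness, note that the sequence \<open>H\<^sub>n(\<nu>) + 2 \<integral> ln \<parallel>A\<^sub>w\<parallel> d\<nu>\<close> is subadditive, so its averages converge to their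
  infimum. If \<open>\<nu>\<close> is an equilibrium state, that infimum is \<open>P\<close>; each term is then at least \<open>n P\<close>, and
  the relative entropies stay bounded in \<open>n\<close>. This forces \<open>\<nu>\<close> to be absolutely continuous with
  respect to \<open>\<mu>\<close> (\<open>equilibrium_absolutely_continuous\<close>). Irreducibility supplies finitely many words
  connecting any two cylinders with a definite proportion of the product of their masses
  (\<open>cylinders_mixing\<close>). Hence \<open>\<mu>\<close> is ergodic and has no other absolutely continuous invariant
  probability measure (\<open>absolutely_continuous_invariant_unique\<close>).
\<close>

section \<open>Subadditive sequences\<close>

text \<open>
  Fekete's lemma in the extended reals. The limit is \<open>-\<infinity>\<close> when the averages are unbounded
  below, as happens for a sequence of integrated log-norms whose Lyapunov exponent is \<open>-\<infinity>\<close>.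
\<close>

lemma fekete:
  fixes a :: "nat \<Rightarrow> real"
  assumes sub: "\<And>m n. m \<ge> 1 \<Longrightarrow> n \<ge> 1 \<Longrightarrow> a (m + n) \<le> a m + a n"
  shows "(\<lambda>n. ereal (a n / real n)) \<longlonglongrightarrow> (INF n\<in>{1..}. ereal (a n / real n))"
    (is "_ \<longlonglongrightarrow> ?I")
proof (rule order_tendstoI)
  fix c assume c: "c < ?I"
  show "\<forall>\<^sub>F n in sequentially. c < ereal (a n / real n)"
    using eventually_ge_at_top[of 1]
  proof eventually_elim
    case (elim n)
    then have "?I \<le> ereal (a n / real n)" by (intro INF_lower) auto
    with c show ?case by order
  qed
next
  fix c assume c: "?I < c"
  then obtain k where k: "k \<ge> 1" "ereal (a k / real k) < c"
    by (auto simp: INF_less_iff)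
  obtain d where d: "ereal (a k / real k) < ereal d" "ereal d < c"
    using ereal_dense2[OF k(2)] by auto
  have mult: "a (q * k + r) \<le> real q * a k + a r" if "r \<ge> 1" for q r
  proof (induction q)
    case (Suc q)
    have "a (Suc q * k + r) = a (k + (q * k + r))" by (simp add: algebra_simps)
    also have "\<dots> \<le> a k + a (q * k + r)" using k that by (intro sub) auto
    finally show ?case using Suc by (simp add: algebra_simps)
  qed auto
  define B where "B = Max ((\<lambda>r. a r - real r * (a k / real k)) ` {1..k})"
  have bound: "a n / real n \<le> a k / real k + B / real n" if n: "n \<ge> 1" for n
  proof -
    \<comment> \<open>Remainders run over \<open>1..k\<close> because subadditivity is assumed for positive indices only.\<close>
    define q where "q = (n - 1) div k"
    define r where "r = (n - 1) mod k + 1"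
    have nqr: "n = q * k + r" using n by (simp add: q_def r_def)
    have r: "r \<in> {1..k}" using k by (auto simp: r_def Suc_le_eq)
    have "a n \<le> real q * a k + a r" unfolding nqr using r by (intro mult) auto
    also have "real q * a k = (real n - real r) * (a k / real k)"
      using k by (simp add: nqr)
    finally have "a n \<le> real n * (a k / real k) + (a r - real r * (a k / real k))"
      by (simp only: left_diff_distrib)
    also have "a r - real r * (a k / real k) \<le> B"
      unfolding B_def by (rule Max_ge) (use r in auto)
    finally have "a n \<le> real n * (a k / real k) + B" by simp
    then have "a n / real n \<le> (real n * (a k / real k) + B) / real n"
      by (intro divide_right_mono) auto
    then show ?thesis using n by (simp add: add_divide_distrib)
  qed
  have "(\<lambda>n. a k / real k + B / real n) \<longlonglongrightarrow> a k / real k + 0"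
    by (intro tendsto_intros lim_const_over_n)
  then have "\<forall>\<^sub>F n in sequentially. a k / real k + B / real n < d"
    using d by (intro order_tendstoD(2)) auto
  then show "\<forall>\<^sub>F n in sequentially. ereal (a n / real n) < c"
    using eventually_ge_at_top[of 1]
  proof eventually_elim
    case (elim n)
    then have "ereal (a n / real n) < ereal d" using bound[of n] by simp
    with d show ?case by order
  qed
qed

lemma fekete_nonneg:
  fixes a :: "nat \<Rightarrow> real"
  assumes sub: "\<And>m n. m \<ge> 1 \<Longrightarrow> n \<ge> 1 \<Longrightarrow> a (m + n) \<le> a m + a n"
    and nonneg: "\<And>n. a n \<ge> 0"
  shows "convergent (\<lambda>n. a n / real n)"
proof -
  let ?I = "INF n\<in>{1..}. ereal (a n / real n)"
  have "0 \<le> ?I" using nonneg by (intro INF_greatest) auto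
  moreover have "?I \<le> ereal (a 1 / real 1)" by (intro INF_lower) auto
  ultimately obtain h where h: "?I = ereal h" by (cases ?I) auto
  have "(\<lambda>n. ereal (a n / real n)) \<longlonglongrightarrow> ereal h" using fekete[of a, OF sub] unfolding h .
  then show ?thesis unfolding convergent_def by auto
qed

section \<open>Entropy of random variables with finitely many values\<close>

context prob_space
begin

definition law :: "('a \<Rightarrow> 'b) \<Rightarrow> 'b \<Rightarrow> real" where
  "law X s = prob (X -` {s} \<inter> space M)"

definition rv_entropy :: "('a \<Rightarrow> 'b) \<Rightarrow> real" where
  "rv_entropy X = - (\<Sum>s\<in>X ` space M. law X s * ln (law X s))"

lemma rv_entropy_cong:
  assumes "\<And>x. x \<in> space M \<Longrightarrow> X x = Y x"
  shows "rv_entropy X = rv_entropy Y"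
proof -
  have "X -` {s} \<inter> space M = Y -` {s} \<inter> space M" for s using assms by auto
  moreover have "X ` space M = Y ` space M" using assms by (rule image_cong[OF refl])
  ultimately show ?thesis by (simp add: rv_entropy_def law_def)
qed

lemma law_nonneg: "0 \<le> law X s" and law_le_1: "law X s \<le> 1"
  by (auto simp: law_def)

lemma integrable_simple:
  fixes f :: "'a \<Rightarrow> real"
  shows "simple_function M f \<Longrightarrow> integrable M f"
  by (rule integrable_simple_function) auto

lemma expectation_simple:
  assumes X: "simple_function M X"
  shows "expectation (\<lambda>x. h (X x) :: real) = (\<Sum>s\<in>X ` space M. law X s * h s)"
proof -
  have fin: "finite (X ` space M)" using X by (simp add: simple_function_def)
  have sets: "X -` {s} \<inter> space M \<in> events" for s
  proof (cases "s \<in> X ` space M")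
    case False
    then have "X -` {s} \<inter> space M = {}" by auto
    then show ?thesis by simp
  qed (use X in \<open>auto simp: simple_function_def\<close>)
  have "expectation (\<lambda>x. h (X x)) =
      expectation (\<lambda>x. \<Sum>s\<in>X ` space M. h s * indicator (X -` {s} \<inter> space M) x)"
  proof (rule Bochner_Integration.integral_cong[OF refl])
    fix x assume x: "x \<in> space M"
    have "(\<Sum>s\<in>X ` space M. h s * indicator (X -` {s} \<inter> space M) x) =
        (\<Sum>s\<in>X ` space M. if s = X x then h s else 0)"
      using x by (intro sum.cong) (auto simp: indicator_def)
    then show "h (X x) = (\<Sum>s\<in>X ` space M. h s * indicator (X -` {s} \<inter> space M) x)"
      using x fin by (simp add: sum.delta')
  qed
  also have "\<dots> = (\<Sum>s\<in>X ` space M. expectation (\<lambda>x. h s * indicator (X -` {s} \<inter> space M) x))"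
    using sets by (intro Bochner_Integration.integral_sum integrable_mult_right)
      (auto simp: integrable_indicator_iff emeasure_eq_measure)
  also have "\<dots> = (\<Sum>s\<in>X ` space M. law X s * h s)"
    using sets by (intro sum.cong) (auto simp: law_def mult.commute)
  finally show ?thesis .
qed

lemma sum_law: "simple_function M X \<Longrightarrow> (\<Sum>s\<in>X ` space M. law X s) = 1"
  using expectation_simple[of X "\<lambda>_. 1"] by (simp add: prob_space)

lemma rv_entropy_eq_expectation:
  "simple_function M X \<Longrightarrow> rv_entropy X = expectation (\<lambda>x. - ln (law X (X x)))"
  by (subst expectation_simple) (auto simp: rv_entropy_def sum_negf)

lemma rv_entropy_nonneg: "0 \<le> rv_entropy X"
proof -
  have "law X s * ln (law X s) \<le> 0" for s
    using law_nonneg[of X s] law_le_1[of X s]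
    by (metis ln_le_zero_iff less_eq_real_def mult_nonneg_nonpos mult_zero_left)
  then show ?thesis by (simp add: rv_entropy_def sum_nonpos)
qed

text \<open>
  Every entropy estimate below is an instance of this comparison: the entropy of \<open>X\<close> is at most
  its cross entropy against any subprobability vector \<open>q\<close> charging all values that \<open>X\<close> takes with
  positive probability. The proof is \<open>ln t \<le> t - 1\<close> at \<open>t = q s / law X s\<close>.
\<close>

lemma gibbs_inequality:
  assumes X: "simple_function M X"
    and q: "\<And>s. 0 \<le> q s" "(\<Sum>s\<in>X ` space M. q s) \<le> 1"
    and abs: "\<And>s. s \<in> X ` space M \<Longrightarrow> law X s > 0 \<Longrightarrow> q s > 0"
  shows "rv_entropy X \<le> expectation (\<lambda>x. - ln (q (X x)))"
proof -
  have "law X s * (ln (q s) - ln (law X s)) \<le> q s - law X s" if s: "s \<in> X ` space M" for s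
  proof (cases "law X s > 0")
    case True
    note qs = abs[OF s True]
    have "ln (q s) - ln (law X s) = ln (q s / law X s)" using True qs by (simp add: ln_div)
    also have "\<dots> \<le> q s / law X s - 1" using True qs by (intro ln_le_minus_one) auto
    finally have "law X s * (ln (q s) - ln (law X s)) \<le> law X s * (q s / law X s - 1)"
      using True by (intro mult_left_mono) auto
    then show ?thesis using True by (simp add: right_diff_distrib)
  qed (use law_nonneg[of X s] q in auto)
  then have "(\<Sum>s\<in>X ` space M. law X s * (ln (q s) - ln (law X s))) \<le> (\<Sum>s\<in>X ` space M. q s - law X s)"
    by (rule sum_mono)
  also have "\<dots> \<le> 0" using q(2) sum_law[OF X] by (simp add: sum_subtractf)
  finally show ?thesis
    by (subst expectation_simple[OF X]) (simp add: rv_entropy_def right_diff_distrib sum_subtractf sum_negf)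
qed

lemma event_simple: "simple_function M X \<Longrightarrow> X -` S \<inter> space M \<in> events"
  by (rule simple_functionD(2))

text \<open>
  Logarithms of probabilities split into sums only where the factors are positive. This lemma and
  \<open>expectation_mono_law\<close> let such identities and inequalities be checked on the values of positive
  probability alone.
\<close>

lemma expectation_cong_law:
  assumes X: "simple_function M X" and eq: "\<And>s. law X s > 0 \<Longrightarrow> h s = (h' s :: real)"
  shows "expectation (\<lambda>x. h (X x)) = expectation (\<lambda>x. h' (X x))"
  unfolding expectation_simple[OF X]
  by (rule sum.cong[OF refl]) (use eq law_nonneg[of X] in \<open>auto simp: less_le\<close>)

text \<open>
  Coarsening a random variable merges values, so it raises the probability of the value taken at
  each point and lowers the entropy.
\<close>

lemma rv_entropy_comp_le:
  assumes X: "simple_function M X"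
  shows "rv_entropy (\<lambda>x. f (X x)) \<le> rv_entropy X"
proof -
  have fX: "simple_function M (\<lambda>x. f (X x))" using X by (rule simple_function_compose1)
  have meas: "(\<lambda>x. f (X x)) -` {s} \<inter> space M \<in> events" for s
    using measurable_simple_function[OF fX] by (auto intro: measurable_sets)
  have le: "law X s \<le> law (\<lambda>x. f (X x)) (f s)" for s
    unfolding law_def by (rule finite_measure_mono[OF _ meas]) auto
  have "rv_entropy (\<lambda>x. f (X x)) = (\<Sum>s\<in>X ` space M. law X s * - ln (law (\<lambda>x. f (X x)) (f s)))"
    by (subst rv_entropy_eq_expectation[OF fX])
      (rule expectation_simple[OF X, of "\<lambda>s. - ln (law (\<lambda>x. f (X x)) (f s))"])
  also have "\<dots> \<le> (\<Sum>s\<in>X ` space M. law X s * - ln (law X s))"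
  proof (rule sum_mono)
    fix s
    show "law X s * - ln (law (\<lambda>x. f (X x)) (f s)) \<le> law X s * - ln (law X s)"
      using le[of s] law_nonneg[of X s] by (cases "law X s = 0") (auto intro!: mult_left_mono)
  qed
  finally show ?thesis by (simp add: rv_entropy_def sum_negf)
qed

end

section \<open>Measure-preserving maps and itineraries\<close>

locale measure_preserving = prob_space +
  fixes T :: "'a \<Rightarrow> 'a"
  assumes T_measurable: "T \<in> measurable M M"
    and T_invariant: "distr M M T = M"
begin

lemma T_space: "x \<in> space M \<Longrightarrow> (T ^^ i) x \<in> space M"
  by (induction i) (auto intro: measurable_space[OF T_measurable])

lemma iter_measurable: "(T ^^ i) \<in> measurable M M"
  by (induction i) (auto intro: measurable_compose[OF _ T_measurable] simp: id_def measurable_ident o_def)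

lemma iter_invariant: "distr M M (T ^^ i) = M"
proof (induction i)
  case (Suc i)
  have "distr M M (T ^^ Suc i) = distr (distr M M (T ^^ i)) M T"
    using distr_distr[OF T_measurable iter_measurable[of i]] by simp
  then show ?case by (simp only: Suc T_invariant)
qed (simp add: id_def distr_id)

lemma expectation_iter:
  fixes f :: "'a \<Rightarrow> real"
  assumes "f \<in> borel_measurable M"
  shows "expectation (\<lambda>x. f ((T ^^ i) x)) = expectation f"
  using integral_distr[OF iter_measurable assms, of i] by (simp add: iter_invariant)

text \<open>
  The \<open>Y\<close>-name of length \<open>n\<close>: the sequence of values of the observable \<open>Y\<close> along an orbit. Names
  with respect to the cell function of a partition encode the iterated join of that partition.
\<close>

definition name :: "('a \<Rightarrow> 'b) \<Rightarrow> nat \<Rightarrow> 'a \<Rightarrow> 'b list" where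
  "name Y n x = map (\<lambda>i. Y ((T ^^ i) x)) [0..<n]"

lemma length_name [simp]: "length (name Y n x) = n"
  by (simp add: name_def)

lemma nth_name: "i < n \<Longrightarrow> name Y n x ! i = Y ((T ^^ i) x)"
  by (simp add: name_def)

lemma iter_iter: "(T ^^ i) ((T ^^ j) x) = (T ^^ (j + i)) x"
  by (simp add: funpow_add[THEN fun_cong, unfolded o_apply, symmetric] add.commute)

lemma name_add: "name Y (m + n) x = name Y m x @ name Y n ((T ^^ m) x)"
  by (rule nth_equalityI) (auto simp: nth_name nth_append iter_iter)

lemma window_name: "i + m \<le> n \<Longrightarrow> take m (drop i (name Y n x)) = name Y m ((T ^^ i) x)"
  by (rule nth_equalityI) (auto simp: nth_name iter_iter)

lemma simple_iter:
  assumes "simple_function M Y"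
  shows "simple_function M (\<lambda>x. Y ((T ^^ i) x))"
  using simple_function_comp[OF iter_measurable assms, of i] by (simp add: o_def)

lemma law_iter:
  assumes "simple_function M Y"
  shows "law (\<lambda>x. Y ((T ^^ i) x)) s = law Y s"
proof -
  have "law Y s = measure (distr M M (T ^^ i)) (Y -` {s} \<inter> space M)"
    by (simp add: law_def iter_invariant)
  also have "\<dots> = prob ((T ^^ i) -` (Y -` {s} \<inter> space M) \<inter> space M)"
    by (rule measure_distr[OF iter_measurable event_simple[OF assms]])
  also have "(T ^^ i) -` (Y -` {s} \<inter> space M) \<inter> space M = (\<lambda>x. Y ((T ^^ i) x)) -` {s} \<inter> space M"
    using T_space by auto
  finally show ?thesis by (simp add: law_def)
qed

lemma simple_name:
  assumes Y: "simple_function M Y"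
  shows "simple_function M (name Y n)"
proof (induction n)
  case (Suc n)
  have "name Y (Suc n) = (\<lambda>x. name Y n x @ [Y ((T ^^ n) x)])"
    by (auto simp: name_def)
  then show ?case
    using simple_function_compose2[OF Suc simple_iter[OF Y, of n], of "\<lambda>u b. u @ [b]"] by simp
qed (simp add: name_def simple_function_const)

text \<open>
  The comparison vector is the product of the laws of the first \<open>m\<close> and the last \<open>n\<close> symbols. By
  invariance the last \<open>n\<close> symbols have the law of \<open>name Y n\<close>, so the cross entropy is the sum of
  the two entropies.
\<close>

lemma name_entropy_subadditive:
  assumes Y: "simple_function M Y"
  shows "rv_entropy (name Y (m + n)) \<le> rv_entropy (name Y m) + rv_entropy (name Y n)"
proof -
  let ?X = "name Y (m + n)"
  let ?q = "\<lambda>s. law (name Y m) (take m s) * law (name Y n) (drop m s)"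
  note sm = simple_name[OF Y]
  have fin: "finite (name Y k ` space M)" for k using sm[of k] by (simp add: simple_function_def)
  have split: "take m (?X x) = name Y m x" "drop m (?X x) = name Y n ((T ^^ m) x)" for x
    by (simp_all add: name_add)
  have inj: "inj_on (\<lambda>s. (take m s, drop m s)) (?X ` space M)"
    by (rule inj_on_inverseI[where g = "\<lambda>(u, v). u @ v"]) simp
  have "(\<Sum>s\<in>?X ` space M. ?q s) =
      (\<Sum>(u, v)\<in>(\<lambda>s. (take m s, drop m s)) ` ?X ` space M. law (name Y m) u * law (name Y n) v)"
    by (subst sum.reindex[OF inj]) simp
  also have "\<dots> \<le> (\<Sum>(u, v)\<in>name Y m ` space M \<times> name Y n ` space M. law (name Y m) u * law (name Y n) v)"
    using fin by (intro sum_mono2) (auto simp: split T_space law_nonneg)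
  also have "\<dots> = (\<Sum>u\<in>name Y m ` space M. law (name Y m) u) * (\<Sum>v\<in>name Y n ` space M. law (name Y n) v)"
    by (simp add: sum_product sum.cartesian_product)
  finally have sum_q: "(\<Sum>s\<in>?X ` space M. ?q s) \<le> 1" using sum_law[OF sm] by simp
  have pos: "0 < law (name Y m) (take m s) \<and> 0 < law (name Y n) (drop m s)" if "0 < law ?X s" for s
  proof -
    have "law ?X s \<le> law (name Y m) (take m s)"
      unfolding law_def by (rule finite_measure_mono[OF _ event_simple[OF sm]]) (auto simp: split)
    moreover have "law ?X s \<le> law (\<lambda>x. name Y n ((T ^^ m) x)) (drop m s)"
      unfolding law_def
      by (rule finite_measure_mono[OF _ event_simple[OF simple_iter[OF sm]]]) (auto simp: split)
    ultimately show ?thesis using that law_iter[OF sm] by (metis order_less_le_trans)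
  qed
  have "rv_entropy ?X \<le> expectation (\<lambda>x. - ln (?q (?X x)))"
    using sum_q pos by (intro gibbs_inequality[OF sm]) (auto simp: law_nonneg)
  also have "\<dots> = expectation (\<lambda>x. - ln (law (name Y m) (take m (?X x))) - ln (law (name Y n) (drop m (?X x))))"
    by (rule expectation_cong_law[OF sm]) (drule pos, simp add: ln_mult)
  also have "\<dots> = expectation (\<lambda>x. - ln (law (name Y m) (name Y m x)) +
      - ln (law (name Y n) (name Y n ((T ^^ m) x))))"
    by (simp add: split)
  also have "\<dots> = rv_entropy (name Y m) + expectation (\<lambda>x. - ln (law (name Y n) (name Y n ((T ^^ m) x))))"
    unfolding rv_entropy_eq_expectation[OF sm]
    by (intro Bochner_Integration.integral_add integrable_simple simple_function_compose1[OF sm]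
          simple_function_compose1[OF simple_iter[OF sm]])
  also have "expectation (\<lambda>x. - ln (law (name Y n) (name Y n ((T ^^ m) x)))) = rv_entropy (name Y n)"
    unfolding rv_entropy_eq_expectation[OF sm]
    by (rule expectation_iter[where f = "\<lambda>x. - ln (law (name Y n) (name Y n x))"])
      (intro borel_measurable_simple_function simple_function_compose1[OF sm])
  finally show ?thesis .
qed

lemma convergent_name_entropy:
  "simple_function M Y \<Longrightarrow> convergent (\<lambda>n. rv_entropy (name Y n) / real n)"
  using fekete_nonneg[of "\<lambda>n. rv_entropy (name Y n)", OF name_entropy_subadditive rv_entropy_nonneg] .

end

section \<open>The Kolmogorov--Sinai generator theorem\<close>

lemma sum_lists_prod:
  fixes g :: "nat \<Rightarrow> 'b \<Rightarrow> real"
  assumes "finite B"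
  shows "(\<Sum>c\<in>{c. set c \<subseteq> B \<and> length c = n}. \<Prod>i<n. g i (c ! i)) = (\<Prod>i<n. \<Sum>b\<in>B. g i b)"
proof (induction n arbitrary: g)
  case 0
  have "{c :: 'b list. set c \<subseteq> B \<and> length c = 0} = {[]}" by auto
  then show ?case by simp
next
  case (Suc n)
  have eq: "{c. set c \<subseteq> B \<and> length c = Suc n} =
      (\<lambda>(b, c). b # c) ` (B \<times> {c. set c \<subseteq> B \<and> length c = n})"
    by (auto simp: length_Suc_conv image_iff)
  have inj: "inj_on (\<lambda>(b, c). b # c) (B \<times> {c. set c \<subseteq> B \<and> length c = n})"
    by (auto simp: inj_on_def)
  have "(\<Sum>c\<in>{c. set c \<subseteq> B \<and> length c = Suc n}. \<Prod>i<Suc n. g i (c ! i)) =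
      (\<Sum>(b, c)\<in>B \<times> {c. set c \<subseteq> B \<and> length c = n}. g 0 b * (\<Prod>i<n. g (Suc i) (c ! i)))"
    unfolding eq sum.reindex[OF inj]
    by (intro sum.cong) (auto simp: prod.lessThan_Suc_shift simp del: prod.lessThan_Suc)
  also have "\<dots> = (\<Sum>b\<in>B. g 0 b) * (\<Sum>c\<in>{c. set c \<subseteq> B \<and> length c = n}. \<Prod>i<n. g (Suc i) (c ! i))"
    by (simp add: sum_product sum.cartesian_product)
  also have "\<dots> = (\<Prod>i<Suc n. \<Sum>b\<in>B. g i b)"
    using Suc[of "\<lambda>i. g (Suc i)"] by (simp add: prod.lessThan_Suc_shift del: prod.lessThan_Suc)
  finally show ?case .
qed

context measure_preserving
begin

text \<open>
  Passing from a partition to its cell function turns the entropy of partitions into the entropy of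
  random variables.
\<close>

definition cell :: "'a set set \<Rightarrow> 'a \<Rightarrow> 'a set" where
  "cell \<xi> x = (THE C. C \<in> \<xi> \<and> x \<in> C)"

lemma cell_eq_iff:
  assumes "\<xi> \<in> finite_partitions M" "x \<in> space M" "C \<in> \<xi>"
  shows "cell \<xi> x = C \<longleftrightarrow> x \<in> C"
proof -
  have part: "partition_on (space M) \<xi>" using assms by (simp add: finite_partitions_def)
  have "\<exists>C. C \<in> \<xi> \<and> x \<in> C" using partition_onD1[OF part] assms(2) by auto
  moreover have "C = D" if "C \<in> \<xi>" "x \<in> C" "D \<in> \<xi>" "x \<in> D" for C D
    using disjointD[OF partition_onD2[OF part] that(1,3)] that by auto
  ultimately have ex: "\<exists>!C. C \<in> \<xi> \<and> x \<in> C" by auto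
  show ?thesis
    unfolding cell_def using theI'[OF ex] ex assms(3) by metis
qed

lemma cell_in: "\<xi> \<in> finite_partitions M \<Longrightarrow> x \<in> space M \<Longrightarrow> cell \<xi> x \<in> \<xi>"
proof -
  assume \<xi>: "\<xi> \<in> finite_partitions M" and x: "x \<in> space M"
  then have "x \<in> \<Union>\<xi>" using partition_onD1[of "space M" \<xi>] by (simp add: finite_partitions_def)
  then show ?thesis using cell_eq_iff[OF \<xi> x] by auto
qed

lemma simple_cell:
  assumes "\<xi> \<in> finite_partitions M"
  shows "simple_function M (cell \<xi>)"
  unfolding simple_function_def
proof (intro conjI ballI)
  show "finite (cell \<xi> ` space M)"
    by (rule finite_subset[of _ \<xi>]) (use assms cell_in in \<open>auto simp: finite_partitions_def\<close>)
  fix C assume "C \<in> cell \<xi> ` space M"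
  then have C: "C \<in> \<xi>" using assms cell_in by auto
  then have ev: "C \<in> events" using assms by (auto simp: finite_partitions_def)
  moreover have "cell \<xi> -` {C} \<inter> space M = C"
    using cell_eq_iff[OF assms _ C] sets.sets_into_space[OF ev] by auto
  ultimately show "cell \<xi> -` {C} \<inter> space M \<in> events" by simp
qed

text \<open>
  The atoms of the iterated join are the level sets of the name map, up to the empty set, which
  contributes nothing.
\<close>

lemma partition_entropy_iterated_join:
  assumes \<xi>: "\<xi> \<in> finite_partitions M"
  shows "partition_entropy M (iterated_join T M \<xi> n) = rv_entropy (name (cell \<xi>) n)"
proof -
  let ?X = "name (cell \<xi>) n"
  let ?E = "\<lambda>s. ?X -` {s} \<inter> space M"
  let ?J = "iterated_join T M \<xi> n"
  have atom: "{x \<in> space M. \<forall>i<n. (T ^^ i) x \<in> c i} = ?E (map c [0..<n])" if "\<forall>i<n. c i \<in> \<xi>" for c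
    using that cell_eq_iff[OF \<xi> T_space] by (auto simp: name_def)
  have J: "?J - {{}} = ?E ` ?X ` space M"
  proof (intro equalityI subsetI)
    fix E assume "E \<in> ?J - {{}}"
    then obtain c where c: "\<forall>i<n. c i \<in> \<xi>" "E = {x \<in> space M. \<forall>i<n. (T ^^ i) x \<in> c i}" "E \<noteq> {}"
      unfolding iterated_join_def by blast
    then have E: "E = ?E (map c [0..<n])" using atom[of c] by simp
    obtain x where "x \<in> E" using c(3) by auto
    then have x: "x \<in> space M" "?X x = map c [0..<n]" unfolding E by auto
    have "E = ?E (?X x)" unfolding x(2) by (rule E)
    with x(1) show "E \<in> ?E ` ?X ` space M" by blast
  next
    fix E assume "E \<in> ?E ` ?X ` space M"
    then obtain x where x: "x \<in> space M" "E = ?E (?X x)" by auto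
    let ?c = "\<lambda>i. cell \<xi> ((T ^^ i) x)"
    have c: "\<forall>i<n. ?c i \<in> \<xi>" using cell_in[OF \<xi>] T_space x by auto
    have "E = {x \<in> space M. \<forall>i<n. (T ^^ i) x \<in> ?c i}"
      unfolding atom[OF c] x(2) by (simp only: name_def)
    then have "E \<in> ?J"
      unfolding iterated_join_def mem_Collect_eq by (intro exI[of _ ?c] conjI c)
    moreover have "E \<noteq> {}" using x by auto
    ultimately show "E \<in> ?J - {{}}" by simp
  qed
  have fin: "finite (?X ` space M)"
    using simple_name[OF simple_cell[OF \<xi>]] by (simp add: simple_function_def)
  have "finite (?J - {{}})" unfolding J using fin by simp
  then have finJ: "finite ?J" by simp
  have inj: "inj_on ?E (?X ` space M)" by (auto simp: inj_on_def)
  have "(\<Sum>C\<in>?J. prob C * ln (prob C)) = (\<Sum>C\<in>?J - {{}}. prob C * ln (prob C))"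
    using finJ by (intro sum.mono_neutral_right) auto
  also have "\<dots> = (\<Sum>s\<in>?X ` space M. law ?X s * ln (law ?X s))"
    unfolding J sum.reindex[OF inj] by (simp add: law_def)
  finally show ?thesis by (simp add: partition_entropy_def rv_entropy_def)
qed

text \<open>
  If \<open>Y\<close> can be guessed from \<open>m\<close> consecutive symbols of \<open>X\<close>, then \<open>Y\<close>-names are encoded by slightly
  longer \<open>X\<close>-names at a small cost per symbol. The pair of names is compared with the vector that
  draws the \<open>X\<close>-name from its law and then, independently for each \<open>i < n\<close>, puts mass \<open>1 - \<epsilon>\<close> on the
  guess \<open>\<phi>\<close> for the \<open>i\<close>-th \<open>Y\<close>-symbol and mass \<open>\<epsilon> / r\<close> on each of the \<open>r\<close> symbols otherwise. A
  correct guess costs \<open>- ln (1 - \<epsilon>)\<close>, and a wrong one at most \<open>ln (r / \<epsilon>)\<close> more. This replaces the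
  usual estimate by conditional entropies.
\<close>

lemma name_entropy_approx:
  fixes \<phi> :: "'b list \<Rightarrow> 'c"
  assumes X: "simple_function M X" and Y: "simple_function M Y" and \<epsilon>: "0 < \<epsilon>" "\<epsilon> < 1"
  shows "rv_entropy (name Y n) \<le> rv_entropy (name X (n + m)) +
     real n * (- ln (1 - \<epsilon>) + prob {x \<in> space M. \<phi> (name X m x) \<noteq> Y x} * ln (real (card (Y ` space M)) / \<epsilon>))"
proof -
  let ?B = "Y ` space M"
  define r where "r = real (card ?B)"
  define k where "k a b = (if a = b then 1 - \<epsilon> else \<epsilon> / r)" for a b :: 'c
  let ?W = "name X (n + m)"
  let ?Z = "\<lambda>x. (name Y n x, ?W x)"
  let ?K = "\<lambda>c w. \<Prod>i<n. k (\<phi> (take m (drop i w))) (c ! i)"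
  let ?q = "\<lambda>(c, w). law ?W w * ?K c w"
  have finB: "finite ?B" using Y by (simp add: simple_function_def)
  have "?B \<noteq> {}" using not_empty by simp
  then have cardB: "card ?B \<noteq> 0" using finB by simp
  then have r: "r \<ge> 1" unfolding r_def by linarith
  have kpos: "k a b > 0" for a b using \<epsilon> r by (simp add: k_def)
  have ksum: "(\<Sum>b\<in>?B. k a b) \<le> 1" for a
  proof -
    have "(\<Sum>b\<in>?B. k a b) \<le> (\<Sum>b\<in>?B. (if a = b then 1 - \<epsilon> else 0) + \<epsilon> / r)"
      using \<epsilon> r by (intro sum_mono) (auto simp: k_def)
    also have "\<dots> = (if a \<in> ?B then 1 - \<epsilon> else 0) + \<epsilon>"
      using finB cardB by (simp add: sum.distrib r_def)
    finally show ?thesis using \<epsilon> by (simp split: if_splits)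
  qed
  have SW: "simple_function M ?W" and SYn: "simple_function M (name Y n)"
    using X Y by (auto intro: simple_name)
  have SZ: "simple_function M ?Z"
    using simple_function_compose2[OF SYn SW, of Pair] .
  have finW: "finite (?W ` space M)" using SW by (simp add: simple_function_def)
  let ?L = "{c. set c \<subseteq> ?B \<and> length c = n}"
  have finL: "finite ?L" by (rule finite_lists_length_eq[OF finB])
  have Kpos: "?K c w > 0" for c w using kpos by (simp add: prod_pos)
  have qnn: "?q z \<ge> 0" for z
    using law_nonneg[of ?W "snd z"] Kpos[of "snd z" "fst z"] by (simp add: case_prod_beta)
  have "(\<Sum>z\<in>?Z ` space M. ?q z) \<le> (\<Sum>z\<in>?L \<times> ?W ` space M. ?q z)"
  proof (rule sum_mono2)
    show "finite (?L \<times> ?W ` space M)" using finL finW by simp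
    show "?Z ` space M \<subseteq> ?L \<times> ?W ` space M" by (auto simp: name_def T_space)
  qed (rule qnn)
  also have "\<dots> = (\<Sum>w\<in>?W ` space M. \<Sum>c\<in>?L. law ?W w * ?K c w)"
    by (subst sum.swap) (simp add: sum.cartesian_product)
  also have "\<dots> \<le> (\<Sum>w\<in>?W ` space M. law ?W w)"
  proof (rule sum_mono)
    fix w
    have "(\<Sum>c\<in>?L. ?K c w) = (\<Prod>i<n. \<Sum>b\<in>?B. k (\<phi> (take m (drop i w))) b)"
      by (rule sum_lists_prod[OF finB])
    also have "\<dots> \<le> (\<Prod>i<n. 1)"
      by (rule prod_mono) (use ksum kpos in \<open>auto intro!: sum_nonneg intro: less_imp_le\<close>)
    finally have "(\<Sum>c\<in>?L. ?K c w) \<le> 1" by simp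
    from mult_left_mono[OF this law_nonneg[of ?W w]]
    show "(\<Sum>c\<in>?L. law ?W w * ?K c w) \<le> law ?W w"
      by (simp add: sum_distrib_left)
  qed
  finally have qsum: "(\<Sum>z\<in>?Z ` space M. ?q z) \<le> 1" using sum_law[OF SW] by simp
  have pos: "law ?W (snd z) > 0" if "law ?Z z > 0" for z
  proof -
    have "law ?Z z \<le> law ?W (snd z)"
      unfolding law_def by (rule finite_measure_mono[OF _ event_simple[OF SW]]) auto
    with that show ?thesis by simp
  qed
  let ?bad = "\<lambda>x. \<phi> (name X m x) \<noteq> Y x"
  let ?f = "\<lambda>x. - ln (1 - \<epsilon>) + (if ?bad x then ln (r / \<epsilon>) else 0)"
  let ?g = "\<lambda>i w c. - ln (k (\<phi> (take m (drop i w))) (c ! i))"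
  have Sf: "simple_function M ?f"
    by (rule simple_function_compose2[OF simple_name[OF X] Y,
          where h = "\<lambda>u b. - ln (1 - \<epsilon>) + (if \<phi> u \<noteq> b then ln (r / \<epsilon>) else 0)"])
  have Sg: "simple_function M (\<lambda>x. ?g i (?W x) (name Y n x))" for i
    by (rule simple_function_compose2[OF SW SYn])
  have "rv_entropy (name Y n) \<le> rv_entropy ?Z"
    using rv_entropy_comp_le[OF SZ, of fst] by simp
  also have "\<dots> \<le> expectation (\<lambda>x. - ln (?q (?Z x)))"
  proof (rule gibbs_inequality[OF SZ qnn qsum])
    fix z assume "law ?Z z > 0"
    then show "?q z > 0" using pos Kpos by (simp add: case_prod_beta)
  qed
  also have "\<dots> = expectation (\<lambda>x. (\<lambda>(c, w). - ln (law ?W w) + (\<Sum>i<n. ?g i w c)) (?Z x))"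
  proof (rule expectation_cong_law[OF SZ])
    fix z assume "law ?Z z > 0"
    from pos[OF this] have "ln (?q z) = ln (law ?W (snd z)) + ln (?K (fst z) (snd z))"
      using Kpos[of "snd z" "fst z"] unfolding case_prod_beta by (intro ln_mult_pos)
    moreover have "ln (?K (fst z) (snd z)) = (\<Sum>i<n. - ?g i (snd z) (fst z))"
      by (subst ln_prod) (simp_all add: less_imp_neq[OF kpos, symmetric])
    ultimately show "- ln (?q z) = (\<lambda>(c, w). - ln (law ?W w) + (\<Sum>i<n. ?g i w c)) z"
      by (simp add: sum_negf case_prod_beta)
  qed
  also have "\<dots> = expectation (\<lambda>x. - ln (law ?W (?W x))) + expectation (\<lambda>x. \<Sum>i<n. ?g i (?W x) (name Y n x))"
    unfolding prod.case
    by (intro Bochner_Integration.integral_add integrable_simple simple_function_compose1[OF SW]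
         Bochner_Integration.integrable_sum Sg)
  also have "expectation (\<lambda>x. \<Sum>i<n. ?g i (?W x) (name Y n x)) = (\<Sum>i<n. expectation (\<lambda>x. ?g i (?W x) (name Y n x)))"
    by (intro Bochner_Integration.integral_sum integrable_simple Sg)
  also have "expectation (\<lambda>x. - ln (law ?W (?W x))) = rv_entropy ?W"
    by (rule rv_entropy_eq_expectation[OF SW, symmetric])
  also have "(\<Sum>i<n. expectation (\<lambda>x. ?g i (?W x) (name Y n x))) \<le> (\<Sum>i<n. expectation ?f)"
  proof (rule sum_mono)
    fix i assume "i \<in> {..<n}"
    then have i: "i < n" by simp
    have "expectation (\<lambda>x. ?g i (?W x) (name Y n x)) \<le> expectation (\<lambda>x. ?f ((T ^^ i) x))"
    proof (rule integral_mono[OF integrable_simple[OF Sg] integrable_simple[OF simple_iter[OF Sf]]])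
      fix x
      have ln: "ln (1 - \<epsilon>) \<le> 0" "ln (\<epsilon> / r) = - ln (r / \<epsilon>)" using \<epsilon> r by (auto simp: ln_div)
      have "?g i (?W x) (name Y n x) = - ln (k (\<phi> (name X m ((T ^^ i) x))) (Y ((T ^^ i) x)))"
        using i by (simp add: window_name nth_name)
      also have "\<dots> \<le> ?f ((T ^^ i) x)" using ln by (simp add: k_def)
      finally show "?g i (?W x) (name Y n x) \<le> ?f ((T ^^ i) x)" .
    qed
    also have "\<dots> = expectation ?f"
      by (rule expectation_iter[OF borel_measurable_simple_function[OF Sf]])
    finally show "expectation (\<lambda>x. ?g i (?W x) (name Y n x)) \<le> expectation ?f" .
  qed
  also have "expectation ?f = - ln (1 - \<epsilon>) + prob {x \<in> space M. ?bad x} * ln (r / \<epsilon>)"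
  proof -
    have "simple_function M ?bad"
      by (rule simple_function_compose2[OF simple_name[OF X] Y])
    then have ev: "{x \<in> space M. ?bad x} \<in> events"
      using event_simple[of ?bad "{True}"] by (simp add: vimage_def Int_def conj_commute)
    have "expectation ?f = expectation (\<lambda>x. - ln (1 - \<epsilon>) + ln (r / \<epsilon>) * indicator {x \<in> space M. ?bad x} x)"
      by (intro Bochner_Integration.integral_cong) (auto simp: indicator_def)
    also have "\<dots> = - ln (1 - \<epsilon>) + ln (r / \<epsilon>) * prob {x \<in> space M. ?bad x}"
      using ev by (subst Bochner_Integration.integral_add)
        (auto simp: prob_space integrable_indicator_iff emeasure_eq_measure)
    finally show ?thesis by simp
  qed
  finally show ?thesis unfolding r_def[symmetric] by simp
qed

text \<open>
  An observable whose names approximate every finite partition computes the metric entropy: in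
  \<open>name_entropy_approx\<close> the parameter \<open>\<epsilon>\<close> is chosen first, to make the cost of a correct guess small,
  and then the error probability is made small compared with \<open>1 / ln (r / \<epsilon>)\<close>. The auxiliary
  partition \<open>\<xi>\<^sub>0\<close>, which determines the observable, ensures that the supremum is attained.
\<close>

lemma metric_entropy_generator:
  assumes X: "simple_function M X"
    and \<xi>\<^sub>0: "\<xi>\<^sub>0 \<in> finite_partitions M" "\<And>x. x \<in> space M \<Longrightarrow> X x = g (cell \<xi>\<^sub>0 x)"
    and gen: "\<And>\<xi> \<delta>. \<xi> \<in> finite_partitions M \<Longrightarrow> \<delta> > 0 \<Longrightarrow>
      \<exists>m \<phi>. prob {x \<in> space M. \<phi> (name X m x) \<noteq> cell \<xi> x} < \<delta>"
    and h: "(\<lambda>n. rv_entropy (name X n) / real n) \<longlonglongrightarrow> h"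
  shows "metric_entropy T M = ereal h"
proof (rule antisym)
  have ent: "(\<lambda>n. rv_entropy (name (cell \<xi>) n) / real n) \<longlonglongrightarrow> entropy_wrt T M \<xi>"
    if "\<xi> \<in> finite_partitions M" for \<xi>
    using convergent_name_entropy[OF simple_cell[OF that]]
    by (simp add: entropy_wrt_def partition_entropy_iterated_join[OF that] convergent_LIMSEQ_iff)
  show "metric_entropy T M \<le> ereal h"
    unfolding metric_entropy_def
  proof (rule SUP_least)
    fix \<xi> assume \<xi>: "\<xi> \<in> finite_partitions M"
    let ?Y = "cell \<xi>"
    have "entropy_wrt T M \<xi> \<le> h + \<tau>" if \<tau>: "\<tau> > 0" for \<tau>
    proof -
      define \<epsilon> where "\<epsilon> = 1 - exp (- \<tau> / 2)"
      have \<epsilon>: "0 < \<epsilon>" "\<epsilon> < 1" using \<tau> by (auto simp: \<epsilon>_def)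
      have ln\<epsilon>: "- ln (1 - \<epsilon>) = \<tau> / 2" by (simp add: \<epsilon>_def)
      define R where "R = \<bar>ln (real (card (?Y ` space M)) / \<epsilon>)\<bar> + 1"
      have R: "R > 0" by (simp add: R_def add_nonneg_pos)
      then have "\<tau> / 2 / R > 0" using \<tau> by simp
      from gen[OF \<xi> this] obtain m \<phi> where
        \<delta>: "prob {x \<in> space M. \<phi> (name X m x) \<noteq> ?Y x} < \<tau> / 2 / R" (is "?\<delta> < _") by blast
      have "?\<delta> * ln (real (card (?Y ` space M)) / \<epsilon>) \<le> ?\<delta> * R"
        by (intro mult_left_mono) (auto simp: R_def)
      also have "\<dots> \<le> \<tau> / 2 / R * R" using \<delta> R by (intro mult_right_mono) auto
      also have "\<dots> = \<tau> / 2" using R by simp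
      finally have "real n * (- ln (1 - \<epsilon>) + ?\<delta> * ln (real (card (?Y ` space M)) / \<epsilon>)) \<le> real n * \<tau>" for n
        using ln\<epsilon> by (intro mult_left_mono) auto
      then have le: "rv_entropy (name ?Y n) \<le> rv_entropy (name X (n + m)) + real n * \<tau>" for n
        using name_entropy_approx[OF X simple_cell[OF \<xi>] \<epsilon>, of n m \<phi>] by (meson add_left_mono order_trans)
      have "(\<lambda>n. rv_entropy (name X (n + m)) / real (n + m)) \<longlonglongrightarrow> h"
        using h by (rule LIMSEQ_ignore_initial_segment)
      moreover have "(\<lambda>n. 1 + real m / real n) \<longlonglongrightarrow> 1 + 0"
        by (intro tendsto_intros lim_const_over_n)
      ultimately have "(\<lambda>n. rv_entropy (name X (n + m)) / real (n + m) * (1 + real m / real n) + \<tau>) \<longlonglongrightarrow> h * (1 + 0) + \<tau>"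
        by (intro tendsto_intros)
      then have lim: "(\<lambda>n. rv_entropy (name X (n + m)) / real (n + m) * (1 + real m / real n) + \<tau>) \<longlonglongrightarrow> h + \<tau>"
        by simp
      show ?thesis
      proof (rule LIMSEQ_le[OF ent[OF \<xi>] lim], intro exI[of _ 1] allI impI)
        fix n :: nat assume n: "n \<ge> 1"
        have "rv_entropy (name ?Y n) / real n \<le> (rv_entropy (name X (n + m)) + real n * \<tau>) / real n"
          using le by (intro divide_right_mono) auto
        also have "\<dots> = rv_entropy (name X (n + m)) / real (n + m) * (1 + real m / real n) + \<tau>"
        proof -
          have eq: "1 + real m / real n = real (n + m) / real n" using n by (simp add: add_divide_distrib)
          have "rv_entropy (name X (n + m)) / real (n + m) * (1 + real m / real n)
              = rv_entropy (name X (n + m)) / real n"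
            unfolding eq using n by (simp del: of_nat_add)
          then show ?thesis using n by (simp add: add_divide_distrib)
        qed
        finally show "rv_entropy (name ?Y n) / real n \<le> rv_entropy (name X (n + m)) / real (n + m) * (1 + real m / real n) + \<tau>" .
      qed
    qed
    then have "entropy_wrt T M \<xi> \<le> h" by (rule field_le_epsilon)
    then show "ereal (entropy_wrt T M \<xi>) \<le> ereal h" by simp
  qed
  have "rv_entropy (name X n) \<le> rv_entropy (name (cell \<xi>\<^sub>0) n)" for n
  proof -
    have eq: "name X n x = map g (name (cell \<xi>\<^sub>0) n x)" if "x \<in> space M" for x
      using \<xi>\<^sub>0(2)[OF T_space[OF that]] by (simp add: name_def)
    have "rv_entropy (name X n) = rv_entropy (\<lambda>x. map g (name (cell \<xi>\<^sub>0) n x))"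
      by (rule rv_entropy_cong) (rule eq)
    also have "\<dots> \<le> rv_entropy (name (cell \<xi>\<^sub>0) n)"
      by (rule rv_entropy_comp_le[OF simple_name[OF simple_cell[OF \<xi>\<^sub>0(1)]]])
    finally show ?thesis .
  qed
  then have "h \<le> entropy_wrt T M \<xi>\<^sub>0"
    by (intro LIMSEQ_le[OF h ent[OF \<xi>\<^sub>0(1)]] exI[of _ 0] allI impI divide_right_mono) auto
  then show "ereal h \<le> metric_entropy T M"
    unfolding metric_entropy_def by (intro SUP_upper2[OF \<xi>\<^sub>0(1)]) simp
qed

end

section \<open>Cylinder sets\<close>

definition initial_word :: "nat \<Rightarrow> (nat \<Rightarrow> nat) \<Rightarrow> nat list" where
  "initial_word n x = map x [0..<n]"

text \<open>
  Finite unions of cylinders of a common length. They form an algebra, which makes them more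
  convenient than single cylinders.
\<close>

definition cylinders :: "nat \<Rightarrow> nat \<Rightarrow> nat list set \<Rightarrow> (nat \<Rightarrow> nat) set" where
  "cylinders M n S = {x \<in> full_shift M. initial_word n x \<in> S}"

lemma length_initial_word [simp]: "length (initial_word n x) = n"
  by (simp add: initial_word_def)

lemma nth_initial_word: "i < n \<Longrightarrow> initial_word n x ! i = x i"
  by (simp add: initial_word_def)

lemma take_initial_word: "m \<le> n \<Longrightarrow> take m (initial_word n x) = initial_word m x"
  by (simp add: initial_word_def take_map)

lemma initial_word_in_words: "x \<in> full_shift M \<Longrightarrow> initial_word n x \<in> words M n"
  by (auto simp: initial_word_def words_def full_shift_def)

lemma finite_words: "finite (words M n)"
  unfolding words_def using finite_lists_length_eq[of "{1..M}" n] by (simp add: conj_commute)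

lemma cylinder_eq_cylinders: "cylinder M w = cylinders M (length w) {w}"
  by (auto simp: cylinder_def cylinders_def list_eq_iff_nth_eq nth_initial_word)

lemma cylinders_refine: "m \<le> n \<Longrightarrow> cylinders M m S = cylinders M n {w. take m w \<in> S}"
  by (auto simp: cylinders_def take_initial_word)

lemma cylinders_Un: "cylinders M n S \<union> cylinders M n S' = cylinders M n (S \<union> S')"
  and cylinders_Int: "cylinders M n S \<inter> cylinders M n S' = cylinders M n (S \<inter> S')"
  and cylinders_Compl: "full_shift M - cylinders M n S = cylinders M n (- S)"
  by (auto simp: cylinders_def)

lemma cylinders_subset: "cylinders M n S \<subseteq> full_shift M"
  by (auto simp: cylinders_def)

lemma space_shift_borel [simp]: "space (shift_borel M) = full_shift M"
  by (simp add: shift_borel_def space_restrict_space)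

lemma measurable_coordinate: "(\<lambda>x::nat \<Rightarrow> nat. x i) \<in> measurable borel (count_space UNIV)"
proof -
  have "(\<lambda>x::nat \<Rightarrow> nat. x i) \<in> borel_measurable borel"
    by (intro borel_measurable_continuous_onI continuous_on_product_coordinates)
  then show ?thesis
    by (simp add: measurable_cong_sets[OF refl sets_borel_eq_count_space])
qed

lemma initial_word_measurable: "initial_word n \<in> measurable (shift_borel M) (count_space UNIV)"
proof -
  have "initial_word n -` {w} \<inter> space borel \<in> sets borel" for w
  proof (cases "length w = n")
    case True
    have "initial_word n -` {w} \<inter> space borel = {x \<in> space borel. \<forall>i\<in>{..<n}. x i = w ! i}"
      using True by (auto simp: list_eq_iff_nth_eq nth_initial_word)
    also have "\<dots> \<in> sets borel"
    proof (rule sets.sets_Collect_finite_All)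
      fix i
      have "(\<lambda>x::nat \<Rightarrow> nat. x i) -` {w ! i} \<inter> space borel \<in> sets borel"
        by (rule measurable_sets[OF measurable_coordinate]) simp
      then show "{x \<in> space borel. x i = w ! i} \<in> sets borel"
        by (simp add: vimage_def)
    qed simp
    finally show ?thesis .
  next
    case False
    then have "initial_word n -` {w} = {}" by auto
    then show ?thesis by simp
  qed
  then have "initial_word n \<in> measurable borel (count_space UNIV)"
    by (subst measurable_count_space_eq2_countable) auto
  then show ?thesis unfolding shift_borel_def by (rule measurable_restrict_space1)
qed

lemma cylinders_sets: "cylinders M n S \<in> sets (shift_borel M)"
  using measurable_sets[OF initial_word_measurable[of n M], of S]
  by (simp add: cylinders_def vimage_def Int_def conj_commute)

text \<open>
  The Borel \<open>\<sigma>\<close>-algebra of a countable product is generated by the coordinates, and a coordinate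
  is read off from a sufficiently long initial word.
\<close>

lemma sets_shift_borel:
  "sets (shift_borel M) = sigma_sets (full_shift M) {cylinders M n S | n S. True}"
proof
  let ?E = "{cylinders M n S | n S. True}"
  show "sigma_sets (full_shift M) ?E \<subseteq> sets (shift_borel M)"
    using cylinders_sets sets.sigma_sets_subset[of ?E "shift_borel M"] by auto
  have sub: "?E \<subseteq> Pow (full_shift M)" using cylinders_subset by auto
  let ?G = "sigma (full_shift M) ?E"
  have coord: "(\<lambda>x. x i) \<in> measurable ?G (borel :: nat measure)" for i
  proof -
    have "(\<lambda>x. x i) -` {a} \<inter> full_shift M = cylinders M (Suc i) {w. w ! i = a}" for a
      by (auto simp: cylinders_def nth_initial_word)
    then have "(\<lambda>x. x i) \<in> measurable ?G (count_space UNIV)"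
      using sub by (subst measurable_count_space_eq2_countable)
        (auto simp: space_measure_of_conv sets_measure_of intro!: sigma_sets.Basic)
    then show ?thesis
      by (simp add: measurable_cong_sets[OF refl sets_borel_eq_count_space])
  qed
  have id: "(\<lambda>x. x) \<in> measurable ?G (borel :: (nat \<Rightarrow> nat) measure)"
    by (rule measurable_coordinatewise_then_product) (rule coord)
  show "sets (shift_borel M) \<subseteq> sigma_sets (full_shift M) ?E"
  proof
    fix B assume "B \<in> sets (shift_borel M)"
    then obtain A where A: "A \<in> sets borel" "B = full_shift M \<inter> A"
      by (auto simp: shift_borel_def sets_restrict_space)
    from measurable_sets[OF id A(1)] show "B \<in> sigma_sets (full_shift M) ?E"
      using sub by (simp add: A(2) space_measure_of_conv sets_measure_of Int_commute)
  qed
qed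

lemma measure_eqI_cylinders:
  assumes fin: "finite_measure \<mu>" and sets: "sets \<mu> = sets (shift_borel M)" "sets \<nu> = sets (shift_borel M)"
    and eq: "\<And>n S. emeasure \<mu> (cylinders M n S) = emeasure \<nu> (cylinders M n S)"
  shows "\<mu> = \<nu>"
proof (rule measure_eqI_generator_eq[where E = "{cylinders M n S | n S. True}"
      and A = "\<lambda>_. full_shift M" and \<Omega> = "full_shift M"])
  show "Int_stable {cylinders M n S | n S. True}"
  proof (rule Int_stableI, clarify)
    fix m n S S'
    have "cylinders M m S \<inter> cylinders M n S' =
        cylinders M (max m n) ({w. take m w \<in> S} \<inter> {w. take n w \<in> S'})"
      by (simp add: cylinders_refine[of m "max m n"] cylinders_refine[of n "max m n"] cylinders_Int)
    then show "\<exists>k S''. cylinders M m S \<inter> cylinders M n S' = cylinders M k S'' \<and> True" by auto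
  qed
  have "full_shift M = cylinders M 0 UNIV" by (auto simp: cylinders_def)
  then show "range (\<lambda>_. full_shift M) \<subseteq> {cylinders M n S | n S. True}" by auto
  interpret finite_measure \<mu> by fact
  show "emeasure \<mu> (full_shift M) \<noteq> \<infinity>" by simp
qed (use sets eq in \<open>auto simp: sets_shift_borel cylinders_def\<close>)

text \<open>
  The sets approximable by cylinders in both measures simultaneously form a \<open>\<sigma>\<close>-algebra. A single
  approximation for two measures is what the proof of absolute continuity of equilibrium states
  requires.
\<close>

lemma cylinders_approx:
  assumes fin: "finite_measure \<mu>" "finite_measure \<nu>"
    and sets: "sets \<mu> = sets (shift_borel M)" "sets \<nu> = sets (shift_borel M)"
    and B: "B \<in> sets (shift_borel M)" and \<epsilon>: "\<epsilon> > 0"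
  shows "\<exists>n S. measure \<mu> (sym_diff B (cylinders M n S)) < \<epsilon> \<and> measure \<nu> (sym_diff B (cylinders M n S)) < \<epsilon>"
proof -
  interpret \<mu>: finite_measure \<mu> by fact
  interpret \<nu>: finite_measure \<nu> by fact
  define d where "d A = measure \<mu> A + measure \<nu> A" for A
  have space: "space \<mu> = full_shift M" "space \<nu> = full_shift M"
    using sets[THEN sets_eq_imp_space_eq] by auto
  have d_mono: "d A \<le> d A'" if "A \<subseteq> A'" "A' \<in> sets (shift_borel M)" for A A'
    unfolding d_def using that sets by (intro add_mono \<mu>.finite_measure_mono \<nu>.finite_measure_mono) auto
  have d_Un: "d (A \<union> A') \<le> d A + d A'" if "A \<in> sets (shift_borel M)" "A' \<in> sets (shift_borel M)" for A A'
    using measure_Un_le[of A \<mu> A'] measure_Un_le[of A \<nu> A'] that sets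
    by (simp add: d_def)
  have "B \<in> sigma_sets (full_shift M) {cylinders M n S | n S. True}"
    using B by (simp add: sets_shift_borel)
  then have "\<forall>\<epsilon>>0. \<exists>n S. d (sym_diff B (cylinders M n S)) < \<epsilon>"
  proof induction
    case (Basic a)
    then obtain n S where "a = cylinders M n S" by auto
    moreover have "d {} = 0" by (simp add: d_def)
    ultimately show ?case by (intro allI impI exI[of _ n] exI[of _ S]) simp
  next
    case Empty
    have "d (sym_diff {} (cylinders M 0 {})) = 0" by (simp add: d_def cylinders_def)
    then show ?case by (intro allI impI exI[of _ 0] exI[of _ "{}"]) simp
  next
    case (Compl a)
    show ?case
    proof (intro allI impI)
      fix \<epsilon> :: real assume "\<epsilon> > 0"
      with Compl obtain n S where S: "d (sym_diff a (cylinders M n S)) < \<epsilon>" by blast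
      have "a \<subseteq> full_shift M"
        using sigma_sets_into_sp[OF _ Compl(1)] cylinders_subset by auto
      then have "sym_diff (full_shift M - a) (cylinders M n (- S)) = sym_diff a (cylinders M n S)"
        using cylinders_subset[of M n S] by (auto simp: cylinders_Compl[symmetric])
      with S show "\<exists>n S. d (sym_diff (full_shift M - a) (cylinders M n S)) < \<epsilon>"
        by (intro exI[of _ n] exI[of _ "- S"]) simp
    qed
  next
    case (Union a)
    show ?case
    proof (intro allI impI)
      fix \<epsilon> :: real assume \<epsilon>: "\<epsilon> > 0"
      have am: "a i \<in> sets (shift_borel M)" for i
        using Union(1) by (simp add: sets_shift_borel)
      let ?U = "\<Union>i. a i"
      have Um: "?U \<in> sets (shift_borel M)" "(\<Union>i<k. a i) \<in> sets (shift_borel M)" for k :: nat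
        using am by auto
      have fin_Un: "\<forall>\<epsilon>>0. \<exists>n S. d (sym_diff (\<Union>i<k. a i) (cylinders M n S)) < \<epsilon>" for k
      proof (induction k)
        case 0
        have "d (sym_diff {} (cylinders M 0 {})) = 0" by (simp add: d_def cylinders_def)
        then show ?case by (intro allI impI exI[of _ 0] exI[of _ "{}"]) simp
      next
        case (Suc k)
        show ?case
        proof (intro allI impI)
          fix \<epsilon> :: real assume \<epsilon>: "\<epsilon> > 0"
          then have "\<epsilon> / 2 > 0" by simp
          with Suc obtain m S where S: "d (sym_diff (\<Union>i<k. a i) (cylinders M m S)) < \<epsilon> / 2" by blast
          from Union(2)[of k] \<open>\<epsilon> / 2 > 0\<close> obtain n S' where
            S': "d (sym_diff (a k) (cylinders M n S')) < \<epsilon> / 2" by blast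
          let ?S = "{w. take m w \<in> S} \<union> {w. take n w \<in> S'}"
          have eq: "cylinders M (max m n) ?S = cylinders M m S \<union> cylinders M n S'"
            by (simp add: cylinders_refine[of m "max m n"] cylinders_refine[of n "max m n"] cylinders_Un)
          have "d (sym_diff (\<Union>i<Suc k. a i) (cylinders M (max m n) ?S)) \<le>
              d (sym_diff (\<Union>i<k. a i) (cylinders M m S) \<union> sym_diff (a k) (cylinders M n S'))"
            using am Um(2) cylinders_sets unfolding eq
            by (intro d_mono) (auto simp: less_Suc_eq)
          also have "\<dots> \<le> d (sym_diff (\<Union>i<k. a i) (cylinders M m S)) + d (sym_diff (a k) (cylinders M n S'))"
            using am Um(2) cylinders_sets by (intro d_Un) auto
          also have "\<dots> < \<epsilon>" using S S' by simp
          finally show "\<exists>n S. d (sym_diff (\<Union>i<Suc k. a i) (cylinders M n S)) < \<epsilon>" by blast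
        qed
      qed
      have "(\<lambda>k. d (?U - (\<Union>i<k. a i))) \<longlonglongrightarrow> 0"
      proof -
        have dec: "decseq (\<lambda>k. ?U - (\<Union>i<k. a i))"
          by (auto simp: decseq_def)
        have int: "(\<Inter>k. ?U - (\<Union>i<k. a i)) = {}" by auto
        have "(\<lambda>k. measure \<mu> (?U - (\<Union>i<k. a i))) \<longlonglongrightarrow> measure \<mu> (\<Inter>k. ?U - (\<Union>i<k. a i))"
          using Um sets dec by (intro \<mu>.finite_Lim_measure_decseq) auto
        moreover have "(\<lambda>k. measure \<nu> (?U - (\<Union>i<k. a i))) \<longlonglongrightarrow> measure \<nu> (\<Inter>k. ?U - (\<Union>i<k. a i))"
          using Um sets dec by (intro \<nu>.finite_Lim_measure_decseq) auto
        ultimately have "(\<lambda>k. d (?U - (\<Union>i<k. a i))) \<longlonglongrightarrow> d (\<Inter>k. ?U - (\<Union>i<k. a i))"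
          unfolding d_def by (rule tendsto_add)
        then show ?thesis unfolding int by (simp add: d_def)
      qed
      then have "\<forall>\<^sub>F k in sequentially. d (?U - (\<Union>i<k. a i)) < \<epsilon> / 2"
        using \<epsilon> by (intro order_tendstoD(2)) auto
      then obtain k where k: "d (?U - (\<Union>i<k. a i)) < \<epsilon> / 2"
        by (auto simp: eventually_sequentially)
      obtain n S where S: "d (sym_diff (\<Union>i<k. a i) (cylinders M n S)) < \<epsilon> / 2"
        using fin_Un \<epsilon> by (meson half_gt_zero)
      have "d (sym_diff ?U (cylinders M n S)) \<le> d ((?U - (\<Union>i<k. a i)) \<union> sym_diff (\<Union>i<k. a i) (cylinders M n S))"
        using Um cylinders_sets by (intro d_mono) auto
      also have "\<dots> \<le> d (?U - (\<Union>i<k. a i)) + d (sym_diff (\<Union>i<k. a i) (cylinders M n S))"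
        using Um cylinders_sets by (intro d_Un) auto
      also have "\<dots> < \<epsilon>" using k S by simp
      finally show "\<exists>n S. d (sym_diff ?U (cylinders M n S)) < \<epsilon>" by blast
    qed
  qed
  with \<epsilon> obtain n S where "d (sym_diff B (cylinders M n S)) < \<epsilon>" by blast
  then have "measure \<mu> (sym_diff B (cylinders M n S)) < \<epsilon>" "measure \<nu> (sym_diff B (cylinders M n S)) < \<epsilon>"
    unfolding d_def using measure_nonneg[of \<mu> "sym_diff B (cylinders M n S)"]
      measure_nonneg[of \<nu> "sym_diff B (cylinders M n S)"] by linarith+
  then show ?thesis by blast
qed

lemma measure_cylinders:
  assumes fin: "finite_measure \<mu>" and sets: "sets \<mu> = sets (shift_borel M)"
  shows "measure \<mu> (cylinders M n S) = (\<Sum>w\<in>words M n \<inter> S. measure \<mu> (cylinder M w))"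
proof -
  interpret finite_measure \<mu> by fact
  have "cylinders M n S = (\<Union>w\<in>words M n \<inter> S. cylinder M w)"
  proof (intro equalityI subsetI)
    fix x assume x: "x \<in> cylinders M n S"
    then have "initial_word n x \<in> words M n \<inter> S" "x \<in> cylinder M (initial_word n x)"
      using initial_word_in_words by (auto simp: cylinders_def cylinder_eq_cylinders)
    then show "x \<in> (\<Union>w\<in>words M n \<inter> S. cylinder M w)" by blast
  qed (auto simp: cylinder_eq_cylinders cylinders_def words_def)
  moreover have "disjoint_family_on (cylinder M) (words M n \<inter> S)"
    by (auto simp: disjoint_family_on_def cylinder_eq_cylinders cylinders_def words_def)
  moreover have "cylinder M ` (words M n \<inter> S) \<subseteq> sets \<mu>"
    by (auto simp: sets cylinder_eq_cylinders cylinders_sets)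
  ultimately show ?thesis
    using finite_words[of M n] finite_measure_finite_Union[of "words M n \<inter> S" "cylinder M"] by simp
qed

section \<open>Measures with prescribed cylinder weights\<close>

text \<open>
  The measure is the image of Lebesgue measure on \<open>[0,1)\<close> under a coding of points by nested
  intervals: the word \<open>w\<close> receives an interval of length \<open>m w\<close> with left end point \<open>l w\<close>, subdivided
  from left to right into the intervals of the words \<open>w @ [i]\<close>. Consistency of the weights says
  exactly that these fill the interval of \<open>w\<close>, so every point has an infinite code.
\<close>

lemma exists_measure_with_cylinder_weights:
  fixes m :: "nat list \<Rightarrow> real"
  assumes nonneg: "\<And>w. m w \<ge> 0" and one: "m [] = 1"
    and split: "\<And>w. set w \<subseteq> {1..M} \<Longrightarrow> m w = (\<Sum>i=1..M. m (w @ [i]))"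
  shows "\<exists>\<mu>. prob_space \<mu> \<and> sets \<mu> = sets (shift_borel M) \<and>
           (\<forall>n. \<forall>w\<in>words M n. measure \<mu> (cylinder M w) = m w)"
proof -
  define l where "l w = (\<Sum>k<length w. \<Sum>j\<in>{1..<w ! k}. m (take k w @ [j]))" for w
  define digit where "digit w r = (LEAST i. r < (\<Sum>j=1..i. m (w @ [j])))" for w r
  \<comment> \<open>\<open>W n t\<close> is the word of length \<open>n\<close> whose interval contains \<open>t\<close>.\<close>
  define W where "W n t = rec_nat [] (\<lambda>_ w. w @ [digit w (t - l w)]) n" for n t
  have W_0 [simp]: "W 0 t = []" and W_Suc: "W (Suc n) t = W n t @ [digit (W n t) (t - l (W n t))]" for n t
    by (simp_all add: W_def)
  have l_Nil: "l [] = 0" by (simp add: l_def)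
  have l_snoc: "l (w @ [i]) = l w + (\<Sum>j\<in>{1..<i}. m (w @ [j]))" for w i
    unfolding l_def by (simp add: nth_append)
  have partial: "(\<Sum>j\<in>{1..<i}. m (w @ [j])) + m (w @ [i]) = (\<Sum>j=1..i. m (w @ [j]))" if "i \<ge> 1" for w i
  proof -
    have "{1..i} = insert i {1..<i}" using that by auto
    then show ?thesis by simp
  qed
  have l_nonneg: "l w \<ge> 0" for w unfolding l_def by (intro sum_nonneg nonneg)
  have nested: "l u \<le> l (u @ [i]) \<and> l (u @ [i]) + m (u @ [i]) \<le> l u + m u"
    if u: "set u \<subseteq> {1..M}" and i: "i \<in> {1..M}" for u i
  proof -
    have "(\<Sum>j=1..i. m (u @ [j])) \<le> m u"
      unfolding split[OF u] by (rule sum_mono2) (use i nonneg in auto)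
    then show ?thesis
      using partial[of i u] i by (auto simp: l_snoc intro!: sum_nonneg nonneg)
  qed
  have top: "l w + m w \<le> 1" if "set w \<subseteq> {1..M}" for w
    using that
  proof (induction w rule: rev_induct)
    case (snoc i u)
    then show ?case using nested[of u i] by auto
  qed (simp add: l_Nil one)
  have W_unique: "W (length w) t = w" if "set w \<subseteq> {1..M}" "l w \<le> t" "t < l w + m w" for w t
    using that
  proof (induction w rule: rev_induct)
    case (snoc i u)
    then have u: "set u \<subseteq> {1..M}" and i: "i \<in> {1..M}" by auto
    have Wu: "W (length u) t = u" using snoc nested[OF u i] by auto
    have "digit u (t - l u) = i"
      unfolding digit_def
    proof (rule Least_equality)
      show "t - l u < (\<Sum>j=1..i. m (u @ [j]))"
        using snoc.prems(3) partial[of i u] i by (simp add: l_snoc)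
      fix k assume k: "t - l u < (\<Sum>j=1..k. m (u @ [j]))"
      show "i \<le> k"
      proof (rule ccontr)
        assume "\<not> i \<le> k"
        then have "(\<Sum>j=1..k. m (u @ [j])) \<le> (\<Sum>j\<in>{1..<i}. m (u @ [j]))"
          by (intro sum_mono2) (auto intro: nonneg)
        then show False using k snoc.prems(2) by (simp add: l_snoc)
      qed
    qed
    then show ?case by (simp add: W_Suc Wu)
  qed simp
  have W_inv: "W n t \<in> words M n \<and> l (W n t) \<le> t \<and> t < l (W n t) + m (W n t)" if t: "t \<in> {0..<1}" for n t
  proof (induction n)
    case 0
    then show ?case using t by (auto simp: words_def l_Nil one)
  next
    case (Suc n)
    let ?u = "W n t" let ?r = "t - l (W n t)"
    have u: "set ?u \<subseteq> {1..M}" using Suc by (auto simp: words_def)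
    have ex: "?r < (\<Sum>j=1..M. m (?u @ [j]))" using Suc split[OF u] by auto
    let ?i = "digit ?u ?r"
    have i1: "?r < (\<Sum>j=1..?i. m (?u @ [j]))"
      unfolding digit_def by (rule LeastI[of _ M]) (rule ex)
    have iM: "?i \<le> M" unfolding digit_def by (rule Least_le) (rule ex)
    have "?i \<noteq> 0"
    proof
      assume "?i = 0"
      then show False using i1 Suc by simp
    qed
    then have i: "?i \<in> {1..M}" using iM by auto
    have "\<not> ?r < (\<Sum>j=1..?i - 1. m (?u @ [j]))"
      using not_less_Least[of "?i - 1" "\<lambda>i. ?r < (\<Sum>j=1..i. m (?u @ [j]))"] i
      unfolding digit_def[symmetric] by auto
    moreover have "{1..?i - 1} = {1..<?i}" by auto
    ultimately have "(\<Sum>j\<in>{1..<?i}. m (?u @ [j])) \<le> ?r" by simp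
    then show ?case
      using Suc i i1 partial[of ?i ?u] by (auto simp: W_Suc l_snoc words_def)
  qed
  define x where "x t n = last (W (Suc n) t)" for t n
  have initial_word_x: "initial_word n (x t) = W n t" for n t
  proof (induction n)
    case (Suc n)
    have "x t n = digit (W n t) (t - l (W n t))" by (simp add: x_def W_Suc)
    moreover have "initial_word (Suc n) (x t) = initial_word n (x t) @ [x t n]"
      by (simp add: initial_word_def)
    ultimately show ?case by (simp only: Suc W_Suc)
  qed (simp add: initial_word_def)
  define U where "U = restrict_space lborel {0..<1::real}"
  have space_U: "space U = {0..<1}" by (simp add: U_def space_restrict_space)
  interpret U: prob_space U
    by (rule prob_spaceI) (simp add: U_def space_restrict_space emeasure_restrict_space)
  have x_shift: "x t \<in> full_shift M" if "t \<in> {0..<1}" for t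
    unfolding full_shift_def
  proof clarify
    fix n
    have "W (Suc n) t \<in> words M (Suc n)" using W_inv[OF that] by blast
    moreover have "W (Suc n) t \<noteq> []" by (simp add: W_Suc)
    ultimately show "x t n \<in> {1..M}" unfolding x_def words_def using last_in_set by blast
  qed
  have pre: "x -` cylinders M n S \<inter> {0..<1} = (\<Union>w\<in>words M n \<inter> S. {l w..<l w + m w} \<inter> {0..<1})" for n S
  proof (intro equalityI subsetI)
    fix t assume t: "t \<in> x -` cylinders M n S \<inter> {0..<1}"
    then have "W n t \<in> S" by (simp add: cylinders_def initial_word_x)
    then show "t \<in> (\<Union>w\<in>words M n \<inter> S. {l w..<l w + m w} \<inter> {0..<1})"
      using W_inv[of t n] t by auto
  next
    fix t assume "t \<in> (\<Union>w\<in>words M n \<inter> S. {l w..<l w + m w} \<inter> {0..<1})"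
    then obtain w where w: "w \<in> words M n" "w \<in> S" "l w \<le> t" "t < l w + m w" "t \<in> {0..<1}" by auto
    then have "W n t = w" using W_unique[of w t] by (auto simp: words_def)
    then show "t \<in> x -` cylinders M n S \<inter> {0..<1}"
      using w x_shift[OF w(5)] by (auto simp: cylinders_def initial_word_x)
  qed
  have x_meas: "x \<in> measurable U (shift_borel M)"
  proof (rule measurable_sigma_sets[OF sets_shift_borel])
    fix A assume "A \<in> {cylinders M n S | n S. True}"
    then obtain n S where A: "A = cylinders M n S" by auto
    have "(\<Union>w\<in>words M n \<inter> S. {l w..<l w + m w} \<inter> {0..<1}) \<in> sets lborel"
      using finite_words[of M n] by (intro sets.finite_UN) auto
    then show "x -` A \<inter> space U \<in> sets U"
      unfolding A space_U pre unfolding U_def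
      by (subst sets_restrict_space_iff) auto
  qed (use x_shift space_U in \<open>auto simp: cylinders_def\<close>)
  let ?\<mu> = "distr U (shift_borel M) x"
  show ?thesis
  proof (intro exI[of _ ?\<mu>] conjI allI ballI)
    show "prob_space ?\<mu>" by (rule U.prob_space_distr[OF x_meas])
    fix n w assume w: "w \<in> words M n"
    then have wM: "set w \<subseteq> {1..M}" and len: "length w = n" by (auto simp: words_def)
    have "{l w..<l w + m w} \<inter> {0..<1} = {l w..<l w + m w}"
      using l_nonneg[of w] top[OF wM] by auto
    then have pre_w: "x -` cylinder M w \<inter> space U = {l w..<l w + m w}"
      using w len by (simp add: cylinder_eq_cylinders pre space_U)
    have "measure ?\<mu> (cylinder M w) = measure U {l w..<l w + m w}"
      using measure_distr[OF x_meas, of "cylinder M w"] pre_w by (simp add: cylinder_eq_cylinders cylinders_sets)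
    also have "\<dots> = measure lborel {l w..<l w + m w}"
      unfolding U_def using l_nonneg[of w] top[OF wM] by (subst measure_restrict_space) auto
    also have "\<dots> = m w" using nonneg[of w] by simp
    finally show "measure ?\<mu> (cylinder M w) = m w" .
  qed simp
qed

section \<open>The full shift as a measure-preserving system\<close>

lemma shift_iter: "(shift ^^ i) x n = x (n + i)"
  by (induction i arbitrary: n) (simp_all add: shift_def)

lemma shift_full_shift: "x \<in> full_shift M \<Longrightarrow> shift x \<in> full_shift M"
  by (simp add: full_shift_def shift_def)

lemma initial_word_shift_iter: "initial_word n ((shift ^^ i) x) = drop i (initial_word (n + i) x)"
  by (rule nth_equalityI) (simp_all add: nth_initial_word shift_iter add.commute)

lemma shift_iter_full_shift: "x \<in> full_shift M \<Longrightarrow> (shift ^^ i) x \<in> full_shift M"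
  by (simp add: full_shift_def shift_iter)

lemma shift_iter_preimage:
  "(shift ^^ i) -` cylinders M n S \<inter> full_shift M = cylinders M (n + i) {w. drop i w \<in> S}"
  by (auto simp: cylinders_def initial_word_shift_iter shift_iter_full_shift)

lemma shift_measurable: "shift \<in> measurable (shift_borel M) (shift_borel M)"
proof (rule measurable_sigma_sets[OF sets_shift_borel])
  fix A assume "A \<in> {cylinders M n S | n S. True}"
  then obtain n S where "A = cylinders M n S" by auto
  then show "shift -` A \<inter> space (shift_borel M) \<in> sets (shift_borel M)"
    using shift_iter_preimage[of 1 M n S] by (simp add: cylinders_sets)
qed (auto simp: cylinders_def shift_full_shift)

lemma invariant_measures_iff:
  "\<nu> \<in> invariant_measures M \<longleftrightarrow> measure_preserving \<nu> shift \<and> sets \<nu> = sets (shift_borel M)"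
proof -
  have "(\<forall>B\<in>sets \<nu>. emeasure \<nu> (shift -` B \<inter> space \<nu>) = emeasure \<nu> B) \<longleftrightarrow> distr \<nu> \<nu> shift = \<nu>"
    if s: "sets \<nu> = sets (shift_borel M)"
  proof -
    have meas: "shift \<in> measurable \<nu> \<nu>"
      using shift_measurable by (simp add: measurable_cong_sets[OF s s])
    show ?thesis
    proof
      assume "distr \<nu> \<nu> shift = \<nu>"
      then show "\<forall>B\<in>sets \<nu>. emeasure \<nu> (shift -` B \<inter> space \<nu>) = emeasure \<nu> B"
        using emeasure_distr[OF meas] by metis
    next
      assume "\<forall>B\<in>sets \<nu>. emeasure \<nu> (shift -` B \<inter> space \<nu>) = emeasure \<nu> B"
      then show "distr \<nu> \<nu> shift = \<nu>"
        by (intro measure_eqI) (auto simp: emeasure_distr[OF meas])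
    qed
  qed
  moreover have "shift \<in> measurable \<nu> \<nu>" if s: "sets \<nu> = sets (shift_borel M)"
    using shift_measurable by (simp add: measurable_cong_sets[OF s s])
  ultimately show ?thesis
    by (auto simp: invariant_measures_def measure_preserving_def measure_preserving_axioms_def)
qed

locale shift_system = measure_preserving \<nu> shift for \<nu> :: "(nat \<Rightarrow> nat) measure" +
  fixes K :: nat
  assumes sets_\<nu>: "sets \<nu> = sets (shift_borel K)"
begin

lemma space_\<nu>: "space \<nu> = full_shift K"
  using sets_eq_imp_space_eq[OF sets_\<nu>] by simp

lemma simple_first: "simple_function \<nu> (\<lambda>x. x 0)"
  unfolding simple_function_def
proof (intro conjI ballI)
  have "(\<lambda>x. x 0) ` space \<nu> \<subseteq> {1..K}" by (auto simp: space_\<nu> full_shift_def)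
  then show "finite ((\<lambda>x. x 0) ` space \<nu>)" by (rule finite_subset) simp
  fix a
  have "(\<lambda>x. x 0) -` {a} \<inter> space \<nu> = cylinders K 1 {[a]}"
    by (auto simp: space_\<nu> cylinders_def initial_word_def)
  then show "(\<lambda>x. x 0) -` {a} \<inter> space \<nu> \<in> sets \<nu>" by (simp add: sets_\<nu> cylinders_sets)
qed

lemma name_first: "name (\<lambda>x. x 0) = initial_word"
  by (intro ext) (simp add: name_def initial_word_def shift_iter)

lemma simple_initial_word: "simple_function \<nu> (initial_word n)"
  using simple_name[OF simple_first] by (simp add: name_first)

lemma law_initial_word: "length w = n \<Longrightarrow> law (initial_word n) w = prob (cylinder K w)"
  by (auto simp: law_def cylinder_eq_cylinders cylinders_def space_\<nu> intro!: arg_cong[where f = prob])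

definition shift_entropy :: real where
  "shift_entropy = lim (\<lambda>n. rv_entropy (initial_word n) / real n)"

lemma shift_entropy: "(\<lambda>n. rv_entropy (initial_word n) / real n) \<longlonglongrightarrow> shift_entropy"
  using convergent_name_entropy[OF simple_first]
  by (simp add: shift_entropy_def convergent_LIMSEQ_iff name_first)

text \<open>
  The zeroth coordinate generates: every cell of a finite partition is approximated by a union of
  cylinders, and outside the union of the approximation errors the initial word decides which cell
  contains the point.
\<close>

lemma metric_entropy_shift: "metric_entropy shift \<nu> = ereal shift_entropy"
proof -
  define \<xi>\<^sub>0 where "\<xi>\<^sub>0 = (\<lambda>i. cylinder K [i]) ` {1..K}"
  have cyl: "cylinder K [i] = {x \<in> full_shift K. x 0 = i}" for i
    by (auto simp: cylinder_def)
  have ne: "(\<lambda>_. i) \<in> cylinder K [i]" if "i \<in> {1..K}" for i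
    using that by (auto simp: cyl full_shift_def)
  have \<xi>\<^sub>0: "\<xi>\<^sub>0 \<in> finite_partitions \<nu>"
    unfolding finite_partitions_def mem_Collect_eq
  proof (intro conjI)
    show "finite \<xi>\<^sub>0" by (simp add: \<xi>\<^sub>0_def)
    show "\<xi>\<^sub>0 \<subseteq> sets \<nu>" by (auto simp: \<xi>\<^sub>0_def sets_\<nu> cylinder_eq_cylinders cylinders_sets)
    show "partition_on (space \<nu>) \<xi>\<^sub>0"
    proof (rule partition_onI)
      show "\<Union>\<xi>\<^sub>0 = space \<nu>" by (auto simp: \<xi>\<^sub>0_def cyl space_\<nu>) (auto simp: full_shift_def)
      show "disjnt p q" if "p \<in> \<xi>\<^sub>0" "q \<in> \<xi>\<^sub>0" "p \<noteq> q" for p q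
        using that by (auto simp: \<xi>\<^sub>0_def cyl disjnt_def)
      show "{} \<notin> \<xi>\<^sub>0" using ne unfolding \<xi>\<^sub>0_def by blast
    qed
  qed
  show ?thesis
  proof (rule metric_entropy_generator[OF simple_first \<xi>\<^sub>0, where g = "\<lambda>C. (SOME y. y \<in> C) 0", unfolded name_first])
    fix x assume x: "x \<in> space \<nu>"
    have "cell \<xi>\<^sub>0 x = cylinder K [x 0]"
      using x by (subst cell_eq_iff[OF \<xi>\<^sub>0 x]) (auto simp: \<xi>\<^sub>0_def cyl space_\<nu> full_shift_def)
    moreover have "(SOME y. y \<in> cylinder K [x 0]) \<in> cylinder K [x 0]"
      by (rule someI[of _ x]) (use x in \<open>auto simp: cyl space_\<nu>\<close>)
    ultimately show "x 0 = (SOME y. y \<in> cell \<xi>\<^sub>0 x) 0" by (simp add: cyl)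
  next
    fix \<xi> :: "(nat \<Rightarrow> nat) set set" and \<delta> :: real
    assume \<xi>: "\<xi> \<in> finite_partitions \<nu>" and \<delta>: "\<delta> > 0"
    have fin: "finite \<xi>" and sub: "\<xi> \<subseteq> sets \<nu>" using \<xi> by (auto simp: finite_partitions_def)
    let ?\<epsilon> = "\<delta> / (real (card \<xi>) + 1)"
    have \<epsilon>: "?\<epsilon> > 0" using \<delta> by simp
    have "\<exists>n S. prob (sym_diff C (cylinders K n S)) < ?\<epsilon>" if "C \<in> \<xi>" for C
      using cylinders_approx[OF finite_measure_axioms finite_measure_axioms sets_\<nu> sets_\<nu> _ \<epsilon>, of C]
        that sub sets_\<nu> by auto
    then obtain N S where NS: "\<And>C. C \<in> \<xi> \<Longrightarrow> prob (sym_diff C (cylinders K (N C) (S C))) < ?\<epsilon>"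
      by metis
    define m where "m = (\<Sum>C\<in>\<xi>. N C)"
    have m: "N C \<le> m" if "C \<in> \<xi>" for C
      unfolding m_def using member_le_sum[of C \<xi> N] fin that by simp
    \<comment> \<open>Only points outside all approximation errors matter; for their words the cell is unique.\<close>
    define \<phi> where "\<phi> w = (THE C. C \<in> \<xi> \<and> take (N C) w \<in> S C)" for w
    let ?D = "\<lambda>C. sym_diff C (cylinders K (N C) (S C))"
    have "{x \<in> space \<nu>. \<phi> (initial_word m x) \<noteq> cell \<xi> x} \<subseteq> (\<Union>C\<in>\<xi>. ?D C)"
    proof (rule subsetI, rule ccontr)
      fix x assume x: "x \<in> {x \<in> space \<nu>. \<phi> (initial_word m x) \<noteq> cell \<xi> x}" and nD: "x \<notin> (\<Union>C\<in>\<xi>. ?D C)"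
      have iff: "take (N C) (initial_word m x) \<in> S C \<longleftrightarrow> cell \<xi> x = C" if C: "C \<in> \<xi>" for C
      proof -
        have "x \<in> C \<longleftrightarrow> x \<in> cylinders K (N C) (S C)" using nD C by auto
        also have "\<dots> \<longleftrightarrow> take (N C) (initial_word m x) \<in> S C"
          using x m[OF C] by (simp add: cylinders_def space_\<nu> take_initial_word)
        finally show ?thesis using cell_eq_iff[OF \<xi> _ C] x by auto
      qed
      have "\<phi> (initial_word m x) = cell \<xi> x"
        unfolding \<phi>_def
      proof (rule the_equality)
        show "cell \<xi> x \<in> \<xi> \<and> take (N (cell \<xi> x)) (initial_word m x) \<in> S (cell \<xi> x)"
          using cell_in[OF \<xi>, of x] x iff by auto
      qed (use iff in auto)
      then show False using x by simp
    qed
    then have "prob {x \<in> space \<nu>. \<phi> (initial_word m x) \<noteq> cell \<xi> x} \<le> prob (\<Union>C\<in>\<xi>. ?D C)"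
      using fin sub sets_\<nu> cylinders_sets by (intro finite_measure_mono sets.finite_UN) auto
    also have "\<dots> \<le> (\<Sum>C\<in>\<xi>. prob (?D C))"
      using fin sub sets_\<nu> cylinders_sets by (intro finite_measure_subadditive_finite) auto
    also have "\<dots> \<le> (\<Sum>C\<in>\<xi>. ?\<epsilon>)" using NS by (intro sum_mono) (auto intro: less_imp_le)
    also have "\<dots> = real (card \<xi>) * ?\<epsilon>" by simp
    also have "\<dots> < \<delta>" using \<delta> by (simp add: field_simps)
    finally show "\<exists>m \<phi>. prob {x \<in> space \<nu>. \<phi> (initial_word m x) \<noteq> cell \<xi> x} < \<delta>" by blast
  qed (rule shift_entropy)
qed

end

lemma shift_system_iff: "\<nu> \<in> invariant_measures M \<longleftrightarrow> shift_system \<nu> M"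
  by (simp add: invariant_measures_iff shift_system_def shift_system_axioms_def)

section \<open>Positive semidefinite matrices\<close>

lemma inner_transpose: "x \<bullet> (transpose A *v y) = (A *v x) \<bullet> (y :: real ^ 'n)"
  by (simp add: dot_lmul_matrix[symmetric] inner_commute)

definition psd :: "real ^ 'd ^ 'd \<Rightarrow> bool" where
  "psd B \<longleftrightarrow> transpose B = B \<and> (\<forall>v. 0 \<le> v \<bullet> (B *v v))"

lemma psd_nonneg: "psd B \<Longrightarrow> 0 \<le> v \<bullet> (B *v v)"
  by (simp add: psd_def)

lemma symmetric_inner: "transpose B = B \<Longrightarrow> x \<bullet> (B *v y) = (B *v x) \<bullet> (y :: real ^ 'n)"
  using inner_transpose[of x B y] by simp

lemma positive_definite_psd: "positive_definite B \<Longrightarrow> psd B"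
  unfolding positive_definite_def psd_def by (metis inner_zero_left less_imp_le order_refl)

lemma psd_quadratic_expand:
  assumes "psd B"
  shows "0 \<le> x \<bullet> (B *v x) + 2 * t * (x \<bullet> (B *v y)) + t\<^sup>2 * (y \<bullet> (B *v y))"
proof -
  have sym: "y \<bullet> (B *v x) = x \<bullet> (B *v y)"
    using symmetric_inner[of B y x] assms by (simp add: psd_def inner_commute)
  have "0 \<le> (x + t *\<^sub>R y) \<bullet> (B *v (x + t *\<^sub>R y))" using assms by (rule psd_nonneg)
  also have "\<dots> = x \<bullet> (B *v x) + 2 * t * (x \<bullet> (B *v y)) + t\<^sup>2 * (y \<bullet> (B *v y))"
    using sym by (simp add: matrix_vector_right_distrib matrix_vector_mult_scaleR inner_add_left
        inner_add_right algebra_simps power2_eq_square)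
  finally show ?thesis .
qed

lemma psd_cauchy_schwarz:
  assumes "psd B" "y \<bullet> (B *v y) > 0"
  shows "(x \<bullet> (B *v y))\<^sup>2 / (y \<bullet> (B *v y)) \<le> x \<bullet> (B *v x)"
  using psd_quadratic_expand[OF assms(1), of x "- (x \<bullet> (B *v y)) / (y \<bullet> (B *v y))" y] assms(2)
  by (simp add: field_simps power2_eq_square)

lemma psd_kernel:
  assumes "psd B" "y \<bullet> (B *v y) = 0"
  shows "B *v y = 0"
proof -
  have sym: "transpose B = B" using assms(1) by (simp add: psd_def)
  let ?x = "B *v y"
  define a c where "a = ?x \<bullet> ?x" and "c = ?x \<bullet> (B *v ?x)"
  have c: "c \<ge> 0" using psd_nonneg[OF assms(1)] by (simp add: c_def)
  have "0 \<le> c + 2 * t * a" for t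
    using psd_quadratic_expand[OF assms(1), of ?x t y] assms(2) by (simp add: a_def c_def)
  from this[of "- (c + 1) / a"] c have "a = 0"
    by (cases "a = 0") auto
  then show ?thesis by (simp add: a_def)
qed

definition outer :: "real ^ 'd \<Rightarrow> real ^ 'd ^ 'd" where
  "outer u = (\<chi> i j. u $ i * u $ j)"

lemma outer_mult: "outer u *v x = (u \<bullet> x) *\<^sub>R u"
  by (simp add: outer_def matrix_vector_mult_def vec_eq_iff inner_vec_def sum_distrib_left mult_ac)

lemma transpose_outer: "transpose (outer u) = outer u"
  by (simp add: outer_def transpose_def vec_eq_iff mult.commute)

lemma transpose_diff: "transpose (A - B) = transpose A - transpose (B :: real ^ 'n ^ 'm)"
  by (simp add: transpose_def vec_eq_iff)

text \<open>
  Subtracting \<open>B y y\<^sup>T B / (y \<bullet> B y)\<close> keeps the matrix positive semidefinite by the Cauchy--Schwarz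
  inequality and adds \<open>y\<close> to its kernel, so the decomposition ends after at most as many steps as
  the dimension. This substitute for the spectral theorem is used to see that
  \<open>tr (Q' X\<^sup>T Q X)\<close> is positive.
\<close>

lemma psd_sum_rank_one:
  fixes B :: "real ^ 'd ^ 'd"
  assumes "psd B"
  shows "\<exists>us. \<forall>x. B *v x = (\<Sum>u\<leftarrow>us. (u \<bullet> x) *\<^sub>R u)"
  using assms
proof (induction "CARD('d) - dim {x. B *v x = 0}" arbitrary: B rule: less_induct)
  case less
  note psd = less.prems
  have sym: "transpose B = B" using psd by (simp add: psd_def)
  show ?case
  proof (cases "\<forall>y. y \<bullet> (B *v y) = 0")
    case True
    then have "B *v y = 0" for y using psd_kernel[OF psd] by blast
    then show ?thesis by (intro exI[of _ "[]"]) simp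
  next
    case False
    then obtain y where "y \<bullet> (B *v y) \<noteq> 0" by blast
    then have y: "y \<bullet> (B *v y) > 0" (is "?a > 0") using psd_nonneg[OF psd, of y] by simp
    define u where "u = (1 / sqrt ?a) *\<^sub>R (B *v y)"
    define B' where "B' = B - outer u"
    have B'_mult: "B' *v x = B *v x - (u \<bullet> x) *\<^sub>R u" for x
      by (simp add: B'_def matrix_vector_mult_diff_rdistrib outer_mult)
    have ux: "u \<bullet> x = (x \<bullet> (B *v y)) / sqrt ?a" for x
      by (simp add: u_def inner_commute)
    have "psd B'"
      unfolding psd_def
    proof (intro conjI allI)
      show "transpose B' = B'" by (simp add: B'_def transpose_diff sym transpose_outer)
      fix x
      have "x \<bullet> (B' *v x) = x \<bullet> (B *v x) - (u \<bullet> x)\<^sup>2"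
        by (simp add: B'_mult inner_diff_right inner_commute power2_eq_square)
      also have "(u \<bullet> x)\<^sup>2 = (x \<bullet> (B *v y))\<^sup>2 / ?a"
        using y by (simp add: ux power_divide)
      finally show "0 \<le> x \<bullet> (B' *v x)" using psd_cauchy_schwarz[OF psd y, of x] by simp
    qed
    have sub: "subspace {x. C *v x = 0}" for C :: "real ^ 'd ^ 'd"
      by (simp add: subspace_def matrix_vector_right_distrib matrix_vector_mult_scaleR)
    have "B' *v x = 0" if "B *v x = 0" for x
    proof -
      have "x \<bullet> (B *v y) = 0" using symmetric_inner[OF sym, of x y] that by simp
      then show ?thesis using that by (simp add: B'_mult ux)
    qed
    moreover have "B' *v y = 0"
      using y by (simp add: B'_mult ux) (simp add: u_def real_div_sqrt)
    moreover have "B *v y \<noteq> 0" using y by auto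
    ultimately have "{x. B *v x = 0} \<subset> {x. B' *v x = 0}" by blast
    then have "dim {x. B *v x = 0} < dim {x. B' *v x = 0}"
      using sub[of B] sub[of B'] by (intro dim_psubset) (simp add: span_eq_iff[THEN iffD2])
    moreover have "dim {x. B' *v x = 0} \<le> CARD('d)"
      using dim_subset_UNIV[of "{x. B' *v x = 0}"] by simp
    ultimately have "CARD('d) - dim {x. B' *v x = 0} < CARD('d) - dim {x. B *v x = 0}" by linarith
    from less.hyps[OF this \<open>psd B'\<close>]
    obtain us where us: "\<And>x. B' *v x = (\<Sum>u\<leftarrow>us. (u \<bullet> x) *\<^sub>R u)" by blast
    then have "B *v x = (\<Sum>u\<leftarrow>u # us. (u \<bullet> x) *\<^sub>R u)" for x
      using B'_mult[of x] by (simp add: algebra_simps)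
    then show ?thesis by blast
  qed
qed

lemma trace_eq_sum_axis: "trace B = (\<Sum>i\<in>UNIV. axis i 1 \<bullet> (B *v axis i (1::real)))"
  by (simp add: trace_def matrix_vector_mul_component inner_axis inner_axis' )

lemma trace_mult_rank_one:
  fixes B Y :: "real ^ 'd ^ 'd"
  assumes "\<And>x. B *v x = (\<Sum>u\<leftarrow>us. (u \<bullet> x) *\<^sub>R u)"
  shows "trace (B ** Y) = (\<Sum>u\<leftarrow>us. u \<bullet> (Y *v u))"
proof -
  have lin: "Y *v (\<Sum>u\<leftarrow>us. f u) = (\<Sum>u\<leftarrow>us. Y *v f u)" for f :: "real ^ 'd \<Rightarrow> real ^ 'd" and us
    by (induction us) (auto simp: matrix_vector_right_distrib)
  have inn: "z \<bullet> (\<Sum>u\<leftarrow>us. f u) = (\<Sum>u\<leftarrow>us. z \<bullet> f u)" for z :: "real ^ 'd" and f us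
    by (induction us) (auto simp: inner_add_right)
  have sw: "(\<Sum>i\<in>UNIV. \<Sum>u\<leftarrow>us. f i u) = (\<Sum>u\<leftarrow>us. \<Sum>i\<in>UNIV. f i u)" for f :: "'d \<Rightarrow> real ^ 'd \<Rightarrow> real" and us
    by (induction us) (auto simp: sum.distrib)
  have "trace (B ** Y) = trace (Y ** B)" by (rule trace_mul_sym)
  also have "\<dots> = (\<Sum>i\<in>UNIV. \<Sum>u\<leftarrow>us. u $ i * (Y *v u) $ i)"
    by (simp add: trace_eq_sum_axis matrix_vector_mul_assoc[symmetric] assms lin inn
        matrix_vector_mult_scaleR inner_axis inner_axis')
  also have "\<dots> = (\<Sum>u\<leftarrow>us. u \<bullet> (Y *v u))"
    by (simp add: sw inner_vec_def)
  finally show ?thesis .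
qed

lemma positive_definite_surj:
  assumes "positive_definite (B :: real ^ 'd ^ 'd)"
  obtains x where "B *v x = y"
proof -
  have "inj ((*v) B)"
  proof (rule injI)
    fix a b assume "B *v a = B *v b"
    then have "(a - b) \<bullet> (B *v (a - b)) = 0" by (simp add: matrix_vector_mult_diff_distrib)
    then show "a = b" using assms unfolding positive_definite_def by (metis eq_iff_diff_eq_0 less_irrefl)
  qed
  then have "surj ((*v) B)"
    by (intro linear_injective_imp_surjective) auto
  then show ?thesis using that by (metis surjD)
qed

text \<open>
  Up to the factor \<open>e\<^bsup>- n P\<^esup>\<close>, the mass of a cylinder under the Kusuoka measure.
\<close>

definition kusuoka_form :: "real ^ 'd ^ 'd \<Rightarrow> real ^ 'd ^ 'd \<Rightarrow> real ^ 'd ^ 'd \<Rightarrow> real" where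
  "kusuoka_form Q Q' X = trace (Q' ** transpose X ** Q ** X)"

text \<open>
  If \<open>Q'\<close> is the sum of the matrices \<open>u u\<^sup>T\<close>, then the form is the sum of the terms
  \<open>(X u) \<bullet> Q (X u) \<ge> 0\<close>. They cannot all vanish, because the vectors \<open>u\<close> span the range of \<open>Q'\<close>,
  which is the whole space.
\<close>

lemma kusuoka_form_pos:
  assumes Q: "positive_definite Q" and Q': "positive_definite Q'" and X: "X \<noteq> 0"
  shows "kusuoka_form Q Q' X > 0"
proof -
  obtain us where us: "\<And>x. Q' *v x = (\<Sum>u\<leftarrow>us. (u \<bullet> x) *\<^sub>R u)"
    using psd_sum_rank_one[OF positive_definite_psd[OF Q']] by blast
  have eq: "kusuoka_form Q Q' X = (\<Sum>u\<leftarrow>us. (X *v u) \<bullet> (Q *v (X *v u)))"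
    unfolding kusuoka_form_def matrix_mul_assoc[symmetric] trace_mult_rank_one[OF us]
      matrix_vector_mul_assoc[symmetric] inner_transpose ..
  have nonneg: "0 \<le> (X *v u) \<bullet> (Q *v (X *v u))" for u
    by (rule psd_nonneg[OF positive_definite_psd[OF Q]])
  have "\<exists>u\<in>set us. X *v u \<noteq> 0"
  proof (rule ccontr)
    assume no: "\<not> (\<exists>u\<in>set us. X *v u \<noteq> 0)"
    have "X *v (\<Sum>u\<leftarrow>vs. (u \<bullet> x) *\<^sub>R u) = 0" if "set vs \<subseteq> set us" for vs x
      using that no by (induction vs) (auto simp: matrix_vector_right_distrib matrix_vector_mult_scaleR)
    then have "X *v (Q' *v x) = 0" for x using us by simp
    then have "X *v y = 0" for y using positive_definite_surj[OF Q'] by metis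
    then show False using X by (simp add: matrix_eq)
  qed
  then obtain u where u: "u \<in> set us" "X *v u \<noteq> 0" by blast
  have "0 < (X *v u) \<bullet> (Q *v (X *v u))" using Q u by (simp add: positive_definite_def)
  also have "\<dots> \<le> (\<Sum>u\<leftarrow>us. (X *v u) \<bullet> (Q *v (X *v u)))"
    using u(1) by (intro member_le_sum_list) (use nonneg in auto)
  finally show ?thesis by (simp add: eq)
qed

lemma continuous_on_matrix_mult [continuous_intros]:
  fixes f :: "'a::topological_space \<Rightarrow> real ^ 'n ^ 'm"
  shows "continuous_on S f \<Longrightarrow> continuous_on S g \<Longrightarrow> continuous_on S (\<lambda>x. f x ** g x)"
  unfolding matrix_matrix_mult_def by (intro continuous_intros)

lemma continuous_on_transpose [continuous_intros]:
  fixes f :: "'a::topological_space \<Rightarrow> real ^ 'n ^ 'm"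
  shows "continuous_on S f \<Longrightarrow> continuous_on S (\<lambda>x. transpose (f x))"
  unfolding transpose_def by (intro continuous_intros)

lemma continuous_on_trace [continuous_intros]:
  fixes f :: "'a::topological_space \<Rightarrow> real ^ 'n ^ 'n"
  shows "continuous_on S f \<Longrightarrow> continuous_on S (\<lambda>x. trace (f x))"
  unfolding trace_def by (intro continuous_intros)

lemma continuous_on_matrix_vector [continuous_intros]:
  fixes f :: "'a::topological_space \<Rightarrow> real ^ 'n ^ 'm"
  shows "continuous_on S f \<Longrightarrow> continuous_on S (\<lambda>x. f x *v v)"
  unfolding matrix_vector_mult_def by (intro continuous_intros)

text \<open>
  On the compact unit sphere \<open>f / g\<close> is bounded, and the quotient does not change along rays.
\<close>

lemma homogeneous_le:
  fixes f g :: "'a::euclidean_space \<Rightarrow> real"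
  assumes cont: "continuous_on UNIV f" "continuous_on UNIV g"
    and hom: "\<And>c x. f (c *\<^sub>R x) = c\<^sup>2 * f x" "\<And>c x. g (c *\<^sub>R x) = c\<^sup>2 * g x"
    and pos: "\<And>x. x \<noteq> 0 \<Longrightarrow> g x > 0"
  shows "\<exists>C>0. \<forall>x. f x \<le> C * g x"
proof -
  let ?h = "\<lambda>x. f x / g x"
  have nz: "g x \<noteq> 0" if "x \<in> sphere 0 1" for x
  proof -
    have "x \<noteq> 0" using that by auto
    from pos[OF this] show ?thesis by simp
  qed
  have "continuous_on (sphere 0 1) ?h"
    by (intro continuous_on_divide continuous_on_subset[OF cont(1)] continuous_on_subset[OF cont(2)])
      (use nz in auto)
  then have "bounded (?h ` sphere 0 1)"
    by (intro compact_imp_bounded compact_continuous_image) auto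
  then obtain C where C: "C > 0" "\<And>x. x \<in> sphere 0 1 \<Longrightarrow> \<bar>?h x\<bar> \<le> C"
    by (auto simp: bounded_pos)
  have "f x \<le> C * g x" for x
  proof (cases "x = 0")
    case True
    then show ?thesis using hom(1)[of 0 0] hom(2)[of 0 0] by simp
  next
    case False
    let ?y = "(1 / norm x) *\<^sub>R x"
    have y: "?y \<in> sphere 0 1" using False by simp
    have "f ?y \<le> C * g ?y"
    proof -
      have "?h ?y \<le> C" using abs_le_D1[OF C(2)[OF y]] .
      moreover have "g ?y > 0" using pos[of ?y] False by simp
      ultimately show ?thesis by (simp add: divide_le_eq)
    qed
    then show ?thesis using False by (simp add: hom divide_le_cancel field_simps)
  qed
  with C(1) show ?thesis by blast
qed

section \<open>Comparison with the operator norm\<close>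

lemma mat_norm_nonneg: "mat_norm X \<ge> 0"
  by (simp add: mat_norm_def onorm_pos_le)

lemma mat_norm_eq_0: "mat_norm X = 0 \<longleftrightarrow> X = 0"
  by (simp add: mat_norm_def onorm_eq_0 matrix_eq)

lemma mat_norm_pos: "mat_norm X > 0 \<longleftrightarrow> X \<noteq> 0"
  using mat_norm_nonneg[of X] mat_norm_eq_0[of X] by linarith

lemma mat_norm_mult: "mat_norm (X ** Y) \<le> mat_norm X * mat_norm Y"
proof -
  have "mat_norm (X ** Y) = onorm ((*v) X \<circ> (*v) Y)"
    by (simp add: mat_norm_def o_def matrix_vector_mul_assoc)
  also have "\<dots> \<le> mat_norm X * mat_norm Y"
    unfolding mat_norm_def by (rule onorm_compose) auto
  finally show ?thesis .
qed

lemma mat_norm_le_norm: "\<exists>C>0. \<forall>X :: real ^ 'd ^ 'd. mat_norm X \<le> C * norm X"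
proof (intro exI conjI allI)
  let ?C = "real CARD('d) * real CARD('d)"
  show "0 < ?C" by simp
  fix X :: "real ^ 'd ^ 'd"
  have "\<bar>X $ i $ j\<bar> \<le> norm X" for i j
    using component_le_norm_cart[of "X $ i" j] Finite_Cartesian_Product.norm_nth_le[of X i] by linarith
  from onorm_le_matrix_component[OF this] show "mat_norm X \<le> ?C * norm X"
    by (simp add: mat_norm_def)
qed

lemma mat_norm_scaleR: "mat_norm (c *\<^sub>R X) = \<bar>c\<bar> * mat_norm X"
proof -
  have "(\<lambda>v. (c *\<^sub>R X) *v v) = (\<lambda>v. c *\<^sub>R (X *v v))"
    by (simp add: fun_eq_iff scaleR_matrix_vector_assoc)
  then show ?thesis unfolding mat_norm_def by (simp add: onorm_scaleR)
qed

lemma continuous_on_mat_norm [continuous_intros]: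
  fixes f :: "'a::topological_space \<Rightarrow> real ^ 'd ^ 'd"
  assumes "continuous_on S f"
  shows "continuous_on S (\<lambda>x. mat_norm (f x))"
proof -
  obtain C where C: "C > 0" "\<And>X :: real ^ 'd ^ 'd. mat_norm X \<le> C * norm X"
    using mat_norm_le_norm by blast
  have "mat_norm X \<le> mat_norm Y + C * norm (X - Y)" for X Y :: "real ^ 'd ^ 'd"
  proof -
    have "mat_norm X = onorm (\<lambda>v. Y *v v + (X - Y) *v v)"
      unfolding mat_norm_def by (simp add: matrix_vector_mult_diff_rdistrib)
    also have "\<dots> \<le> mat_norm Y + mat_norm (X - Y)"
      unfolding mat_norm_def by (rule onorm_triangle) auto
    finally show ?thesis using C(2)[of "X - Y"] by linarith
  qed
  from this[of x y for x y] this[of y x for x y]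
  have "\<bar>mat_norm X - mat_norm Y\<bar> \<le> C * norm (X - Y)" for X Y :: "real ^ 'd ^ 'd"
    by (smt (verit, best) norm_minus_commute)
  then have "C-lipschitz_on UNIV (mat_norm :: real ^ 'd ^ 'd \<Rightarrow> real)"
    using C(1) by (intro lipschitz_onI) (auto simp: dist_norm)
  from lipschitz_on_continuous_on[OF this] show ?thesis
    using assms by (rule continuous_on_compose2) simp
qed

lemma kusuoka_form_scale: "kusuoka_form Q Q' (c *\<^sub>R X) = c\<^sup>2 * kusuoka_form Q Q' X"
proof -
  have "Q' ** transpose (c *\<^sub>R X) ** Q ** (c *\<^sub>R X) = c\<^sup>2 *\<^sub>R (Q' ** transpose X ** Q ** X)"
    by (simp add: transpose_scalar matrix_scalar_ac scalar_matrix_assoc[symmetric] power2_eq_square)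
  then show ?thesis by (simp add: kusuoka_form_def trace_def sum_distrib_left)
qed

lemma kusuoka_form_nonneg:
  "positive_definite Q \<Longrightarrow> positive_definite Q' \<Longrightarrow> kusuoka_form Q Q' X \<ge> 0"
  using kusuoka_form_pos[of Q Q' X] kusuoka_form_scale[of Q Q' 0 X] by (cases "X = 0") auto

lemma kusuoka_form_comparable:
  fixes Q Q' :: "real ^ 'd ^ 'd"
  assumes Q: "positive_definite Q" and Q': "positive_definite Q'"
  shows "\<exists>C>0. \<forall>X. kusuoka_form Q Q' X \<le> C * (mat_norm X)\<^sup>2 \<and> (mat_norm X)\<^sup>2 \<le> C * kusuoka_form Q Q' X"
proof -
  have cont: "continuous_on UNIV (kusuoka_form Q Q')"
    unfolding kusuoka_form_def by (intro continuous_intros)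
  have contn: "continuous_on UNIV (\<lambda>X :: real ^ 'd ^ 'd. (mat_norm X)\<^sup>2)" by (intro continuous_intros)
  have scale: "(mat_norm (c *\<^sub>R X))\<^sup>2 = c\<^sup>2 * (mat_norm X)\<^sup>2" for c and X :: "real ^ 'd ^ 'd"
    by (simp add: mat_norm_scaleR power_mult_distrib)
  have pos: "(mat_norm X)\<^sup>2 > 0" if "X \<noteq> 0" for X :: "real ^ 'd ^ 'd"
    using that by (simp add: mat_norm_eq_0)
  obtain C1 where C1: "C1 > 0" "\<And>X. kusuoka_form Q Q' X \<le> C1 * (mat_norm X)\<^sup>2"
    using homogeneous_le[OF cont contn kusuoka_form_scale scale pos] by blast
  obtain C2 where C2: "C2 > 0" "\<And>X. (mat_norm X)\<^sup>2 \<le> C2 * kusuoka_form Q Q' X"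
    using homogeneous_le[OF contn cont scale kusuoka_form_scale kusuoka_form_pos[OF Q Q']] by blast
  note nonneg = kusuoka_form_nonneg[OF Q Q']
  have "kusuoka_form Q Q' X \<le> max C1 C2 * (mat_norm X)\<^sup>2" for X
    using C1(2)[of X] mult_right_mono[of C1 "max C1 C2" "(mat_norm X)\<^sup>2"] by simp
  moreover have "(mat_norm X)\<^sup>2 \<le> max C1 C2 * kusuoka_form Q Q' X" for X
    using C2(2)[of X] mult_right_mono[of C2 "max C1 C2" "kusuoka_form Q Q' X"] nonneg by simp
  moreover have "max C1 C2 > 0" using C1(1) by simp
  ultimately show ?thesis by blast
qed

section \<open>The transfer operators\<close>

lemma sum_matrix_vector: "(\<Sum>i\<in>I. F i) *v v = (\<Sum>i\<in>I. F i *v (v :: real ^ 'n))"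
  by (induction I rule: infinite_finite_induct) (auto simp: matrix_vector_mult_add_rdistrib)

lemma matrix_mult_sum_right: "C ** (\<Sum>i\<in>I. F i) = (\<Sum>i\<in>I. C ** (F i :: real ^ 'n ^ 'n))"
  by (induction I rule: infinite_finite_induct) (auto simp: matrix_add_ldistrib)

lemma matrix_add_rdistrib: "(B + C) ** A = B ** A + C ** (A :: real ^ 'k ^ 'n)"
  by (simp add: matrix_matrix_mult_def vec_eq_iff sum.distrib algebra_simps)

lemma mult_scaleR_matrix:
  fixes A B :: "real ^ 'n ^ 'n"
  shows "A ** (k *\<^sub>R B) = k *\<^sub>R (A ** B)" "(k *\<^sub>R A) ** B = k *\<^sub>R (A ** B)"
  by (simp_all add: matrix_matrix_mult_def vec_eq_iff sum_distrib_left mult_ac)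

lemma matrix_mult_sum_left: "(\<Sum>i\<in>I. F i) ** C = (\<Sum>i\<in>I. (F i :: real ^ 'n ^ 'n) ** C)"
  by (induction I rule: infinite_finite_induct) (auto simp: matrix_add_rdistrib)

lemma trace_sum: "trace (\<Sum>i\<in>I. F i) = (\<Sum>i\<in>I. trace (F i :: real ^ 'n ^ 'n))"
  by (induction I rule: infinite_finite_induct) (auto simp: trace_add trace_0[unfolded mat_0])

lemma trace_scaleR: "trace (c *\<^sub>R B) = c * trace (B :: real ^ 'n ^ 'n)"
  by (simp add: trace_def sum_distrib_left)

lemma transpose_sum: "transpose (\<Sum>i\<in>I. F i) = (\<Sum>i\<in>I. transpose (F i :: real ^ 'n ^ 'n))"
  by (simp add: transpose_def vec_eq_iff)

lemma transfer_op_quadratic: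
  "v \<bullet> (transfer_op M A B *v v) = (\<Sum>i=1..M. (A i *v v) \<bullet> (B *v (A i *v v)))"
  by (simp add: transfer_op_def sum_matrix_vector inner_sum_right matrix_vector_mul_assoc[symmetric]
      inner_transpose del: transpose_matrix_vector)

lemma transfer_op_psd: "psd B \<Longrightarrow> psd (transfer_op M A B)"
  unfolding psd_def
proof safe
  assume B: "transpose B = B" and nn: "\<forall>v. 0 \<le> v \<bullet> (B *v v)"
  show "transpose (transfer_op M A B) = transfer_op M A B"
    by (simp add: transfer_op_def transpose_sum matrix_transpose_mul B matrix_mul_assoc)
  show "0 \<le> v \<bullet> (transfer_op M A B *v v)" for v
    unfolding transfer_op_quadratic by (intro sum_nonneg) (use nn in blast)
qed

lemma transfer_op_scaleR: "transfer_op M A (c *\<^sub>R B) = c *\<^sub>R transfer_op M A B"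
  by (simp add: transfer_op_def mult_scaleR_matrix scaleR_sum_right)

lemma dual_transfer_op_eq: "dual_transfer_op M A = transfer_op M (\<lambda>i. transpose (A i))"
  by (intro ext) (simp add: dual_transfer_op_def transfer_op_def)

text \<open>
  The two operators are adjoint for the trace pairing; this forces their Perron eigenvalues to
  coincide.
\<close>

lemma trace_transfer_op_dual: "trace (C ** transfer_op M A B) = trace (dual_transfer_op M A C ** B)"
proof -
  have "trace (C ** (transpose (A i) ** B ** A i)) = trace ((A i ** C ** transpose (A i)) ** B)" for i
    using trace_mul_sym[of "C ** transpose (A i) ** B" "A i"] by (simp add: matrix_mul_assoc)
  then show ?thesis
    by (simp add: transfer_op_def dual_transfer_op_def matrix_mult_sum_right matrix_mult_sum_left trace_sum)
qed

lemma psd_trace_nonneg: "psd B \<Longrightarrow> 0 \<le> trace B"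
  unfolding trace_eq_sum_axis by (intro sum_nonneg psd_nonneg)

lemma psd_trace_eq_0:
  assumes "psd (B :: real ^ 'd ^ 'd)" "trace B = 0"
  shows "B = 0"
proof -
  have "axis i 1 \<bullet> (B *v axis i 1) = 0" for i
    using assms sum_nonneg_eq_0_iff[of UNIV "\<lambda>i. axis i 1 \<bullet> (B *v axis i 1)"]
    by (simp add: trace_eq_sum_axis psd_nonneg)
  then have "B *v axis i 1 = 0" for i using psd_kernel[OF assms(1)] by blast
  moreover have "B $ j $ i = (B *v axis i 1) $ j" for i j
    by (simp add: matrix_vector_mul_component inner_axis)
  ultimately have "B $ j $ i = 0" for i j by simp
  then show ?thesis by (simp add: vec_eq_iff)
qed

text \<open>
  Follows by testing positivity on \<open>e\<^sub>i + e\<^sub>j\<close> and \<open>e\<^sub>i - e\<^sub>j\<close>; it bounds the set of density matrices.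
\<close>

lemma psd_entry_le_trace:
  assumes "psd (B :: real ^ 'd ^ 'd)"
  shows "\<bar>B $ i $ j\<bar> \<le> trace B"
proof -
  have entry: "axis i 1 \<bullet> (B *v axis j 1) = B $ i $ j" for i j
    by (simp add: inner_axis inner_axis' matrix_vector_mul_component)
  have diag: "0 \<le> B $ i $ i" for i using psd_nonneg[OF assms, of "axis i 1"] by (simp add: entry)
  have diag_le: "B $ i $ i \<le> trace B" for i
    unfolding trace_def using diag by (intro member_le_sum) auto
  have "0 \<le> B $ i $ i + 2 * t * B $ i $ j + t\<^sup>2 * B $ j $ j" for t
    using psd_quadratic_expand[OF assms, of "axis i 1" t "axis j 1"] by (simp add: entry)
  from this[of 1] this[of "-1"] have "2 * \<bar>B $ i $ j\<bar> \<le> B $ i $ i + B $ j $ j" by simp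
  then show ?thesis using diag_le[of i] diag_le[of j] by linarith
qed

definition density_matrices :: "(real ^ 'd ^ 'd) set" where
  "density_matrices = {B. psd B \<and> trace B = 1}"

lemma compact_density_matrices: "compact (density_matrices :: (real ^ 'd ^ 'd) set)"
proof -
  have "norm B \<le> (\<Sum>i\<in>(UNIV::'d set). \<Sum>j\<in>(UNIV::'d set). 1)" if "B \<in> density_matrices" for B :: "real ^ 'd ^ 'd"
  proof -
    have "norm B \<le> (\<Sum>i\<in>UNIV. norm (B $ i))"
      unfolding norm_vec_def by (rule L2_set_le_sum) simp
    also have "\<dots> \<le> (\<Sum>i\<in>UNIV. \<Sum>j\<in>UNIV. \<bar>B $ i $ j\<bar>)"
      by (intro sum_mono norm_le_l1_cart)
    also have "\<dots> \<le> (\<Sum>i\<in>(UNIV::'d set). \<Sum>j\<in>(UNIV::'d set). 1)"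
      using psd_entry_le_trace[of B] that by (intro sum_mono) (auto simp: density_matrices_def)
    finally show ?thesis .
  qed
  then have bdd: "bounded (density_matrices :: (real ^ 'd ^ 'd) set)" by (meson boundedI)
  have c1: "closed {B :: real ^ 'd ^ 'd. transpose B = B}" by (intro closed_Collect_eq continuous_intros)
  have c2: "closed {B :: real ^ 'd ^ 'd. \<forall>v. 0 \<le> v \<bullet> (B *v v)}"
    by (intro closed_Collect_all closed_Collect_le continuous_intros)
  have c3: "closed {B :: real ^ 'd ^ 'd. trace B = 1}" by (intro closed_Collect_eq continuous_intros)
  have eq: "density_matrices = {B :: real ^ 'd ^ 'd. transpose B = B} \<inter> {B. \<forall>v. 0 \<le> v \<bullet> (B *v v)} \<inter> {B. trace B = 1}"
    by (auto simp: density_matrices_def psd_def)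
  have "closed (density_matrices :: (real ^ 'd ^ 'd) set)"
    unfolding eq by (intro closed_Int c1 c2 c3)
  with bdd show ?thesis by (simp add: compact_eq_bounded_closed)
qed

lemma convex_density_matrices: "convex (density_matrices :: (real ^ 'd ^ 'd) set)"
proof (rule convexI)
  fix B C :: "real ^ 'd ^ 'd" and u v :: real
  assume "B \<in> density_matrices" "C \<in> density_matrices" "0 \<le> u" "0 \<le> v" "u + v = 1"
  moreover have "transpose (B + C) = transpose B + transpose C" for B C :: "real ^ 'd ^ 'd"
    by (simp add: transpose_def vec_eq_iff)
  ultimately show "u *\<^sub>R B + v *\<^sub>R C \<in> density_matrices"
    by (auto simp: density_matrices_def psd_def trace_add trace_scaleR transpose_scalar
        matrix_vector_mult_add_rdistrib scaleR_matrix_vector_assoc[symmetric] inner_add_right)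
qed

lemma density_matrices_nonempty: "(density_matrices :: (real ^ 'd ^ 'd) set) \<noteq> {}"
proof -
  have "(1 / real CARD('d)) *\<^sub>R mat 1 \<in> (density_matrices :: (real ^ 'd ^ 'd) set)"
    by (simp add: density_matrices_def psd_def trace_scaleR trace_I transpose_scalar scaleR_matrix_vector_assoc[symmetric])
  then show ?thesis by blast
qed

lemma invariant_subspace_trivial:
  fixes A :: "nat \<Rightarrow> real ^ 'd ^ 'd"
  assumes irr: "irreducible_tuple M A" and U: "subspace U" "\<And>i u. i \<in> {1..M} \<Longrightarrow> u \<in> U \<Longrightarrow> A i *v u \<in> U"
  shows "U = {0} \<or> U = UNIV"
proof -
  have "(\<forall>i\<in>{1..M}. (\<lambda>v. A i *v v) ` U \<subseteq> U)" using U(2) by auto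
  then have "\<not> (0 < dim U \<and> dim U < CARD('d))"
    using irr U(1) unfolding irreducible_tuple_def by blast
  then have "dim U = 0 \<or> dim U = CARD('d)" using dim_subset_UNIV[of U] by force
  then show ?thesis
  proof
    assume "dim U = 0"
    then have "U \<subseteq> {0}" by (simp add: dim_eq_0)
    then show ?thesis using subspace_0[OF U(1)] by auto
  next
    assume "dim U = CARD('d)"
    then have "span U = UNIV" by (simp add: dim_eq_full[symmetric])
    then show ?thesis using U(1) by (simp add: span_eq_iff[THEN iffD2])
  qed
qed

lemma irreducible_transpose:
  fixes A :: "nat \<Rightarrow> real ^ 'd ^ 'd"
  assumes irr: "irreducible_tuple M A"
  shows "irreducible_tuple M (\<lambda>i. transpose (A i))"
  unfolding irreducible_tuple_def
proof clarify
  fix U :: "(real ^ 'd) set"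
  assume U: "subspace U" and dim: "0 < dim U" "dim U < CARD('d)"
    and inv: "\<forall>i\<in>{1..M}. (\<lambda>v. transpose (A i) *v v) ` U \<subseteq> U"
  have "U\<^sup>\<bottom> = {0} \<or> U\<^sup>\<bottom> = UNIV"
  proof (rule invariant_subspace_trivial[OF irr subspace_orthogonal_comp])
    fix i v assume i: "i \<in> {1..M}" and v: "v \<in> U\<^sup>\<bottom>"
    show "A i *v v \<in> U\<^sup>\<bottom>"
      unfolding orthogonal_comp_def orthogonal_def mem_Collect_eq
    proof
      fix u assume u: "u \<in> U"
      then have "transpose (A i) *v u \<in> U" using inv i by blast
      then have "(transpose (A i) *v u) \<bullet> v = 0" using v by (simp add: orthogonal_comp_def orthogonal_def)
      then show "u \<bullet> (A i *v v) = 0"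
        using inner_transpose[of v "A i" u] by (simp add: inner_commute del: transpose_matrix_vector)
    qed
  qed
  then show False
  proof
    assume "U\<^sup>\<bottom> = {0}"
    then have "U = UNIV" using orthogonal_comp_self[OF U] by simp
    then show False using dim(2) by simp
  next
    assume "U\<^sup>\<bottom> = UNIV"
    then have "U = {0}" using orthogonal_comp_self[OF U] by simp
    then show False using dim(1) by simp
  qed
qed

text \<open>
  This is where irreducibility makes eigenvectors in the cone positive definite: an invariant kernel
  is \<open>0\<close> or everything.
\<close>

lemma invariant_kernel_positive_definite:
  fixes A :: "nat \<Rightarrow> real ^ 'd ^ 'd"
  assumes irr: "irreducible_tuple M A" and B: "psd B" "B \<noteq> 0"
    and inv: "\<And>i v. i \<in> {1..M} \<Longrightarrow> B *v v = 0 \<Longrightarrow> B *v (A i *v v) = 0"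
  shows "positive_definite B"
proof -
  have "{v. B *v v = 0} = {0} \<or> {v. B *v v = 0} = UNIV"
    by (rule invariant_subspace_trivial[OF irr])
      (auto simp: subspace_def matrix_vector_right_distrib matrix_vector_mult_scaleR inv)
  moreover have "{v. B *v v = 0} \<noteq> UNIV" using B(2) by (auto simp: matrix_eq)
  ultimately have ker: "B *v v = 0 \<Longrightarrow> v = 0" for v by blast
  show ?thesis
    unfolding positive_definite_def
  proof (intro conjI allI impI)
    show "transpose B = B" using B by (simp add: psd_def)
    fix v :: "real ^ 'd" assume "v \<noteq> 0"
    then have "v \<bullet> (B *v v) \<noteq> 0" using psd_kernel[OF B(1)] ker by blast
    then show "0 < v \<bullet> (B *v v)" using psd_nonneg[OF B(1), of v] by simp
  qed
qed

lemma positive_definite_kernel: "positive_definite B \<Longrightarrow> B *v v = 0 \<Longrightarrow> v = 0"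
  unfolding positive_definite_def by force

lemma transfer_op_eq_0:
  assumes "psd B" "transfer_op M A B = 0" "i \<in> {1..M}"
  shows "B *v (A i *v v) = 0"
proof -
  have "(\<Sum>i=1..M. (A i *v v) \<bullet> (B *v (A i *v v))) = 0"
    using assms(2) transfer_op_quadratic[of v M A B] by simp
  then have "(A i *v v) \<bullet> (B *v (A i *v v)) = 0"
    using assms(3) psd_nonneg[OF assms(1)] by (subst (asm) sum_nonneg_eq_0_iff) auto
  then show ?thesis by (rule psd_kernel[OF assms(1)])
qed

text \<open>
  Brouwer's fixed point theorem for \<open>B \<mapsto> L B / tr (L B)\<close> on the compact convex set of density
  matrices. The denominator does not vanish: if \<open>L B = 0\<close> then every \<open>A i\<close> maps into the kernel of
  \<open>B\<close>, which is then invariant, so \<open>B\<close> is positive definite and all \<open>A i\<close> are zero. The kernel of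
  the fixed point is invariant by the eigenvalue equation.
\<close>

lemma perron_frobenius:
  fixes A :: "nat \<Rightarrow> real ^ 'd ^ 'd"
  assumes irr: "irreducible_tuple M A" and nz: "\<exists>i\<in>{1..M}. A i \<noteq> 0"
  shows "\<exists>Q l. l > 0 \<and> positive_definite Q \<and> transfer_op M A Q = l *\<^sub>R Q"
proof -
  let ?L = "transfer_op M A"
  let ?K = "density_matrices :: (real ^ 'd ^ 'd) set"
  have Lnz: "trace (?L B) > 0" if B: "B \<in> ?K" for B
  proof -
    have psd: "psd B" and B0: "B \<noteq> 0" using B by (auto simp: density_matrices_def trace_0[unfolded mat_0])
    have "?L B \<noteq> 0"
    proof
      assume L0: "?L B = 0"
      have "positive_definite B"
        by (rule invariant_kernel_positive_definite[OF irr psd B0]) (rule transfer_op_eq_0[OF psd L0])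
      then have "A i *v v = 0" if "i \<in> {1..M}" for i v
        using transfer_op_eq_0[OF psd L0 that, of v] positive_definite_kernel by blast
      then show False using nz by (auto simp: matrix_eq)
    qed
    then have "trace (?L B) \<noteq> 0" using psd_trace_eq_0[OF transfer_op_psd[OF psd]] by blast
    then show ?thesis using psd_trace_nonneg[OF transfer_op_psd[OF psd, of M A]] by simp
  qed
  let ?f = "\<lambda>B. (1 / trace (?L B)) *\<^sub>R ?L B"
  have contL: "continuous_on S ?L" for S
    unfolding transfer_op_def by (intro continuous_intros)
  obtain Q where Q: "Q \<in> ?K" "?f Q = Q"
  proof (rule brouwer[OF compact_density_matrices convex_density_matrices density_matrices_nonempty])
    show "continuous_on ?K ?f"
      by (intro continuous_intros contL) (use Lnz in fastforce)
    show "?f \<in> ?K \<rightarrow> ?K"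
    proof
      fix B assume B: "B \<in> ?K"
      have "psd (?L B)" using B by (intro transfer_op_psd) (simp add: density_matrices_def)
      then show "?f B \<in> ?K"
        using Lnz[OF B] by (simp add: density_matrices_def psd_def trace_scaleR transpose_scalar
            scaleR_matrix_vector_assoc[symmetric])
    qed
  qed
  define l where "l = trace (?L Q)"
  have l: "l > 0" unfolding l_def by (rule Lnz[OF Q(1)])
  have eig: "?L Q = l *\<^sub>R Q"
  proof -
    have "l *\<^sub>R Q = l *\<^sub>R ((1 / l) *\<^sub>R ?L Q)" using Q(2) unfolding l_def by (rule arg_cong[OF sym])
    then show ?thesis using l by simp
  qed
  have psd: "psd Q" and Q0: "Q \<noteq> 0" using Q(1) by (auto simp: density_matrices_def trace_0[unfolded mat_0])
  have "positive_definite Q"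
  proof (rule invariant_kernel_positive_definite[OF irr psd Q0])
    fix i v assume i: "i \<in> {1..M}" and v: "Q *v v = 0"
    have "(\<Sum>i=1..M. (A i *v v) \<bullet> (Q *v (A i *v v))) = v \<bullet> (?L Q *v v)"
      by (rule transfer_op_quadratic[symmetric])
    also have "\<dots> = 0" by (simp add: eig scaleR_matrix_vector_assoc[symmetric] v)
    finally have "(A i *v v) \<bullet> (Q *v (A i *v v)) = 0"
      using i psd_nonneg[OF psd] by (subst (asm) sum_nonneg_eq_0_iff) auto
    then show "Q *v (A i *v v) = 0" by (rule psd_kernel[OF psd])
  qed
  with l eig show ?thesis by blast
qed

lemma perron_frobenius_pair:
  fixes A :: "nat \<Rightarrow> real ^ 'd ^ 'd"
  assumes irr: "irreducible_tuple M A" and nz: "\<exists>i\<in>{1..M}. A i \<noteq> 0"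
  shows "\<exists>Q Q' l. l > 0 \<and> positive_definite Q \<and> positive_definite Q' \<and>
    transfer_op M A Q = l *\<^sub>R Q \<and> dual_transfer_op M A Q' = l *\<^sub>R Q' \<and> trace (Q ** Q') = 1"
proof -
  obtain Q l where Q: "l > 0" "positive_definite Q" "transfer_op M A Q = l *\<^sub>R Q"
    using perron_frobenius[OF irr nz] by blast
  have nz': "\<exists>i\<in>{1..M}. transpose (A i) \<noteq> 0"
  proof -
    from nz obtain i where i: "i \<in> {1..M}" "A i \<noteq> 0" by blast
    have "transpose (A i) \<noteq> 0"
    proof
      assume "transpose (A i) = 0"
      then have "transpose (transpose (A i)) = transpose 0" by simp
      then show False using i(2) by (simp add: transpose_def vec_eq_iff)
    qed
    then show ?thesis using i(1) by blast
  qed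
  obtain R l' where R: "l' > 0" "positive_definite R" "dual_transfer_op M A R = l' *\<^sub>R R"
    using perron_frobenius[OF irreducible_transpose[OF irr] nz'] by (auto simp: dual_transfer_op_eq)
  have "mat 1 \<noteq> (0 :: real ^ 'd ^ 'd)" by (simp add: mat_def vec_eq_iff)
  from kusuoka_form_pos[OF Q(2) R(2) this]
  have pos: "trace (R ** Q) > 0" by (simp add: kusuoka_form_def)
  have "l * trace (R ** Q) = trace (R ** transfer_op M A Q)"
    by (simp add: Q(3) mult_scaleR_matrix trace_scaleR)
  also have "\<dots> = l' * trace (R ** Q)"
    by (simp add: trace_transfer_op_dual R(3) mult_scaleR_matrix trace_scaleR)
  finally have "l' = l" using pos by simp
  define Q' where "Q' = (1 / trace (R ** Q)) *\<^sub>R R"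
  have "positive_definite Q'"
    using R(2) pos by (simp add: Q'_def positive_definite_def transpose_scalar scaleR_matrix_vector_assoc[symmetric])
  moreover have "dual_transfer_op M A Q' = l *\<^sub>R Q'"
    using R(3) \<open>l' = l\<close> by (simp add: Q'_def dual_transfer_op_eq transfer_op_scaleR)
  moreover have "trace (Q ** Q') = 1"
    using pos trace_mul_sym[of Q R] by (simp add: Q'_def mult_scaleR_matrix trace_scaleR)
  ultimately show ?thesis using Q by (intro exI[of _ Q] exI[of _ Q'] exI[of _ l] conjI)
qed

lemma mat_prod_append: "mat_prod A (u @ v) = mat_prod A v ** mat_prod A u"
  by (induction u) (auto simp: matrix_mul_assoc)

lemma words_Suc: "words M (Suc n) = (\<lambda>(i, w). i # w) ` ({1..M} \<times> words M n)"
  by (auto simp: words_def length_Suc_conv image_iff)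

lemma sum_words_Suc: "(\<Sum>w\<in>words M (Suc n). f w) = (\<Sum>i=1..M. \<Sum>w\<in>words M n. f (i # w))"
proof -
  have "inj_on (\<lambda>(i, w). i # w) ({1..M} \<times> words M n)" by (auto simp: inj_on_def)
  from sum.reindex[OF this, of f] show ?thesis
    by (simp add: words_Suc sum.cartesian_product case_prod_beta o_def)
qed

text \<open>
  The iterates of the transfer operator are sums over words, which links the eigenvalue to the
  norm sums defining the pressure.
\<close>

lemma transfer_op_iterate:
  assumes "transfer_op M A Q = l *\<^sub>R Q"
  shows "(\<Sum>w\<in>words M n. transpose (mat_prod A w) ** Q ** mat_prod A w) = l ^ n *\<^sub>R Q"
proof (induction n)
  case 0
  have "words M 0 = {[]}" by (auto simp: words_def)
  then show ?case by simp
next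
  case (Suc n)
  have "(\<Sum>w\<in>words M (Suc n). transpose (mat_prod A w) ** Q ** mat_prod A w) =
     (\<Sum>i=1..M. transpose (A i) ** (\<Sum>w\<in>words M n. transpose (mat_prod A w) ** Q ** mat_prod A w) ** A i)"
    by (simp add: sum_words_Suc matrix_transpose_mul matrix_mult_sum_left matrix_mult_sum_right matrix_mul_assoc)
  also have "\<dots> = l ^ n *\<^sub>R transfer_op M A Q"
    unfolding Suc transfer_op_scaleR[symmetric] by (simp add: transfer_op_def)
  finally show ?case by (simp add: assms)
qed

lemma sum_kusuoka_form:
  assumes "transfer_op M A Q = l *\<^sub>R Q" "trace (Q ** Q') = 1"
  shows "(\<Sum>w\<in>words M n. kusuoka_form Q Q' (mat_prod A w)) = l ^ n"
proof -
  have "(\<Sum>w\<in>words M n. kusuoka_form Q Q' (mat_prod A w)) =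
      trace (Q' ** (\<Sum>w\<in>words M n. transpose (mat_prod A w) ** Q ** mat_prod A w))"
    by (simp add: kusuoka_form_def matrix_mult_sum_right trace_sum matrix_mul_assoc)
  also have "\<dots> = l ^ n"
    using assms(2) trace_mul_sym[of Q Q'] by (simp add: transfer_op_iterate[OF assms(1)] mult_scaleR_matrix trace_scaleR)
  finally show ?thesis .
qed

text \<open>
  The eigenvalue equation of \<open>Q\<close> makes the cylinder weights consistent under appending a symbol, so
  that they define a measure.
\<close>

lemma sum_kusuoka_form_snoc:
  assumes "transfer_op M A Q = l *\<^sub>R Q"
  shows "(\<Sum>i=1..M. kusuoka_form Q Q' (mat_prod A (w @ [i]))) = l * kusuoka_form Q Q' (mat_prod A w)"
proof -
  have "(\<Sum>i=1..M. kusuoka_form Q Q' (mat_prod A (w @ [i]))) =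
      trace (Q' ** transpose (mat_prod A w) ** transfer_op M A Q ** mat_prod A w)"
    by (simp add: kusuoka_form_def mat_prod_append transfer_op_def matrix_transpose_mul
        matrix_mult_sum_right matrix_mult_sum_left trace_sum matrix_mul_assoc)
  then show ?thesis
    by (simp add: assms kusuoka_form_def mult_scaleR_matrix trace_scaleR)
qed

text \<open>
  The eigenvalue equation of \<open>Q'\<close> gives the same for prepending a symbol, which is shift invariance.
\<close>

lemma sum_kusuoka_form_Cons:
  assumes "dual_transfer_op M A Q' = l *\<^sub>R Q'"
  shows "(\<Sum>i=1..M. kusuoka_form Q Q' (mat_prod A (i # w))) = l * kusuoka_form Q Q' (mat_prod A w)"
proof -
  let ?B = "transpose (mat_prod A w) ** Q ** mat_prod A w"
  have "kusuoka_form Q Q' (mat_prod A (i # w)) = trace (Q' ** (transpose (A i) ** ?B ** A i))" for i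
    by (simp add: kusuoka_form_def matrix_transpose_mul matrix_mul_assoc)
  then have "(\<Sum>i=1..M. kusuoka_form Q Q' (mat_prod A (i # w))) = trace (Q' ** transfer_op M A ?B)"
    by (simp add: transfer_op_def matrix_mult_sum_right trace_sum)
  also have "\<dots> = l * trace (Q' ** ?B)"
    by (simp add: trace_transfer_op_dual assms mult_scaleR_matrix trace_scaleR)
  finally show ?thesis by (simp add: kusuoka_form_def matrix_mul_assoc)
qed

section \<open>The pressure\<close>

text \<open>
  The form \<open>kusuoka_form Q Q'\<close> is comparable to \<open>\<parallel>X\<parallel>\<^sup>2\<close> and its sum over words of length \<open>n\<close> is
  exactly \<open>l\<^sup>n\<close>. Hence the limit in the definition of the pressure exists and equals \<open>ln l\<close>.
\<close>

lemma pressure_eq: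
  fixes A :: "nat \<Rightarrow> real ^ 'd ^ 'd"
  assumes Q: "positive_definite Q" and Q': "positive_definite Q'" and l: "l > 0"
    and eig: "transfer_op M A Q = l *\<^sub>R Q" and tr: "trace (Q ** Q') = 1"
  shows "pressure M A 2 = ereal (ln l)"
proof -
  obtain C where C: "C > 0" "\<And>X. kusuoka_form Q Q' X \<le> C * (mat_norm X)\<^sup>2"
      "\<And>X. (mat_norm X)\<^sup>2 \<le> C * kusuoka_form Q Q' X"
    using kusuoka_form_comparable[OF Q Q'] by blast
  define S where "S n = (\<Sum>w\<in>words M n. mat_norm (mat_prod A w) powr 2)" for n
  have S_eq: "S n = (\<Sum>w\<in>words M n. (mat_norm (mat_prod A w))\<^sup>2)" for n
    unfolding S_def by (intro sum.cong) (auto simp: powr_numeral mat_norm_nonneg)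
  have lo: "l ^ n \<le> C * S n" and up: "S n \<le> C * l ^ n" for n
    unfolding S_eq sum_kusuoka_form[OF eig tr, symmetric] sum_distrib_left
    by (intro sum_mono C)+
  have S_pos: "S n > 0" for n
    using lo[of n] l C(1) by (metis zero_less_mult_pos zero_less_power order_less_le_trans)
  have "(\<lambda>n. ln (S n) / real n) \<longlonglongrightarrow> ln l"
  proof (rule real_tendsto_sandwich)
    have lim: "(\<lambda>n. ln l + c / real n) \<longlonglongrightarrow> ln l" for c
      using tendsto_add[OF tendsto_const lim_const_over_n[of c], of "ln l"] by simp
    show "(\<lambda>n. ln l + (- ln C) / real n) \<longlonglongrightarrow> ln l" "(\<lambda>n. ln l + ln C / real n) \<longlonglongrightarrow> ln l"
      by (rule lim)+
    have lnS: "real n * ln l - ln C \<le> ln (S n)" "ln (S n) \<le> real n * ln l + ln C" for n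
    proof -
      have "ln (l ^ n) \<le> ln (C * S n)" using lo[of n] l by (intro ln_mono) auto
      then show "real n * ln l - ln C \<le> ln (S n)"
        using C(1) S_pos[of n] l by (simp add: ln_mult ln_realpow)
      have "ln (S n) \<le> ln (C * l ^ n)" using up[of n] S_pos[of n] by (intro ln_mono) auto
      then show "ln (S n) \<le> real n * ln l + ln C"
        using C(1) l by (simp add: ln_mult ln_realpow)
    qed
    show "\<forall>\<^sub>F n in sequentially. ln l + (- ln C) / real n \<le> ln (S n) / real n"
      using eventually_gt_at_top[of 0]
    proof eventually_elim
      case (elim n)
      from divide_right_mono[OF lnS(1)[of n], of "real n"] elim show ?case
        by (simp add: diff_divide_distrib)
    qed
    show "\<forall>\<^sub>F n in sequentially. ln (S n) / real n \<le> ln l + ln C / real n"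
      using eventually_gt_at_top[of 0]
    proof eventually_elim
      case (elim n)
      from divide_right_mono[OF lnS(2)[of n], of "real n"] elim show ?case
        by (simp add: add_divide_distrib)
    qed
  qed
  then have "(\<lambda>n. ereal (ln (S n) / real n)) \<longlonglongrightarrow> ereal (ln l)" by simp
  then have "(\<lambda>n. elog (S n) / ereal (real n)) \<longlonglongrightarrow> ereal (ln l)"
  proof (rule Lim_transform_eventually)
    show "\<forall>\<^sub>F n in sequentially. ereal (ln (S n) / real n) = elog (S n) / ereal (real n)"
      using eventually_gt_at_top[of 0]
      by eventually_elim (use S_pos in \<open>simp add: elog_def\<close>)
  qed
  then show ?thesis unfolding pressure_def S_def by (rule limI)
qed

lemma pressure_zero:
  assumes "\<forall>i\<in>{1..M}. A i = (0 :: real ^ 'd ^ 'd)"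
  shows "pressure M A 2 = -\<infinity>"
proof -
  have "mat_prod A w = 0" if "w \<in> words M n" "n > 0" for w n
    using that assms by (cases w) (auto simp: words_def)
  then have sum0: "(\<Sum>w\<in>words M n. mat_norm (mat_prod A w) powr 2) = 0" if "n > 0" for n
    using that by (intro sum.neutral) (auto simp: mat_norm_eq_0[THEN iffD2])
  have ev: "\<forall>\<^sub>F n in sequentially. -\<infinity> = elog (\<Sum>w\<in>words M n. mat_norm (mat_prod A w) powr 2) / ereal (real n)"
    by (rule eventually_mono[OF eventually_gt_at_top[of 0]]) (simp add: elog_def sum0)
  show ?thesis
    unfolding pressure_def by (rule limI) (rule Lim_transform_eventually[OF tendsto_const ev])
qed

section \<open>Mixing from irreducibility\<close>

text \<open>
  For a vector \<open>u \<noteq> 0\<close> in the range of \<open>X\<close>, the vectors annihilated by all \<open>Y A\<^sub>z\<close> form an invariant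
  subspace; if it contained \<open>u\<close> it would be everything, and \<open>Y\<close> would be \<open>0\<close>.
\<close>

lemma irreducible_connects:
  fixes A :: "nat \<Rightarrow> real ^ 'd ^ 'd"
  assumes irr: "irreducible_tuple M A" and XY: "X \<noteq> 0" "Y \<noteq> 0"
  shows "\<exists>z. set z \<subseteq> {1..M} \<and> Y ** mat_prod A z ** X \<noteq> 0"
proof (rule ccontr)
  assume no: "\<nexists>z. set z \<subseteq> {1..M} \<and> Y ** mat_prod A z ** X \<noteq> 0"
  obtain v where v: "X *v v \<noteq> 0" using XY(1) by (auto simp: matrix_eq)
  let ?U = "{u. \<forall>z. set z \<subseteq> {1..M} \<longrightarrow> Y *v (mat_prod A z *v u) = 0}"
  have "?U = {0} \<or> ?U = UNIV"
  proof (rule invariant_subspace_trivial[OF irr])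
    show "subspace ?U" by (auto simp: subspace_def matrix_vector_right_distrib matrix_vector_mult_scaleR)
    fix i u assume i: "i \<in> {1..M}" and u: "u \<in> ?U"
    have "Y *v (mat_prod A z *v (A i *v u)) = 0" if "set z \<subseteq> {1..M}" for z
    proof -
      have "set (i # z) \<subseteq> {1..M}" using that i by simp
      then have "Y *v (mat_prod A (i # z) *v u) = 0" using u by blast
      then show ?thesis by (simp add: matrix_vector_mul_assoc)
    qed
    then show "A i *v u \<in> ?U" by simp
  qed
  moreover have "X *v v \<in> ?U" using no by (simp add: matrix_vector_mul_assoc matrix_mul_assoc)
  ultimately have "?U = UNIV" using v by blast
  then have "Y *v (mat_prod A [] *v u) = 0" for u
    by (metis (mono_tags, lifting) UNIV_I empty_set empty_subsetI mem_Collect_eq)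
  then show False using XY(2) by (simp add: matrix_eq)
qed

text \<open>
  Finitely many connecting words suffice for all pairs \<open>X, Y\<close> at once, with a uniform lower bound.
  By \<open>irreducible_connects\<close> the open sets on which \<open>Y A\<^sub>z X \<noteq> 0\<close> cover the product of two unit
  spheres. On a finite subcover the continuous function \<open>\<Sum>z. \<parallel>Y A\<^sub>z X\<parallel>\<^sup>2\<close> has a positive minimum,
  and homogeneity extends the bound to all matrices.
\<close>

lemma irreducible_mixing:
  fixes A :: "nat \<Rightarrow> real ^ 'd ^ 'd"
  assumes irr: "irreducible_tuple M A"
  shows "\<exists>Z c. finite Z \<and> (\<forall>z\<in>Z. set z \<subseteq> {1..M}) \<and> c > 0 \<and>
    (\<forall>(X :: real ^ 'd ^ 'd) (Y :: real ^ 'd ^ 'd). c * (mat_norm X)\<^sup>2 * (mat_norm Y)\<^sup>2 \<le> (\<Sum>z\<in>Z. (mat_norm (Y ** mat_prod A z ** X))\<^sup>2))"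
proof -
  let ?S = "sphere 0 1 :: (real ^ 'd ^ 'd) set"
  let ?W = "{z. set z \<subseteq> {1..M}}"
  let ?U = "\<lambda>z. {p :: (real ^ 'd ^ 'd) \<times> (real ^ 'd ^ 'd). snd p ** mat_prod A z ** fst p \<noteq> 0}"
  have comp: "compact (?S \<times> ?S)" by (intro compact_Times) auto
  have op: "open (?U z)" for z by (intro open_Collect_neq continuous_intros)
  have cov: "?S \<times> ?S \<subseteq> (\<Union>z\<in>?W. ?U z)"
  proof
    fix p assume p: "p \<in> ?S \<times> ?S"
    then have "fst p \<noteq> 0" "snd p \<noteq> 0" by auto
    from irreducible_connects[OF irr this] show "p \<in> (\<Union>z\<in>?W. ?U z)" by auto
  qed
  obtain Z where Z: "Z \<subseteq> ?W" "finite Z" "?S \<times> ?S \<subseteq> (\<Union>z\<in>Z. ?U z)"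
    using compactE_image[OF comp op cov] by blast
  let ?F = "\<lambda>p :: (real ^ 'd ^ 'd) \<times> (real ^ 'd ^ 'd). \<Sum>z\<in>Z. (mat_norm (snd p ** mat_prod A z ** fst p))\<^sup>2"
  obtain x :: "real ^ 'd ^ 'd" where "norm x = 1" using vector_choose_size[of 1] by auto
  then have "x \<in> ?S" by simp
  then have ne: "?S \<times> ?S \<noteq> {}" by blast
  have contF: "continuous_on (?S \<times> ?S) ?F" by (intro continuous_intros)
  obtain p where p: "p \<in> ?S \<times> ?S" "\<And>q. q \<in> ?S \<times> ?S \<Longrightarrow> ?F p \<le> ?F q"
    using continuous_attains_inf[OF comp ne contF] by blast
  have pos: "?F p > 0"
  proof -
    obtain z where z: "z \<in> Z" "p \<in> ?U z" using Z(3) p(1) by blast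
    then have "0 < (mat_norm (snd p ** mat_prod A z ** fst p))\<^sup>2" by (simp add: mat_norm_eq_0)
    also have "\<dots> \<le> ?F p" by (rule member_le_sum) (use z Z in auto)
    finally show ?thesis .
  qed
  have Fp: "?F p * (norm X)\<^sup>2 * (norm Y)\<^sup>2 \<le> (\<Sum>z\<in>Z. (mat_norm (Y ** mat_prod A z ** X))\<^sup>2)"
    for X Y :: "real ^ 'd ^ 'd"
  proof (cases "X = 0 \<or> Y = 0")
    case False
    let ?X = "(1 / norm X) *\<^sub>R X" and ?Y = "(1 / norm Y) *\<^sub>R Y"
    have "(?X, ?Y) \<in> ?S \<times> ?S" using False by auto
    from p(2)[OF this] have "?F p \<le> (\<Sum>z\<in>Z. (mat_norm (?Y ** mat_prod A z ** ?X))\<^sup>2)" by simp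
    also have "\<dots> = (\<Sum>z\<in>Z. (mat_norm (Y ** mat_prod A z ** X))\<^sup>2 / ((norm X)\<^sup>2 * (norm Y)\<^sup>2))"
      by (intro sum.cong refl)
        (simp add: mult_scaleR_matrix mat_norm_scaleR power_divide power_mult_distrib mult.commute)
    also have "\<dots> = (\<Sum>z\<in>Z. (mat_norm (Y ** mat_prod A z ** X))\<^sup>2) / ((norm X)\<^sup>2 * (norm Y)\<^sup>2)"
      by (rule sum_divide_distrib[symmetric])
    finally show ?thesis using False by (simp add: pos_le_divide_eq mult.assoc)
  qed (auto intro!: sum_nonneg)
  obtain C where C: "C > 0" "\<And>X :: real ^ 'd ^ 'd. mat_norm X \<le> C * norm X"
    using mat_norm_le_norm by blast
  have sq: "(mat_norm X)\<^sup>2 \<le> C\<^sup>2 * (norm X)\<^sup>2" for X :: "real ^ 'd ^ 'd"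
    using power_mono[OF C(2)[of X] mat_norm_nonneg, of 2] by (simp add: power_mult_distrib)
  let ?c = "?F p / (C\<^sup>2 * C\<^sup>2)"
  have "?c * (mat_norm X)\<^sup>2 * (mat_norm Y)\<^sup>2 \<le> (\<Sum>z\<in>Z. (mat_norm (Y ** mat_prod A z ** X))\<^sup>2)"
    for X Y :: "real ^ 'd ^ 'd"
  proof -
    have "?c * ((mat_norm X)\<^sup>2 * (mat_norm Y)\<^sup>2) \<le> ?c * ((C\<^sup>2 * (norm X)\<^sup>2) * (C\<^sup>2 * (norm Y)\<^sup>2))"
      using pos by (intro mult_left_mono mult_mono sq) auto
    also have "\<dots> = ?F p * (norm X)\<^sup>2 * (norm Y)\<^sup>2"
      using C(1) by (simp add: field_simps power2_eq_square)
    finally show ?thesis using Fp[of X Y] unfolding mult.assoc by (rule order_trans)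
  qed
  moreover have "?c > 0" using pos C(1) by simp
  moreover have "\<forall>z\<in>Z. set z \<subseteq> {1..M}" using Z(1) by auto
  ultimately show ?thesis using Z(2) by (intro exI[of _ Z] exI[of _ ?c] conjI allI)
qed

section \<open>Lyapunov exponents\<close>

context prob_space
begin

lemma AE_law_pos:
  assumes X: "simple_function M X"
  shows "AE x in M. law X (X x) > 0"
proof -
  have "AE x in M. law X s = 0 \<longrightarrow> X x \<noteq> s" for s
  proof (cases "law X s = 0")
    case True
    then have "X -` {s} \<inter> space M \<in> null_sets M"
      using event_simple[OF X, of "{s}"] by (auto simp: law_def null_sets_def emeasure_eq_measure)
    from AE_not_in[OF this] show ?thesis by (auto simp: vimage_def)
  qed simp
  then have "AE x in M. \<forall>s\<in>X ` space M. law X s = 0 \<longrightarrow> X x \<noteq> s"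
    using X by (intro AE_finite_allI) (auto simp: simple_function_def)
  then show ?thesis
    by (rule AE_mp) (auto intro!: AE_I2 simp: less_le law_nonneg)
qed

lemma expectation_mono_law:
  fixes h h' :: "'b \<Rightarrow> real"
  assumes X: "simple_function M X" and le: "\<And>s. law X s > 0 \<Longrightarrow> h s \<le> h' s"
  shows "expectation (\<lambda>x. h (X x)) \<le> expectation (\<lambda>x. h' (X x))"
  unfolding expectation_simple[OF X]
proof (rule sum_mono)
  fix s
  show "law X s * h s \<le> law X s * h' s"
    using le[of s] law_nonneg[of X s] by (cases "law X s > 0") (auto intro!: mult_left_mono)
qed

lemma ereal_integral_elog:
  fixes g :: "'b \<Rightarrow> real"
  assumes X: "simple_function M X" and pos: "\<And>s. law X s > 0 \<Longrightarrow> g s > 0"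
  shows "ereal_integral M (\<lambda>x. elog (g (X x))) = ereal (expectation (\<lambda>x. ln (g (X x))))"
proof -
  let ?f = "\<lambda>x. ln (g (X x))"
  have int: "integrable M ?f" by (intro integrable_simple simple_function_compose1[OF X])
  have eq: "AE x in M. elog (g (X x)) = ereal (?f x)"
    using AE_law_pos[OF X] by eventually_elim (simp add: elog_def pos)
  have p: "(\<integral>\<^sup>+ x. e2ennreal (elog (g (X x))) \<partial>M) = (\<integral>\<^sup>+ x. ennreal (?f x) \<partial>M)"
    by (rule nn_integral_cong_AE) (use eq in eventually_elim, simp)
  have m: "(\<integral>\<^sup>+ x. e2ennreal (- elog (g (X x))) \<partial>M) = (\<integral>\<^sup>+ x. ennreal (- ?f x) \<partial>M)"
    by (rule nn_integral_cong_AE) (use eq in eventually_elim, simp)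
  have fin: "(\<integral>\<^sup>+ x. ennreal (?f x) \<partial>M) \<noteq> \<infinity>" "(\<integral>\<^sup>+ x. ennreal (- ?f x) \<partial>M) \<noteq> \<infinity>"
    using int by (auto simp: real_integrable_def)
  have conv: "enn2ereal a = ereal (enn2real a)" if "a \<noteq> \<infinity>" for a
    using that by (cases a rule: ennreal_cases) auto
  show ?thesis
    unfolding ereal_integral_def p m real_lebesgue_integral_def[OF int] conv[OF fin(1)] conv[OF fin(2)] by simp
qed

text \<open>
  A value of positive probability at which \<open>g\<close> vanishes makes the negative part of the integral
  infinite, while the positive part stays finite.
\<close>

lemma ereal_integral_elog_zero:
  fixes g :: "'b \<Rightarrow> real"
  assumes X: "simple_function M X" and zero: "law X s > 0" "g s = 0"
  shows "ereal_integral M (\<lambda>x. elog (g (X x))) = -\<infinity>"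
proof -
  let ?f = "\<lambda>x. ln (g (X x))"
  have int: "integrable M ?f" by (intro integrable_simple simple_function_compose1[OF X])
  have "(\<integral>\<^sup>+ x. e2ennreal (elog (g (X x))) \<partial>M) \<le> (\<integral>\<^sup>+ x. ennreal (?f x) \<partial>M)"
    by (rule nn_integral_mono) (auto simp: elog_def e2ennreal_neg)
  then have fin: "(\<integral>\<^sup>+ x. e2ennreal (elog (g (X x))) \<partial>M) \<noteq> \<infinity>"
    using int by (auto simp: real_integrable_def top_unique)
  have "\<infinity> = (\<integral>\<^sup>+ x. \<infinity> * indicator (X -` {s} \<inter> space M) x \<partial>M)"
    using zero(1) event_simple[OF X, of "{s}"]
    by (subst nn_integral_cmult_indicator) (auto simp: law_def emeasure_eq_measure ennreal_top_mult)
  also have "\<dots> \<le> (\<integral>\<^sup>+ x. e2ennreal (- elog (g (X x))) \<partial>M)"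
    by (rule nn_integral_mono) (auto simp: elog_def zero(2) split: split_indicator)
  finally have top: "(\<integral>\<^sup>+ x. e2ennreal (- elog (g (X x))) \<partial>M) = \<infinity>" by (simp add: top_unique)
  obtain r where "r \<ge> 0" "(\<integral>\<^sup>+ x. e2ennreal (elog (g (X x))) \<partial>M) = ennreal r"
    using fin by (cases "\<integral>\<^sup>+ x. e2ennreal (elog (g (X x))) \<partial>M" rule: ennreal_cases) auto
  then show ?thesis unfolding ereal_integral_def top by simp
qed

end

context shift_system
begin

definition log_norm :: "(nat \<Rightarrow> real ^ 'd ^ 'd) \<Rightarrow> nat \<Rightarrow> real" where
  "log_norm A n = expectation (\<lambda>x. ln (mat_norm (mat_prod A (initial_word n x))))"

text \<open>
  No matrix product along a typical orbit vanishes. Otherwise a set of positive measure contributes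
  \<open>-\<infinity>\<close> to the integrals defining the Lyapunov exponent.
\<close>

definition nonvanishing :: "(nat \<Rightarrow> real ^ 'd ^ 'd) \<Rightarrow> bool" where
  "nonvanishing A \<longleftrightarrow> (\<forall>n w. law (initial_word n) w > 0 \<longrightarrow> mat_prod A w \<noteq> 0)"

lemma law_take_drop:
  assumes "law (initial_word (m + n)) w > 0"
  shows "law (initial_word m) (take m w) > 0" "law (initial_word n) (drop m w) > 0"
proof -
  have "law (initial_word (m + n)) w \<le> law (initial_word m) (take m w)"
    unfolding law_def by (rule finite_measure_mono[OF _ event_simple[OF simple_initial_word]])
      (auto simp: take_initial_word)
  with assms show "law (initial_word m) (take m w) > 0" by simp
  have "law (initial_word (m + n)) w \<le> law (\<lambda>x. initial_word n ((shift ^^ m) x)) (drop m w)"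
    unfolding law_def
    by (rule finite_measure_mono[OF _ event_simple[OF simple_iter[OF simple_initial_word]]])
      (auto simp: initial_word_shift_iter add.commute)
  with assms show "law (initial_word n) (drop m w) > 0"
    by (simp add: law_iter[OF simple_initial_word])
qed

lemma law_pos_words:
  assumes "law (initial_word n) w > 0"
  shows "w \<in> words K n"
proof (rule ccontr)
  assume "w \<notin> words K n"
  then have "initial_word n -` {w} \<inter> space \<nu> = {}" using initial_word_in_words by (auto simp: space_\<nu>)
  then show False using assms by (simp add: law_def)
qed

lemma prob_cylinders:
  "prob (cylinders K n S) = (\<Sum>w\<in>initial_word n ` space \<nu>. law (initial_word n) w * indicator S w)"
proof -
  have "prob (cylinders K n S) = expectation (indicator (cylinders K n S))"
    using cylinders_sets by (simp add: sets_\<nu>)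
  also have "\<dots> = expectation (\<lambda>x. indicator S (initial_word n x))"
    by (intro Bochner_Integration.integral_cong) (auto simp: cylinders_def space_\<nu> indicator_def)
  finally show ?thesis by (simp add: expectation_simple[OF simple_initial_word])
qed

lemma expectation_affine:
  "expectation (\<lambda>x. a + c * ln (mat_norm (mat_prod A (initial_word n x))) + b * indicator S (initial_word n x))
    = a + c * log_norm A n + b * prob (cylinders K n S)"
proof -
  note X = simple_initial_word
  have "expectation (\<lambda>x. indicator S (initial_word n x)) = prob (cylinders K n S)"
    by (simp add: prob_cylinders expectation_simple[OF X])
  moreover have "integrable \<nu> (\<lambda>x. c * ln (mat_norm (mat_prod A (initial_word n x))))"
      "integrable \<nu> (\<lambda>x. b * indicator S (initial_word n x) :: real)"
    by (intro integrable_simple simple_function_compose1[OF X])+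
  ultimately show ?thesis by (simp add: log_norm_def prob_space)
qed

lemma log_norm_subadditive:
  assumes good: "nonvanishing A"
  shows "log_norm A (m + n) \<le> log_norm A m + log_norm A n"
proof -
  let ?l = "\<lambda>w. ln (mat_norm (mat_prod A w))"
  note S = simple_initial_word
  have "log_norm A (m + n) \<le> expectation (\<lambda>x. ?l (take m (initial_word (m + n) x)) + ?l (drop m (initial_word (m + n) x)))"
    unfolding log_norm_def
  proof (rule expectation_mono_law[OF S])
    fix w assume w: "law (initial_word (m + n)) w > 0"
    let ?u = "take m w" and ?v = "drop m w"
    have nz: "mat_norm (mat_prod A ?u) > 0" "mat_norm (mat_prod A ?v) > 0" "mat_norm (mat_prod A w) > 0"
      using law_take_drop[OF w] w good by (auto simp: nonvanishing_def mat_norm_pos)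
    have "mat_norm (mat_prod A w) \<le> mat_norm (mat_prod A ?v) * mat_norm (mat_prod A ?u)"
      using mat_norm_mult[of "mat_prod A ?v" "mat_prod A ?u"] mat_prod_append[of A ?u ?v] by simp
    then have "?l w \<le> ln (mat_norm (mat_prod A ?v) * mat_norm (mat_prod A ?u))"
      using nz by (intro ln_mono) auto
    also have "\<dots> = ?l ?u + ?l ?v" using nz by (simp add: ln_mult)
    finally show "?l w \<le> ?l ?u + ?l ?v" .
  qed
  also have "\<dots> = expectation (\<lambda>x. ?l (initial_word m x) + ?l (initial_word n ((shift ^^ m) x)))"
    by (simp add: take_initial_word initial_word_shift_iter add.commute)
  also have "\<dots> = log_norm A m + expectation (\<lambda>x. ?l (initial_word n ((shift ^^ m) x)))"
    unfolding log_norm_def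
    by (intro Bochner_Integration.integral_add integrable_simple simple_function_compose1[OF S]
          simple_function_compose1[OF simple_iter[OF S]])
  also have "expectation (\<lambda>x. ?l (initial_word n ((shift ^^ m) x))) = log_norm A n"
    unfolding log_norm_def
    by (rule expectation_iter[where f = "\<lambda>x. ?l (initial_word n x)"])
      (intro borel_measurable_simple_function simple_function_compose1[OF S])
  finally show ?thesis .
qed

lemma ereal_integral_log_norm:
  assumes "nonvanishing A"
  shows "ereal_integral \<nu> (\<lambda>x. elog (mat_norm (mat_prod A (map x [0..<n])))) = ereal (log_norm A n)"
  unfolding log_norm_def initial_word_def[symmetric]
  by (rule ereal_integral_elog[OF simple_initial_word, where g = "\<lambda>w. mat_norm (mat_prod A w)"])
    (use assms in \<open>auto simp: nonvanishing_def mat_norm_pos\<close>)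

lemma lyapunov_nonvanishing:
  assumes good: "nonvanishing A"
  shows "(\<lambda>n. ereal (log_norm A n / real n)) \<longlonglongrightarrow> lyapunov A \<nu>" "lyapunov A \<nu> \<noteq> \<infinity>"
proof -
  let ?I = "INF n\<in>{1..}. ereal (log_norm A n / real n)"
  have lim: "(\<lambda>n. ereal (log_norm A n / real n)) \<longlonglongrightarrow> ?I"
    by (rule fekete) (rule log_norm_subadditive[OF good])
  have "(\<lambda>n. ereal_integral \<nu> (\<lambda>x. elog (mat_norm (mat_prod A (map x [0..<n])))) / ereal (real n)) \<longlonglongrightarrow> ?I"
    by (rule Lim_transform_eventually[OF lim], rule eventually_mono[OF eventually_gt_at_top[of 0]])
      (simp add: ereal_integral_log_norm[OF good])
  then have eq: "lyapunov A \<nu> = ?I" unfolding lyapunov_def by (rule limI)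
  show "(\<lambda>n. ereal (log_norm A n / real n)) \<longlonglongrightarrow> lyapunov A \<nu>" using lim eq by simp
  have "?I \<le> ereal (log_norm A 1 / real 1)" by (intro INF_lower) auto
  then show "lyapunov A \<nu> \<noteq> \<infinity>" using eq by auto
qed

text \<open>
  A vanishing product of length \<open>m\<close> seen with positive probability is inherited by some word of
  every greater length.
\<close>

lemma lyapunov_vanishing:
  assumes bad: "\<not> nonvanishing A"
  shows "lyapunov A \<nu> = -\<infinity>"
proof -
  obtain m w where w: "law (initial_word m) w > 0" "mat_prod A w = 0"
    using bad by (auto simp: nonvanishing_def)
  have inf: "ereal_integral \<nu> (\<lambda>x. elog (mat_norm (mat_prod A (map x [0..<n])))) = -\<infinity>" if n: "n \<ge> m" for n
  proof -
    have "\<exists>s. law (initial_word n) s > 0 \<and> take m s = w"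
    proof (rule ccontr)
      assume no: "\<nexists>s. law (initial_word n) s > 0 \<and> take m s = w"
      have "AE x in \<nu>. x \<notin> initial_word m -` {w} \<inter> space \<nu>"
        using AE_law_pos[OF simple_initial_word[of n]]
      proof eventually_elim
        case (elim x)
        then show ?case using no n take_initial_word[OF n, of x] by auto
      qed
      then have "initial_word m -` {w} \<inter> space \<nu> \<in> null_sets \<nu>"
        using event_simple[OF simple_initial_word[of m], of "{w}"] by (simp add: AE_iff_null_sets)
      then have "law (initial_word m) w = 0"
        by (simp add: law_def measure_def null_sets_def)
      then show False using w(1) by simp
    qed
    then obtain s where s: "law (initial_word n) s > 0" "take m s = w" by blast
    have "mat_prod A s = mat_prod A (drop m s) ** mat_prod A w"
    proof -
      have "s = w @ drop m s" using append_take_drop_id[of m s] s(2) by simp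
      then show ?thesis by (metis mat_prod_append)
    qed
    then have "mat_norm (mat_prod A s) = 0" using w(2) by (simp add: mat_norm_eq_0[THEN iffD2])
    then show ?thesis
      unfolding initial_word_def[symmetric]
      using ereal_integral_elog_zero[OF simple_initial_word s(1), of "\<lambda>w. mat_norm (mat_prod A w)"] by simp
  qed
  have ev: "\<forall>\<^sub>F n in sequentially. -\<infinity> =
      ereal_integral \<nu> (\<lambda>x. elog (mat_norm (mat_prod A (map x [0..<n])))) / ereal (real n)"
    by (rule eventually_mono[OF eventually_ge_at_top[of "Suc m"]]) (simp add: inf)
  show ?thesis
    unfolding lyapunov_def by (rule limI) (rule Lim_transform_eventually[OF tendsto_const ev])
qed

text \<open>
  The finite-time quantity whose averages converge to \<open>h(\<nu>) + 2 \<Lambda>(A, \<nu>)\<close>. It is subadditive, so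
  by Fekete's lemma the limit is an infimum; in the equilibrium case this bounds it from below at
  every finite time.
\<close>

definition free_energy :: "(nat \<Rightarrow> real ^ 'd ^ 'd) \<Rightarrow> nat \<Rightarrow> real" where
  "free_energy A n = rv_entropy (initial_word n) + 2 * log_norm A n"

lemma free_energy_limit:
  assumes good: "nonvanishing A" and fin: "lyapunov A \<nu> \<noteq> -\<infinity>"
  shows "metric_entropy shift \<nu> + ereal 2 * lyapunov A \<nu> = (INF n\<in>{1..}. ereal (free_energy A n / real n))"
proof -
  obtain r where r: "lyapunov A \<nu> = ereal r"
    using fin lyapunov_nonvanishing(2)[OF good] by (cases "lyapunov A \<nu>") auto
  have "(\<lambda>n. log_norm A n / real n) \<longlonglongrightarrow> r"
    using lyapunov_nonvanishing(1)[OF good] unfolding r by simp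
  from tendsto_add[OF shift_entropy tendsto_mult[OF tendsto_const[of 2] this]]
  have "(\<lambda>n. free_energy A n / real n) \<longlonglongrightarrow> shift_entropy + 2 * r"
    by (simp add: free_energy_def add_divide_distrib)
  then have "(\<lambda>n. ereal (free_energy A n / real n)) \<longlonglongrightarrow> ereal (shift_entropy + 2 * r)" by simp
  moreover have "(\<lambda>n. ereal (free_energy A n / real n)) \<longlonglongrightarrow> (INF n\<in>{1..}. ereal (free_energy A n / real n))"
  proof (rule fekete)
    fix m n
    show "free_energy A (m + n) \<le> free_energy A m + free_energy A n"
      using name_entropy_subadditive[OF simple_first, of m n] log_norm_subadditive[OF good, of m n]
      by (simp add: free_energy_def name_first)
  qed
  ultimately have "(INF n\<in>{1..}. ereal (free_energy A n / real n)) = ereal (shift_entropy + 2 * r)"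
    by (rule LIMSEQ_unique[rotated])
  then show ?thesis by (simp add: metric_entropy_shift r)
qed

end

section \<open>Gibbs measures\<close>

text \<open>
  Only the following two-sided estimate for the cylinder masses of the Kusuoka measure enters the
  thermodynamic argument. The eigenvalue \<open>l\<close> plays the role of \<open>e\<^bsup>P\<^esup>\<close>.
\<close>

locale gibbs = \<mu>: shift_system \<mu> K for \<mu> K +
  fixes A :: "nat \<Rightarrow> real ^ 'd ^ 'd" and l C :: real
  assumes l_pos: "l > 0" and C_pos: "C > 0"
    and upper: "\<And>n w. w \<in> words K n \<Longrightarrow>
      measure \<mu> (cylinder K w) \<le> C * ((mat_norm (mat_prod A w))\<^sup>2 / l ^ n)"
    and lower: "\<And>n w. w \<in> words K n \<Longrightarrow>
      (mat_norm (mat_prod A w))\<^sup>2 / l ^ n \<le> C * measure \<mu> (cylinder K w)"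
begin

definition weight :: "nat list \<Rightarrow> real" where
  "weight w = measure \<mu> (cylinder K w)"

lemma weight_pos_iff: "w \<in> words K n \<Longrightarrow> weight w > 0 \<longleftrightarrow> mat_prod A w \<noteq> 0"
proof -
  assume w: "w \<in> words K n"
  let ?a = "(mat_norm (mat_prod A w))\<^sup>2 / l ^ n"
  have "?a > 0 \<longleftrightarrow> mat_prod A w \<noteq> 0" using l_pos mat_norm_eq_0[of "mat_prod A w"]
    by (simp add: zero_less_divide_iff)
  moreover have "weight w > 0 \<longleftrightarrow> ?a > 0"
    using upper[OF w] lower[OF w] C_pos l_pos unfolding weight_def
    by (metis mult_pos_pos order_less_le_trans zero_less_mult_pos)
  ultimately show ?thesis by simp
qed

lemma ln_weight:
  assumes w: "w \<in> words K n" "mat_prod A w \<noteq> 0"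
  shows "- ln (weight w) \<le> real n * ln l - 2 * ln (mat_norm (mat_prod A w)) + ln C"
    and "real n * ln l - 2 * ln (mat_norm (mat_prod A w)) - ln C \<le> - ln (weight w)"
proof -
  have pos: "weight w > 0" "mat_norm (mat_prod A w) > 0" using w weight_pos_iff mat_norm_pos by auto
  have eq: "ln ((mat_norm (mat_prod A w))\<^sup>2 / l ^ n) = 2 * ln (mat_norm (mat_prod A w)) - real n * ln l"
    using pos l_pos by (simp add: ln_div ln_realpow)
  have apos: "(mat_norm (mat_prod A w))\<^sup>2 / l ^ n > 0" using pos l_pos by simp
  have "ln (weight w) \<le> ln (C * ((mat_norm (mat_prod A w))\<^sup>2 / l ^ n))"
    using upper[OF w(1)] pos unfolding weight_def by (intro ln_mono) auto
  also have "\<dots> = ln C + ln ((mat_norm (mat_prod A w))\<^sup>2 / l ^ n)"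
    using C_pos apos by (rule ln_mult_pos)
  finally show "real n * ln l - 2 * ln (mat_norm (mat_prod A w)) - ln C \<le> - ln (weight w)"
    using eq by simp
  have "ln ((mat_norm (mat_prod A w))\<^sup>2 / l ^ n) \<le> ln (C * weight w)"
    using lower[OF w(1)] apos unfolding weight_def by (intro ln_mono) auto
  also have "\<dots> = ln C + ln (weight w)" using C_pos pos(1) by (rule ln_mult_pos)
  finally show "- ln (weight w) \<le> real n * ln l - 2 * ln (mat_norm (mat_prod A w)) + ln C"
    using eq by simp
qed

lemma sum_weight: "(\<Sum>w\<in>initial_word n ` full_shift K. weight w) = 1"
proof -
  have "(\<Sum>w\<in>initial_word n ` full_shift K. weight w) = (\<Sum>w\<in>initial_word n ` space \<mu>. \<mu>.law (initial_word n) w)"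
    unfolding \<mu>.space_\<nu> weight_def by (rule sum.cong[OF refl]) (auto simp: \<mu>.law_initial_word)
  then show ?thesis using \<mu>.sum_law[OF \<mu>.simple_initial_word] by simp
qed

lemma nonvanishing: "\<mu>.nonvanishing A"
  unfolding \<mu>.nonvanishing_def
proof (intro allI impI)
  fix n w assume w: "\<mu>.law (initial_word n) w > 0"
  have "w \<in> words K n" "length w = n" using \<mu>.law_pos_words[OF w] by (auto simp: words_def)
  then show "mat_prod A w \<noteq> 0"
    using w weight_pos_iff by (simp add: \<mu>.law_initial_word weight_def)
qed

lemma free_energy_lower: "real n * ln l - ln C \<le> \<mu>.free_energy A n"
proof -
  let ?X = "initial_word n"
  let ?h = "\<lambda>w. (real n * ln l - ln C) + (- 2) * ln (mat_norm (mat_prod A w)) + 0 * indicator {} w"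
  have "(real n * ln l - ln C) + (- 2) * \<mu>.log_norm A n + 0 * \<mu>.prob (cylinders K n {}) =
      \<mu>.expectation (\<lambda>x. ?h (?X x))"
    by (rule \<mu>.expectation_affine[symmetric])
  also have "\<dots> \<le> \<mu>.expectation (\<lambda>x. - ln (\<mu>.law ?X (?X x)))"
  proof (rule \<mu>.expectation_mono_law[OF \<mu>.simple_initial_word])
    fix w assume w: "\<mu>.law ?X w > 0"
    have W: "w \<in> words K n" "length w = n" using \<mu>.law_pos_words[OF w] by (auto simp: words_def)
    have "\<mu>.law ?X w = weight w" using W by (simp add: \<mu>.law_initial_word weight_def)
    moreover have "mat_prod A w \<noteq> 0" using nonvanishing w by (auto simp: \<mu>.nonvanishing_def)
    ultimately show "?h w \<le> - ln (\<mu>.law ?X w)" using ln_weight(2)[OF W(1)] by simp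
  qed
  also have "\<dots> = \<mu>.rv_entropy ?X"
    by (rule \<mu>.rv_entropy_eq_expectation[OF \<mu>.simple_initial_word, symmetric])
  finally show ?thesis by (simp add: \<mu>.free_energy_def)
qed

context
  fixes \<nu> assumes \<nu>: "shift_system \<nu> K"
begin

interpretation \<nu>: shift_system \<nu> K by (rule \<nu>)

text \<open>
  The Gibbs inequality for the law of initial words under \<open>\<nu>\<close>, against a vector \<open>q\<close> obtained from the
  weights of \<open>\<mu>\<close>. The variable \<open>a\<close> is a constant loss and \<open>b\<close> a gain or loss on the words in \<open>S\<close>:
  plain weights give the variational inequality, and weights biased towards \<open>S\<close> give absolute
  continuity.
\<close>

lemma free_energy_upper:
  assumes good: "\<nu>.nonvanishing A"
    and q: "\<And>w. 0 \<le> q w" "(\<Sum>w\<in>initial_word n ` full_shift K. q w) \<le> 1"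
    and le: "\<And>w. w \<in> words K n \<Longrightarrow> weight w > 0 \<Longrightarrow> q w > 0 \<and> - ln (q w) \<le> - ln (weight w) + a + b * indicator S w"
  shows "\<nu>.free_energy A n \<le> real n * ln l + ln C + a + b * \<nu>.prob (cylinders K n S)"
proof -
  let ?X = "initial_word n"
  let ?h = "\<lambda>w. (real n * ln l + ln C + a) + (- 2) * ln (mat_norm (mat_prod A w)) + b * indicator S w"
  note X = \<nu>.simple_initial_word
  have w: "w \<in> words K n \<and> mat_prod A w \<noteq> 0 \<and> weight w > 0" if "\<nu>.law ?X w > 0" for w
    using \<nu>.law_pos_words[OF that] that good weight_pos_iff[of w n] by (auto simp: \<nu>.nonvanishing_def)
  have "\<nu>.rv_entropy ?X \<le> \<nu>.expectation (\<lambda>x. - ln (q (?X x)))"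
    by (rule \<nu>.gibbs_inequality[OF X]) (use q le w in \<open>auto simp: \<nu>.space_\<nu>\<close>)
  also have "\<dots> \<le> \<nu>.expectation (\<lambda>x. ?h (?X x))"
  proof (rule \<nu>.expectation_mono_law[OF X])
    fix w assume "\<nu>.law ?X w > 0"
    from w[OF this] show "- ln (q w) \<le> ?h w" using le[of w] ln_weight(1)[of w n] by fastforce
  qed
  also have "\<dots> = (real n * ln l + ln C + a) + (- 2) * \<nu>.log_norm A n + b * \<nu>.prob (cylinders K n S)"
    by (rule \<nu>.expectation_affine)
  finally show ?thesis by (simp add: \<nu>.free_energy_def)
qed

lemma free_energy_le:
  assumes good: "\<nu>.nonvanishing A"
  shows "\<nu>.free_energy A n \<le> real n * ln l + ln C"
  using free_energy_upper[OF good, of weight n 0 0 "{}"] sum_weight[of n] by (simp add: weight_def)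

text \<open>
  Here \<open>q\<close> is the average of \<open>\<mu>\<close> and of \<open>\<mu>\<close> conditioned on the union \<open>U\<close> of cylinders. If \<open>\<mu> U\<close> is
  small and \<open>\<nu> U\<close> is not, the last summand is very negative.
\<close>

lemma free_energy_cylinders:
  assumes good: "\<nu>.nonvanishing A" and U: "\<mu>.prob (cylinders K n S) > 0" (is "?u > 0")
  shows "\<nu>.free_energy A n \<le> real n * ln l + ln C + ln 2 + ln (\<mu>.prob (cylinders K n S)) * \<nu>.prob (cylinders K n S)"
proof (rule free_energy_upper[OF good])
  let ?q = "\<lambda>w. weight w * (1 + indicator S w / ?u) / 2"
  show "0 \<le> ?q w" for w using U by (simp add: weight_def)
  have "(\<Sum>w\<in>initial_word n ` full_shift K. weight w * indicator S w) = ?u"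
    unfolding \<mu>.prob_cylinders weight_def \<mu>.space_\<nu>
    by (intro sum.cong refl) (auto simp: \<mu>.law_initial_word)
  moreover have "(\<Sum>w\<in>initial_word n ` full_shift K. ?q w) =
     ((\<Sum>w\<in>initial_word n ` full_shift K. weight w) + (\<Sum>w\<in>initial_word n ` full_shift K. weight w * indicator S w) / ?u) / 2"
    by (simp add: sum.distrib[symmetric] sum_divide_distrib distrib_left add_divide_distrib)
  ultimately show "(\<Sum>w\<in>initial_word n ` full_shift K. ?q w) \<le> 1"
    using U by (simp add: sum_weight)
  fix w assume "w \<in> words K n" and w: "weight w > 0"
  have pos: "?q w > 0" using w U by (simp add: add_pos_nonneg)
  have "weight w / 2 * (if w \<in> S then 1 / ?u else 1) \<le> ?q w"
    using w U by (auto simp: indicator_def field_simps)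
  then have "ln (weight w / 2 * (if w \<in> S then 1 / ?u else 1)) \<le> ln (?q w)"
    using w U by (intro ln_mono) auto
  moreover have "ln (weight w / 2 * (if w \<in> S then 1 / ?u else 1)) = ln (weight w) - ln 2 - ln ?u * indicator S w"
    using w U by (auto simp: ln_mult ln_div)
  ultimately show "?q w > 0 \<and> - ln (?q w) \<le> - ln (weight w) + ln 2 + ln ?u * indicator S w"
    using pos by simp
qed

lemma free_energy_rate_le: "(\<lambda>n. ereal (ln l + ln C / real n)) \<longlonglongrightarrow> ereal (ln l)"
  using tendsto_add[OF tendsto_const lim_const_over_n[of "ln C"], of "ln l"] by simp

lemma equilibrium_upper:
  "metric_entropy shift \<nu> + ereal 2 * lyapunov A \<nu> \<le> ereal (ln l)"
proof (cases "\<nu>.nonvanishing A \<and> lyapunov A \<nu> \<noteq> -\<infinity>")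
  case True
  let ?I = "INF n\<in>{1..}. ereal (\<nu>.free_energy A n / real n)"
  have "?I \<le> ereal (ln l)"
  proof (rule LIMSEQ_le_const[OF free_energy_rate_le], intro exI[of _ 1] allI impI)
    fix n :: nat assume n: "n \<ge> 1"
    have "?I \<le> ereal (\<nu>.free_energy A n / real n)" using n by (intro INF_lower) auto
    also have "\<nu>.free_energy A n / real n \<le> (real n * ln l + ln C) / real n"
      using True free_energy_le by (intro divide_right_mono) auto
    also have "\<dots> = ln l + ln C / real n" using n by (simp add: add_divide_distrib)
    finally show "?I \<le> ereal (ln l + ln C / real n)" by simp
  qed
  moreover have "metric_entropy shift \<nu> + ereal 2 * lyapunov A \<nu> = ?I"
    using True by (intro \<nu>.free_energy_limit) auto
  ultimately show ?thesis by (simp only:)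
next
  case False
  then have "lyapunov A \<nu> = -\<infinity>" using \<nu>.lyapunov_vanishing by blast
  then show ?thesis by (simp add: \<nu>.metric_entropy_shift)
qed

text \<open>
  In the equilibrium case the infimum of the averaged free energies is \<open>ln l\<close>, hence each of them
  is at least \<open>ln l\<close>. Together with the upper bounds the relative entropies of \<open>\<nu>\<close> with respect to
  \<open>\<mu>\<close> on words of length \<open>n\<close> are bounded uniformly in \<open>n\<close>.
\<close>

lemma equilibrium_free_energy:
  assumes eq: "metric_entropy shift \<nu> + ereal 2 * lyapunov A \<nu> = ereal (ln l)"
  shows "\<nu>.nonvanishing A" "real n * ln l \<le> \<nu>.free_energy A n"
proof -
  have fin: "lyapunov A \<nu> \<noteq> -\<infinity>"
  proof
    assume "lyapunov A \<nu> = -\<infinity>"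
    then show False using eq by (simp add: \<nu>.metric_entropy_shift)
  qed
  then show good: "\<nu>.nonvanishing A" using \<nu>.lyapunov_vanishing by blast
  show "real n * ln l \<le> \<nu>.free_energy A n"
  proof (cases "n = 0")
    case True
    have "mat_norm (mat 1 :: real ^ 'd ^ 'd) = 1"
      by (simp add: mat_norm_def onorm_id)
    then show ?thesis
      using True \<nu>.rv_entropy_nonneg[of "initial_word 0"]
      by (simp add: \<nu>.free_energy_def \<nu>.log_norm_def initial_word_def)
  next
    case False
    have "ereal (ln l) \<le> ereal (\<nu>.free_energy A n / real n)"
      unfolding eq[symmetric] \<nu>.free_energy_limit[OF good fin] using False by (intro INF_lower) auto
    then show ?thesis using False by (simp add: field_simps)
  qed
qed

text \<open>
  The uniform bound on relative entropies gives \<open>\<nu> U \<le> D / t\<close> for every union of cylinders with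
  \<open>\<mu> U < e\<^bsup>- t\<^esup>\<close>. A \<open>\<mu>\<close>-null set is approximated by such unions in both measures, with \<open>t\<close>
  arbitrarily large.
\<close>

lemma equilibrium_absolutely_continuous:
  assumes eq: "metric_entropy shift \<nu> + ereal 2 * lyapunov A \<nu> = ereal (ln l)"
  shows "absolutely_continuous \<mu> \<nu>"
proof -
  note good = equilibrium_free_energy(1)[OF eq]
  define D where "D = \<bar>ln C + ln 2\<bar>"
  have key: "\<nu>.prob (cylinders K n S) \<le> D / t" if t: "t > 0" and U: "\<mu>.prob (cylinders K n S) < exp (- t)" for n S t
  proof (cases "\<mu>.prob (cylinders K n S) > 0")
    case True
    let ?u = "\<mu>.prob (cylinders K n S)" and ?v = "\<nu>.prob (cylinders K n S)"
    have "0 \<le> ln C + ln 2 + ln ?u * ?v"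
      using equilibrium_free_energy(2)[OF eq, of n] free_energy_cylinders[OF good True] by linarith
    moreover have "ln ?u \<le> - t"
    proof -
      have "ln ?u \<le> ln (exp (- t))" using U True by (intro ln_mono) auto
      then show ?thesis by simp
    qed
    then have "ln ?u * ?v \<le> - t * ?v" by (intro mult_right_mono) auto
    ultimately have "t * ?v \<le> D" unfolding D_def by linarith
    then show ?thesis using t by (simp add: field_simps)
  next
    case False
    then have u0: "\<mu>.prob (cylinders K n S) = 0" using measure_nonneg[of \<mu> "cylinders K n S"] by linarith
    have "\<nu>.law (initial_word n) w * indicator S w = 0" if "w \<in> initial_word n ` space \<nu>" for w
    proof (rule ccontr)
      assume "\<not> ?thesis"
      then have w: "\<nu>.law (initial_word n) w > 0" "w \<in> S"
        using \<nu>.law_nonneg[of "initial_word n" w] by (auto simp: indicator_def less_le split: if_splits)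
      then have W: "w \<in> words K n" "mat_prod A w \<noteq> 0" "length w = n"
        using \<nu>.law_pos_words[OF w(1)] good by (auto simp: \<nu>.nonvanishing_def words_def)
      have "weight w > 0" using W weight_pos_iff by blast
      moreover have "weight w \<le> \<mu>.prob (cylinders K n S)"
        unfolding weight_def using w(2) W(3)
        by (intro \<mu>.finite_measure_mono)
          (auto simp: \<mu>.sets_\<nu> cylinders_sets, auto simp: cylinder_eq_cylinders cylinders_def)
      ultimately show False using u0 by simp
    qed
    then have "\<nu>.prob (cylinders K n S) = 0" unfolding \<nu>.prob_cylinders by (rule sum.neutral[rule_format])
    then show ?thesis using t by (simp add: D_def)
  qed
  show ?thesis
    unfolding absolutely_continuous_def
  proof
    fix N assume N: "N \<in> null_sets \<mu>"
    then have Ns: "N \<in> sets (shift_borel K)" and N0: "\<mu>.prob N = 0"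
      by (auto simp: null_sets_def \<mu>.sets_\<nu> measure_def)
    have bound: "\<nu>.prob N \<le> D / t + exp (- t)" if t: "t > 0" for t
    proof -
      obtain n S where S: "\<mu>.prob (sym_diff N (cylinders K n S)) < exp (- t)" "\<nu>.prob (sym_diff N (cylinders K n S)) < exp (- t)"
        using cylinders_approx[OF \<mu>.finite_measure_axioms \<nu>.finite_measure_axioms \<mu>.sets_\<nu> \<nu>.sets_\<nu> Ns, of "exp (- t)"]
        by auto
      let ?U = "cylinders K n S"
      have sym: "sym_diff N ?U \<in> sets (shift_borel K)"
        by (rule sets.Un[OF sets.Diff[OF Ns cylinders_sets] sets.Diff[OF cylinders_sets Ns]])
      have "\<mu>.prob ?U \<le> \<mu>.prob (N \<union> sym_diff N ?U)"
        using sets.Un[OF Ns sym] by (intro \<mu>.finite_measure_mono) (auto simp: \<mu>.sets_\<nu>)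
      also have "\<dots> \<le> \<mu>.prob N + \<mu>.prob (sym_diff N ?U)"
        using Ns sym by (intro measure_Un_le) (simp_all only: \<mu>.sets_\<nu>)
      finally have "\<mu>.prob ?U < exp (- t)" using S(1) N0 by simp
      from key[OF t this] have U: "\<nu>.prob ?U \<le> D / t" .
      have "\<nu>.prob N \<le> \<nu>.prob (?U \<union> sym_diff N ?U)"
        using sets.Un[OF cylinders_sets sym] by (intro \<nu>.finite_measure_mono) (auto simp: \<nu>.sets_\<nu>)
      also have "\<dots> \<le> \<nu>.prob ?U + \<nu>.prob (sym_diff N ?U)"
        using sym cylinders_sets by (intro measure_Un_le) (simp_all only: \<nu>.sets_\<nu>)
      finally show ?thesis using U S(2) by linarith
    qed
    have "((\<lambda>t. D / t + exp (- t)) \<longlongrightarrow> 0 + 0) at_top"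
      by (intro tendsto_add tendsto_divide_0[OF tendsto_const]
            filterlim_at_top_imp_at_infinity filterlim_ident
            filterlim_compose[OF exp_at_bot filterlim_uminus_at_bot_at_top])
    then have "((\<lambda>t. D / t + exp (- t)) \<longlongrightarrow> 0) at_top" by simp
    then have "\<nu>.prob N \<le> 0"
      by (rule tendsto_lowerbound)
        (auto intro!: eventually_mono[OF eventually_gt_at_top[of 0]] bound)
    then have "\<nu>.prob N = 0" using measure_nonneg[of \<nu> N] by linarith
    then show "N \<in> null_sets \<nu>"
      using Ns by (simp add: null_sets_def \<nu>.sets_\<nu> \<nu>.emeasure_eq_measure)
  qed
qed

end

text \<open>
  For \<open>\<mu>\<close> itself the law of initial words is the vector of weights, so the entropy equals the
  integral of \<open>- ln (weight w)\<close> and the lower Gibbs bound applies.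
\<close>

lemma equilibrium_gibbs: "metric_entropy shift \<mu> + ereal 2 * lyapunov A \<mu> = ereal (ln l)"
proof (rule antisym[OF equilibrium_upper[OF \<mu>.shift_system_axioms]])
  let ?h = "\<mu>.shift_entropy"
  have "(\<lambda>n. (ln l + (- ln C) / real n - \<mu>.rv_entropy (initial_word n) / real n) / 2) \<longlonglongrightarrow> (ln l + 0 - ?h) / 2"
    by (intro tendsto_divide tendsto_diff tendsto_add tendsto_const lim_const_over_n \<mu>.shift_entropy) simp
  then have "(\<lambda>n. ereal ((ln l + (- ln C) / real n - \<mu>.rv_entropy (initial_word n) / real n) / 2)) \<longlonglongrightarrow> ereal ((ln l - ?h) / 2)"
    by simp
  then have "ereal ((ln l - ?h) / 2) \<le> lyapunov A \<mu>"
  proof (rule LIMSEQ_le[OF _ \<mu>.lyapunov_nonvanishing(1)[OF nonvanishing]], intro exI[of _ 1] allI impI)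
    fix n :: nat assume n: "n \<ge> 1"
    have "(real n * ln l - ln C) / real n \<le> \<mu>.free_energy A n / real n"
      by (intro divide_right_mono free_energy_lower) simp
    then show "ereal ((ln l + (- ln C) / real n - \<mu>.rv_entropy (initial_word n) / real n) / 2) \<le>
        ereal (\<mu>.log_norm A n / real n)"
      using n by (simp add: \<mu>.free_energy_def diff_divide_distrib add_divide_distrib)
  qed
  then show "ereal (ln l) \<le> metric_entropy shift \<mu> + ereal 2 * lyapunov A \<mu>"
    by (cases "lyapunov A \<mu>") (auto simp: \<mu>.metric_entropy_shift)
qed

end

section \<open>Ergodicity and uniqueness\<close>

text \<open>
  The integral of \<open>f - 1 > 0\<close> over \<open>E\<close> is zero.
\<close>

lemma density_gt_one_null:
  assumes fin: "finite_measure \<mu>" and f: "f \<in> borel_measurable \<mu>" and \<nu>: "\<nu> = density \<mu> f"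
    and E: "E \<in> sets \<mu>" "\<And>x. x \<in> E \<Longrightarrow> f x > 1" and eq: "emeasure \<nu> E = emeasure \<mu> E"
  shows "E \<in> null_sets \<mu>"
proof -
  interpret finite_measure \<mu> by fact
  have meas: "(\<lambda>x. (f x - 1) * indicator E x) \<in> borel_measurable \<mu>"
    using f E(1) by measurable
  have "emeasure \<mu> E = emeasure \<nu> E" by (rule eq[symmetric])
  also have "\<dots> = (\<integral>\<^sup>+ x. f x * indicator E x \<partial>\<mu>)"
    unfolding \<nu> by (rule emeasure_density[OF f E(1)])
  also have "\<dots> = (\<integral>\<^sup>+ x. indicator E x + (f x - 1) * indicator E x \<partial>\<mu>)"
  proof (rule nn_integral_cong)
    fix x
    show "f x * indicator E x = indicator E x + (f x - 1) * indicator E x"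
    proof (cases "x \<in> E")
      case True
      have "1 \<le> f x" by (rule less_imp_le[OF E(2)[OF True]])
      then show ?thesis using True by (simp add: add_diff_inverse_ennreal)
    qed simp
  qed
  also have "\<dots> = (\<integral>\<^sup>+ x. indicator E x \<partial>\<mu>) + (\<integral>\<^sup>+ x. (f x - 1) * indicator E x \<partial>\<mu>)"
    using meas E(1) by (intro nn_integral_add) auto
  also have "(\<integral>\<^sup>+ x. indicator E x \<partial>\<mu>) = emeasure \<mu> E" using E(1) by simp
  finally have "emeasure \<mu> E + 0 = emeasure \<mu> E + (\<integral>\<^sup>+ x. (f x - 1) * indicator E x \<partial>\<mu>)" by simp
  then have "(\<integral>\<^sup>+ x. (f x - 1) * indicator E x \<partial>\<mu>) = 0"
    using emeasure_finite[of E] by (subst (asm) ennreal_add_left_cancel) auto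
  then have "AE x in \<mu>. (f x - 1) * indicator E x = 0"
    using meas by (simp add: nn_integral_0_iff_AE)
  then have "AE x in \<mu>. x \<notin> E"
  proof eventually_elim
    case (elim x)
    show ?case
    proof
      assume x: "x \<in> E"
      then have "f x - 1 > 0" using E(2)[OF x] by (simp add: diff_gr0_ennreal)
      then show False using elim x by simp
    qed
  qed
  then show ?thesis using E(1) by (simp add: AE_iff_null_sets)
qed

locale irreducible_gibbs = gibbs \<mu> K A l C
  for \<mu> K and A :: "nat \<Rightarrow> real ^ 'd ^ 'd" and l C +
  assumes irreducible: "irreducible_tuple K A"
begin

text \<open>
  A lower bound opposite to submultiplicativity of the norm. The finitely many factors
  \<open>l ^ length z\<close> are absorbed into the constant.
\<close>

lemma weight_mixing:
  "\<exists>Z c. finite Z \<and> (\<forall>z\<in>Z. set z \<subseteq> {1..K}) \<and> c > 0 \<and>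
    (\<forall>m n. \<forall>u\<in>words K m. \<forall>v\<in>words K n. c * (weight u * weight v) \<le> (\<Sum>z\<in>Z. weight (u @ z @ v)))"
proof -
  obtain Z c where Z: "finite Z" "\<forall>z\<in>Z. set z \<subseteq> {1..K}" "c > 0"
    and mix: "\<And>(X :: real ^ 'd ^ 'd) (Y :: real ^ 'd ^ 'd). c * (mat_norm X)\<^sup>2 * (mat_norm Y)\<^sup>2 \<le>
      (\<Sum>z\<in>Z. (mat_norm (Y ** mat_prod A z ** X))\<^sup>2)"
    using irreducible_mixing[OF irreducible] by blast
  define b where "b = (\<Sum>z\<in>Z. l ^ length z) + 1"
  have b_pos: "b > 0" using l_pos by (simp add: b_def add_nonneg_pos sum_nonneg)
  have b: "l ^ length z \<le> b" if "z \<in> Z" for z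
    using member_le_sum[of z Z "\<lambda>z. l ^ length z"] that Z(1) l_pos by (simp add: b_def)
  let ?c = "c / (C * C * C * b)"
  have "?c * (weight u * weight v) \<le> (\<Sum>z\<in>Z. weight (u @ z @ v))"
    if u: "u \<in> words K m" and v: "v \<in> words K n" for u v m n
  proof -
    let ?U = "(mat_norm (mat_prod A u))\<^sup>2" and ?V = "(mat_norm (mat_prod A v))\<^sup>2"
    have "c * (weight u * weight v) \<le> c * ((C * (?U / l ^ m)) * (C * (?V / l ^ n)))"
      using upper[OF u] upper[OF v] Z(3) C_pos l_pos
      unfolding weight_def by (intro mult_left_mono mult_mono) auto
    also have "\<dots> = C * C * ((c * ?U * ?V) / l ^ (m + n))" by (simp add: power_add)
    also have "\<dots> \<le> C * C * ((\<Sum>z\<in>Z. (mat_norm (mat_prod A (u @ z @ v)))\<^sup>2) / l ^ (m + n))"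
      using mix[of "mat_prod A u" "mat_prod A v"] C_pos l_pos
      by (intro mult_left_mono divide_right_mono) (auto simp: mat_prod_append)
    also have "\<dots> = (\<Sum>z\<in>Z. C * C * ((mat_norm (mat_prod A (u @ z @ v)))\<^sup>2 / l ^ (m + n)))"
      by (simp add: sum_divide_distrib sum_distrib_left)
    also have "\<dots> \<le> (\<Sum>z\<in>Z. C * C * (C * b * weight (u @ z @ v)))"
    proof (intro sum_mono mult_left_mono)
      fix z assume z: "z \<in> Z"
      have w: "u @ z @ v \<in> words K (m + length z + n)"
        using u v z Z(2) by (auto simp: words_def)
      let ?N = "(mat_norm (mat_prod A (u @ z @ v)))\<^sup>2"
      have "?N / l ^ (m + n) = l ^ length z * (?N / l ^ (m + length z + n))"
        using l_pos by (simp add: power_add)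
      also have "\<dots> \<le> b * (C * weight (u @ z @ v))"
        using lower[OF w] b[OF z] b_pos l_pos unfolding weight_def by (intro mult_mono) auto
      finally show "?N / l ^ (m + n) \<le> C * b * weight (u @ z @ v)" by (simp add: mult_ac)
    qed (use C_pos in auto)
    also have "\<dots> = C * C * C * b * (\<Sum>z\<in>Z. weight (u @ z @ v))"
      by (simp only: sum_distrib_left mult.assoc)
    finally have le: "c * (weight u * weight v) \<le> C * C * C * b * (\<Sum>z\<in>Z. weight (u @ z @ v))" .
    have "C * C * C * b > 0" using C_pos b_pos by simp
    from pos_divide_le_eq[OF this] le show ?thesis by (simp add: mult_ac)
  qed
  moreover have "?c > 0" using Z(3) C_pos b_pos by simp
  ultimately show ?thesis by (intro exI[of _ Z] exI[of _ ?c] conjI Z(1) Z(2) allI ballI)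
qed

lemma prob_cylinders_weight: "\<mu>.prob (cylinders K n S) = (\<Sum>w\<in>words K n \<inter> S. weight w)"
  unfolding weight_def by (rule measure_cylinders[OF \<mu>.finite_measure_axioms \<mu>.sets_\<nu>])

lemma cylinders_mixing:
  "\<exists>Z c. finite (Z :: nat list set) \<and> c > 0 \<and>
    (\<forall>m n S R. c * (\<mu>.prob (cylinders K m S) * \<mu>.prob (cylinders K n R)) \<le>
       (\<Sum>z\<in>Z. \<mu>.prob (cylinders K m S \<inter> (shift ^^ (m + length z)) -` cylinders K n R)))"
proof -
  obtain Z c where Z: "finite Z" "\<forall>z\<in>Z. set z \<subseteq> {1..K}" "c > 0"
    and mix: "\<And>m n u v. u \<in> words K m \<Longrightarrow> v \<in> words K n \<Longrightarrow>
      c * (weight u * weight v) \<le> (\<Sum>z\<in>Z. weight (u @ z @ v))"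
    using weight_mixing by blast
  have "c * (\<mu>.prob (cylinders K m S) * \<mu>.prob (cylinders K n R)) \<le>
       (\<Sum>z\<in>Z. \<mu>.prob (cylinders K m S \<inter> (shift ^^ (m + length z)) -` cylinders K n R))" for m n S R
  proof -
    let ?S = "words K m \<inter> S" and ?R = "words K n \<inter> R"
    have "c * (\<mu>.prob (cylinders K m S) * \<mu>.prob (cylinders K n R)) = (\<Sum>(u, v)\<in>?S \<times> ?R. c * (weight u * weight v))"
      unfolding prob_cylinders_weight sum_product sum.cartesian_product
      by (simp add: sum_distrib_left case_prod_beta)
    also have "\<dots> \<le> (\<Sum>(u, v)\<in>?S \<times> ?R. \<Sum>z\<in>Z. weight (u @ z @ v))"
      by (intro sum_mono) (auto intro: mix)
    also have "\<dots> = (\<Sum>z\<in>Z. \<Sum>(u, v)\<in>?S \<times> ?R. weight (u @ z @ v))"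
      by (simp add: case_prod_beta sum.swap[of _ Z])
    also have "\<dots> \<le> (\<Sum>z\<in>Z. \<mu>.prob (cylinders K m S \<inter> (shift ^^ (m + length z)) -` cylinders K n R))"
    proof (rule sum_mono)
      fix z assume z: "z \<in> Z"
      let ?N = "m + length z + n"
      let ?T = "(\<lambda>(u, v). u @ z @ v) ` (?S \<times> ?R)"
      have inj: "inj_on (\<lambda>(u, v). u @ z @ v) (?S \<times> ?R)"
        by (auto simp: inj_on_def words_def)
      have "set z \<subseteq> {1..K}" using z Z(2) by blast
      then have T: "words K ?N \<inter> ?T = ?T" unfolding words_def by fastforce
      have "(\<Sum>(u, v)\<in>?S \<times> ?R. weight (u @ z @ v)) = (\<Sum>w\<in>?T. weight w)"
        unfolding sum.reindex[OF inj] by (simp add: case_prod_beta o_def)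
      also have "\<dots> = \<mu>.prob (cylinders K ?N ?T)" by (simp add: prob_cylinders_weight T)
      also have "\<dots> \<le> \<mu>.prob (cylinders K m S \<inter> (shift ^^ (m + length z)) -` cylinders K n R)"
      proof (rule \<mu>.finite_measure_mono)
        show "cylinders K ?N ?T \<subseteq> cylinders K m S \<inter> (shift ^^ (m + length z)) -` cylinders K n R"
        proof
          fix x assume x: "x \<in> cylinders K ?N ?T"
          then obtain u v where uv: "u \<in> ?S" "v \<in> ?R" "initial_word ?N x = u @ z @ v" and xK: "x \<in> full_shift K"
            by (auto simp: cylinders_def)
          have len: "length u = m" "length v = n" using uv by (auto simp: words_def)
          have "initial_word m x = take m (initial_word ?N x)" by (simp add: take_initial_word)
          then have "initial_word m x = u" using uv(3) len by simp
          moreover have "initial_word n ((shift ^^ (m + length z)) x) = drop (m + length z) (initial_word ?N x)"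
            by (simp add: initial_word_shift_iter add.commute add.left_commute)
          then have "initial_word n ((shift ^^ (m + length z)) x) = v" using uv(3) len by simp
          ultimately show "x \<in> cylinders K m S \<inter> (shift ^^ (m + length z)) -` cylinders K n R"
            using uv xK by (simp add: cylinders_def shift_iter_full_shift)
        qed
        have "cylinders K m S \<inter> (shift ^^ (m + length z)) -` cylinders K n R =
            cylinders K m S \<inter> ((shift ^^ (m + length z)) -` cylinders K n R \<inter> full_shift K)"
          by (auto simp: cylinders_def)
        then show "cylinders K m S \<inter> (shift ^^ (m + length z)) -` cylinders K n R \<in> sets \<mu>"
          unfolding shift_iter_preimage by (simp add: \<mu>.sets_\<nu> cylinders_sets sets.Int)
      qed
      finally show "(\<Sum>(u, v)\<in>?S \<times> ?R. weight (u @ z @ v)) \<le>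
          \<mu>.prob (cylinders K m S \<inter> (shift ^^ (m + length z)) -` cylinders K n R)" .
    qed
    finally show ?thesis .
  qed
  then show ?thesis using Z by (intro exI[of _ Z] exI[of _ c] conjI allI)
qed

lemma prob_iter_vimage: "B \<in> sets \<mu> \<Longrightarrow> \<mu>.prob ((shift ^^ j) -` B \<inter> space \<mu>) = \<mu>.prob B"
  using measure_distr[OF \<mu>.iter_measurable, of B j] by (simp add: \<mu>.iter_invariant)

text \<open>
  Suppose that almost no point leaves \<open>B\<close>. Then for every \<open>j\<close> the set of points of \<open>B\<close> that lie in
  the complement \<open>B'\<close> after \<open>j\<close> steps is null. Approximating \<open>B\<close> and \<open>B'\<close> by unions of cylinders in
  \<open>cylinders_mixing\<close>, whose right hand side has a fixed number of terms, yields
  \<open>c * \<mu> B * \<mu> B' \<le> 0\<close>.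
\<close>

lemma ergodic:
  assumes B: "B \<in> sets \<mu>" and inv: "\<mu>.prob (B - shift -` B) = 0"
  shows "\<mu>.prob B = 0 \<or> \<mu>.prob B = 1"
proof (rule ccontr)
  assume contr: "\<not> ?thesis"
  define B' where "B' = space \<mu> - B"
  have B': "B' \<in> sets \<mu>" using B by (simp add: B'_def)
  have pre: "(shift ^^ j) -` E \<inter> space \<mu> \<in> sets \<mu>" if "E \<in> sets \<mu>" for j E
    using that by (rule measurable_sets[OF \<mu>.iter_measurable])
  have sub: "E \<subseteq> space \<mu>" if "E \<in> sets \<mu>" for E using that by (rule sets.sets_into_space)
  have B_int: "B \<inter> (shift ^^ j) -` B' = B \<inter> ((shift ^^ j) -` B' \<inter> space \<mu>)" for j
    using sub[OF B] by auto
  have B_int_meas: "B \<inter> (shift ^^ j) -` B' \<in> sets \<mu>" for j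
    unfolding B_int using B pre[OF B'] by auto
  have one: "\<mu>.prob (B \<inter> shift -` B') = 0"
  proof -
    have "B \<inter> shift -` B' = B - shift -` B"
      using sub[OF B] \<mu>.T_space[of _ 1] by (auto simp: B'_def)
    then show ?thesis using inv by simp
  qed
  have escape: "\<mu>.prob (B \<inter> (shift ^^ j) -` B') = 0" for j
  proof (induction j)
    case 0
    have "B \<inter> (shift ^^ 0) -` B' = {}" by (auto simp: B'_def)
    then show ?case by (simp only: measure_empty)
  next
    case (Suc j)
    let ?E = "(shift ^^ j) -` (B \<inter> shift -` B') \<inter> space \<mu>"
    have m1: "B \<inter> shift -` B' \<in> sets \<mu>" using B_int_meas[of 1] by simp
    have "B \<inter> (shift ^^ Suc j) -` B' \<subseteq> (B \<inter> (shift ^^ j) -` B') \<union> ?E"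
      using sub[OF B] \<mu>.T_space[of _ j] by (auto simp: B'_def)
    then have "\<mu>.prob (B \<inter> (shift ^^ Suc j) -` B') \<le> \<mu>.prob ((B \<inter> (shift ^^ j) -` B') \<union> ?E)"
      using B_int_meas pre[OF m1] by (intro \<mu>.finite_measure_mono) auto
    also have "\<dots> \<le> \<mu>.prob (B \<inter> (shift ^^ j) -` B') + \<mu>.prob ?E"
      using B_int_meas pre[OF m1] by (intro measure_Un_le) auto
    also have "\<dots> = 0" using Suc prob_iter_vimage[OF m1] one by simp
    finally show ?case using measure_nonneg[of \<mu> "B \<inter> (shift ^^ Suc j) -` B'"] by linarith
  qed
  obtain Z c where Z: "finite (Z :: nat list set)" "c > 0"
    and mix: "\<And>m n S R. c * (\<mu>.prob (cylinders K m S) * \<mu>.prob (cylinders K n R)) \<le>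
       (\<Sum>z\<in>Z. \<mu>.prob (cylinders K m S \<inter> (shift ^^ (m + length z)) -` cylinders K n R))"
    using cylinders_mixing by blast
  have "\<mu>.prob B' = 1 - \<mu>.prob B" unfolding B'_def by (rule \<mu>.prob_compl[OF B])
  then have pos: "\<mu>.prob B > 0" "\<mu>.prob B' > 0"
    using contr measure_nonneg[of \<mu> B] \<mu>.prob_le_1[of B] by linarith+
  define \<delta> where "\<delta> = min (\<mu>.prob B) (\<mu>.prob B') / 2"
  have \<delta>: "\<delta> > 0" "2 * \<delta> \<le> \<mu>.prob B" "2 * \<delta> \<le> \<mu>.prob B'" using pos by (auto simp: \<delta>_def)
  \<comment> \<open>Each of the \<open>card Z\<close> terms will be at most \<open>2 \<epsilon>\<close>, and the masses of the cylinder unions at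
    least \<open>\<delta>\<close>; this \<open>\<epsilon>\<close> makes the two bounds incompatible.\<close>
  define \<epsilon> where "\<epsilon> = min \<delta> (c * (\<delta> * \<delta>) / (4 * (real (card Z) + 1)))"
  have \<epsilon>: "\<epsilon> > 0" "\<epsilon> \<le> \<delta>" using \<delta>(1) Z(2) by (auto simp: \<epsilon>_def)
  have approx: "\<exists>n S. \<mu>.prob (sym_diff E (cylinders K n S)) < \<epsilon>" if "E \<in> sets \<mu>" for E
    using cylinders_approx[OF \<mu>.finite_measure_axioms \<mu>.finite_measure_axioms \<mu>.sets_\<nu> \<mu>.sets_\<nu> _ \<epsilon>(1), of E]
      that \<mu>.sets_\<nu> by auto
  obtain m S where S: "\<mu>.prob (sym_diff B (cylinders K m S)) < \<epsilon>" using approx[OF B] by blast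
  obtain n R where R: "\<mu>.prob (sym_diff B' (cylinders K n R)) < \<epsilon>" using approx[OF B'] by blast
  let ?U = "cylinders K m S" and ?V = "cylinders K n R"
  have UV: "?U \<in> sets \<mu>" "?V \<in> sets \<mu>" by (simp_all add: \<mu>.sets_\<nu> cylinders_sets)
  have close: "\<delta> \<le> \<mu>.prob W" if "E \<in> sets \<mu>" "W \<in> sets \<mu>" "\<mu>.prob (sym_diff E W) < \<epsilon>" "2 * \<delta> \<le> \<mu>.prob E" for E W
  proof -
    have "\<mu>.prob E \<le> \<mu>.prob (W \<union> sym_diff E W)"
      using that by (intro \<mu>.finite_measure_mono sets.Un sets.Diff) auto
    also have "\<dots> \<le> \<mu>.prob W + \<mu>.prob (sym_diff E W)" using that by (intro measure_Un_le) auto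
    finally show ?thesis using that \<epsilon> by linarith
  qed
  have "\<mu>.prob (?U \<inter> (shift ^^ j) -` ?V) \<le> 2 * \<epsilon>" for j
  proof -
    let ?D = "sym_diff B ?U" and ?E = "(shift ^^ j) -` (sym_diff B' ?V) \<inter> space \<mu>"
    have D: "?D \<in> sets \<mu>" and V: "sym_diff B' ?V \<in> sets \<mu>" using B B' UV by auto
    have "?U \<inter> (shift ^^ j) -` ?V \<subseteq> (B \<inter> (shift ^^ j) -` B') \<union> (?D \<union> ?E)"
      using sub[OF UV(1)] by auto
    then have "\<mu>.prob (?U \<inter> (shift ^^ j) -` ?V) \<le> \<mu>.prob ((B \<inter> (shift ^^ j) -` B') \<union> (?D \<union> ?E))"
      by (intro \<mu>.finite_measure_mono sets.Un[OF B_int_meas sets.Un[OF D pre[OF V]]])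
    also have "\<dots> \<le> \<mu>.prob (B \<inter> (shift ^^ j) -` B') + \<mu>.prob (?D \<union> ?E)"
      by (rule measure_Un_le[OF B_int_meas sets.Un[OF D pre[OF V]]])
    also have "\<mu>.prob (?D \<union> ?E) \<le> \<mu>.prob ?D + \<mu>.prob ?E"
      by (rule measure_Un_le[OF D pre[OF V]])
    finally show ?thesis using escape[of j] prob_iter_vimage[OF V, of j] S R by simp
  qed
  then have "(\<Sum>z\<in>Z. \<mu>.prob (?U \<inter> (shift ^^ (m + length z)) -` ?V)) \<le> (\<Sum>z\<in>Z. 2 * \<epsilon>)"
    by (intro sum_mono)
  also have "\<dots> = 2 * real (card Z) * \<epsilon>" by simp
  finally have "c * (\<mu>.prob ?U * \<mu>.prob ?V) \<le> 2 * real (card Z) * \<epsilon>" using mix[of m S n R] by linarith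
  moreover have "c * (\<delta> * \<delta>) \<le> c * (\<mu>.prob ?U * \<mu>.prob ?V)"
    using close[OF B UV(1) S \<delta>(2)] close[OF B' UV(2) R \<delta>(3)] \<delta>(1) Z(2)
    by (intro mult_left_mono mult_mono) auto
  moreover have "2 * real (card Z) * \<epsilon> < c * (\<delta> * \<delta>)"
  proof -
    have "\<epsilon> \<le> c * (\<delta> * \<delta>) / (4 * (real (card Z) + 1))" by (simp add: \<epsilon>_def)
    then have "\<epsilon> * (4 * (real (card Z) + 1)) \<le> c * (\<delta> * \<delta>)" by (subst (asm) pos_le_divide_eq) auto
    moreover have "2 * real (card Z) * \<epsilon> < \<epsilon> * (4 * (real (card Z) + 1))"
    proof -
      have "0 \<le> \<epsilon> * real (card Z)" using \<epsilon> by simp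
      moreover have "\<epsilon> * (4 * (real (card Z) + 1)) =
          2 * real (card Z) * \<epsilon> + (2 * (\<epsilon> * real (card Z)) + 4 * \<epsilon>)"
        by (simp add: algebra_simps)
      ultimately show ?thesis using \<epsilon> by linarith
    qed
    ultimately show ?thesis by linarith
  qed
  ultimately show False by linarith
qed

text \<open>
  Let \<open>f\<close> be the density of \<open>\<nu>\<close> and \<open>B = {f > 1}\<close>. Both measures are invariant, so \<open>\<nu> - \<mu>\<close> takes the
  same value on \<open>B\<close> and on its preimage \<open>T\<close>. It is nonnegative on \<open>B - T\<close> and nonpositive on
  \<open>T - B\<close>, hence zero on \<open>B - T\<close>, which is therefore \<open>\<mu>\<close>-null. By ergodicity \<open>\<mu> B\<close> is \<open>0\<close> or \<open>1\<close>. It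
  cannot be \<open>1\<close>, since then \<open>\<nu>\<close> would have mass greater than \<open>1\<close>; so \<open>\<nu> \<le> \<mu>\<close>, and the two
  probability measures agree.
\<close>

lemma absolutely_continuous_invariant_unique:
  assumes \<nu>: "shift_system \<nu> K" and ac: "absolutely_continuous \<mu> \<nu>"
  shows "\<nu> = \<mu>"
proof -
  interpret \<nu>: shift_system \<nu> K by (rule \<nu>)
  have sets_eq: "sets \<nu> = sets \<mu>" by (simp add: \<nu>.sets_\<nu> \<mu>.sets_\<nu>)
  define f where "f = RN_deriv \<mu> \<nu>"
  have f: "f \<in> borel_measurable \<mu>" unfolding f_def by (rule borel_measurable_RN_deriv)
  have dens: "\<nu> = density \<mu> f" unfolding f_def using \<mu>.density_RN_deriv[OF ac sets_eq] by simp
  define B where "B = {x \<in> space \<mu>. f x > 1}"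
  have B: "B \<in> sets \<mu>" unfolding B_def using f by measurable
  define T where "T = shift -` B \<inter> space \<mu>"
  have T: "T \<in> sets \<mu>" unfolding T_def by (rule measurable_sets[OF \<mu>.T_measurable B])
  have \<mu>T: "\<mu>.prob T = \<mu>.prob B"
    unfolding T_def using measure_distr[OF \<mu>.T_measurable B] by (simp add: \<mu>.T_invariant)
  have \<nu>T: "\<nu>.prob T = \<nu>.prob B"
    unfolding T_def using measure_distr[OF \<nu>.T_measurable, of B] B
    by (simp add: \<nu>.T_invariant sets_eq \<nu>.space_\<nu> \<mu>.space_\<nu>)
  have ge: "\<mu>.prob E \<le> \<nu>.prob E" if E: "E \<in> sets \<mu>" "E \<subseteq> B" for E
  proof -
    have "emeasure \<mu> E = (\<integral>\<^sup>+ x. 1 * indicator E x \<partial>\<mu>)" using E by simp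
    also have "\<dots> \<le> (\<integral>\<^sup>+ x. f x * indicator E x \<partial>\<mu>)"
      using E(2) by (intro nn_integral_mono) (auto simp: B_def split: split_indicator intro: less_imp_le)
    also have "\<dots> = emeasure \<nu> E" unfolding dens by (rule emeasure_density[OF f E(1), symmetric])
    finally show ?thesis by (simp add: \<mu>.emeasure_eq_measure \<nu>.emeasure_eq_measure)
  qed
  have le: "\<nu>.prob E \<le> \<mu>.prob E" if E: "E \<in> sets \<mu>" "E \<inter> B = {}" for E
  proof -
    have "emeasure \<nu> E = (\<integral>\<^sup>+ x. f x * indicator E x \<partial>\<mu>)" unfolding dens by (rule emeasure_density[OF f E(1)])
    also have "\<dots> \<le> (\<integral>\<^sup>+ x. 1 * indicator E x \<partial>\<mu>)"
      using E(2) sets.sets_into_space[OF E(1)]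
      by (intro nn_integral_mono) (auto simp: B_def not_less[symmetric] split: split_indicator)
    also have "\<dots> = emeasure \<mu> E" using E by simp
    finally show ?thesis by (simp add: \<mu>.emeasure_eq_measure \<nu>.emeasure_eq_measure)
  qed
  have split: "measure \<rho> (B - T) + measure \<rho> (B \<inter> T) = measure \<rho> B"
      "measure \<rho> (T - B) + measure \<rho> (B \<inter> T) = measure \<rho> T"
    if "finite_measure \<rho>" "sets \<rho> = sets \<mu>" for \<rho>
  proof -
    interpret finite_measure \<rho> by fact
    have BT: "B \<in> sets \<rho>" "T \<in> sets \<rho>" using B T that by auto
    show "measure \<rho> (B - T) + measure \<rho> (B \<inter> T) = measure \<rho> B"
      using finite_measure_Diff'[OF BT] by simp
    show "measure \<rho> (T - B) + measure \<rho> (B \<inter> T) = measure \<rho> T"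
      using finite_measure_Diff'[OF BT(2,1)] by (simp add: Int_commute)
  qed
  have "\<mu>.prob (B - T) \<le> \<nu>.prob (B - T)" using B T by (intro ge) auto
  moreover have "\<nu>.prob (T - B) \<le> \<mu>.prob (T - B)" using B T by (intro le) auto
  ultimately have "\<nu>.prob (B - T) = \<mu>.prob (B - T)"
    using split[OF \<mu>.finite_measure_axioms refl] split[OF \<nu>.finite_measure_axioms sets_eq] \<mu>T \<nu>T by linarith
  then have "B - T \<in> null_sets \<mu>"
    using B T by (intro density_gt_one_null[OF \<mu>.finite_measure_axioms f dens])
      (auto simp: B_def \<mu>.emeasure_eq_measure \<nu>.emeasure_eq_measure)
  then have "\<mu>.prob (B - T) = 0" by (auto simp: null_sets_def measure_def)
  moreover have "B - T = B - shift -` B" using sets.sets_into_space[OF B] by (auto simp: T_def)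
  ultimately have "\<mu>.prob B = 0 \<or> \<mu>.prob B = 1" by (intro ergodic[OF B]) simp
  then have B0: "\<mu>.prob B = 0"
  proof
    assume B1: "\<mu>.prob B = 1"
    have "\<nu>.prob B = 1" using ge[OF B order.refl] \<nu>.prob_le_1[of B] B1 by linarith
    then have "B \<in> null_sets \<mu>"
      using B B1 by (intro density_gt_one_null[OF \<mu>.finite_measure_axioms f dens])
        (auto simp: B_def \<mu>.emeasure_eq_measure \<nu>.emeasure_eq_measure)
    then show ?thesis by (auto simp: null_sets_def measure_def)
  qed
  have \<nu>B0: "\<nu>.prob B = 0"
  proof -
    have "B \<in> null_sets \<mu>" using B B0 by (simp add: null_sets_def \<mu>.emeasure_eq_measure)
    then have "B \<in> null_sets \<nu>" using ac by (auto simp: absolutely_continuous_def)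
    then show ?thesis by (auto simp: null_sets_def measure_def)
  qed
  have le_all: "\<nu>.prob E \<le> \<mu>.prob E" if E: "E \<in> sets \<mu>" for E
  proof -
    have "\<nu>.prob E \<le> \<nu>.prob ((E - B) \<union> B)"
      using E B sets_eq by (intro \<nu>.finite_measure_mono) auto
    also have "\<dots> \<le> \<nu>.prob (E - B) + \<nu>.prob B"
      using E B sets_eq by (intro measure_Un_le) auto
    also have "\<dots> \<le> \<mu>.prob (E - B)" using le[of "E - B"] E B \<nu>B0 by auto
    also have "\<dots> \<le> \<mu>.prob E" using E B by (intro \<mu>.finite_measure_mono) auto
    finally show ?thesis .
  qed
  show ?thesis
  proof (rule measure_eqI[OF sets_eq])
    fix E assume "E \<in> sets \<nu>"
    then have E: "E \<in> sets \<mu>" using sets_eq by simp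
    have "\<nu>.prob (space \<mu> - E) = 1 - \<nu>.prob E"
      using \<nu>.prob_compl[of E] E sets_eq by (simp add: \<nu>.space_\<nu> \<mu>.space_\<nu>)
    moreover have "\<mu>.prob (space \<mu> - E) = 1 - \<mu>.prob E" by (rule \<mu>.prob_compl[OF E])
    moreover have "\<nu>.prob (space \<mu> - E) \<le> \<mu>.prob (space \<mu> - E)" using E by (intro le_all) auto
    ultimately have "\<nu>.prob E = \<mu>.prob E" using le_all[OF E] by linarith
    then show "emeasure \<nu> E = emeasure \<mu> E" by (simp add: \<mu>.emeasure_eq_measure \<nu>.emeasure_eq_measure)
  qed
qed

text \<open>
  The supremum in the definition of equilibrium states is \<open>ln l\<close> by \<open>equilibrium_upper\<close>, and it is
  attained at \<open>\<mu>\<close> by \<open>equilibrium_gibbs\<close>; any other measure attaining it is absolutely continuous.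
\<close>

lemma equilibrium_state_iff: "equilibrium_state K A 2 \<nu> \<longleftrightarrow> \<nu> = \<mu>"
proof -
  let ?E = "\<lambda>\<nu>. metric_entropy shift \<nu> + ereal 2 * lyapunov A \<nu>"
  have \<mu>: "\<mu> \<in> invariant_measures K" using \<mu>.shift_system_axioms by (simp add: shift_system_iff)
  have sup: "(SUP \<nu>\<in>invariant_measures K. ?E \<nu>) = ereal (ln l)"
  proof (rule antisym)
    show "(SUP \<nu>\<in>invariant_measures K. ?E \<nu>) \<le> ereal (ln l)"
      by (rule SUP_least) (simp only: equilibrium_upper shift_system_iff)
    show "ereal (ln l) \<le> (SUP \<nu>\<in>invariant_measures K. ?E \<nu>)"
      by (rule SUP_upper2[OF \<mu>]) (simp only: equilibrium_gibbs order.refl)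
  qed
  show ?thesis
  proof
    assume "equilibrium_state K A 2 \<nu>"
    then have "\<nu> \<in> invariant_measures K" "?E \<nu> = ereal (ln l)"
      unfolding equilibrium_state_def sup by blast+
    then show "\<nu> = \<mu>"
      using absolutely_continuous_invariant_unique equilibrium_absolutely_continuous
      by (simp only: shift_system_iff)
  next
    assume "\<nu> = \<mu>"
    then show "equilibrium_state K A 2 \<nu>"
      unfolding equilibrium_state_def sup using \<mu> equilibrium_gibbs by blast
  qed
qed

end

section \<open>The Kusuoka measure\<close>

lemma exists_kusuoka_measure:
  fixes A :: "nat \<Rightarrow> real ^ 'd ^ 'd"
  assumes irr: "irreducible_tuple M A" and press: "pressure M A 2 > -\<infinity>"
  shows "\<exists>\<mu>. is_kusuoka_measure M A \<mu>"
proof -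
  have nz: "\<exists>i\<in>{1..M}. A i \<noteq> 0"
  proof (rule ccontr)
    assume "\<not> (\<exists>i\<in>{1..M}. A i \<noteq> 0)"
    then have "pressure M A 2 = -\<infinity>" by (intro pressure_zero) blast
    then show False using press by simp
  qed
  obtain Q Q' l where l: "l > 0" and Q: "positive_definite Q" "positive_definite Q'"
    and eig: "transfer_op M A Q = l *\<^sub>R Q" "dual_transfer_op M A Q' = l *\<^sub>R Q'"
    and tr: "trace (Q ** Q') = 1"
    using perron_frobenius_pair[OF irr nz] by blast
  have p: "pressure M A 2 = ereal (ln l)" by (rule pressure_eq[OF Q l eig(1) tr])
  let ?m = "\<lambda>w. kusuoka_form Q Q' (mat_prod A w) / l ^ length w"
  have "\<exists>\<mu>. prob_space \<mu> \<and> sets \<mu> = sets (shift_borel M) \<and>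
      (\<forall>n. \<forall>w\<in>words M n. measure \<mu> (cylinder M w) = ?m w)"
  proof (rule exists_measure_with_cylinder_weights)
    show "?m w \<ge> 0" for w using kusuoka_form_nonneg[OF Q] l by simp
    show "?m [] = 1" using tr trace_mul_sym[of Q Q'] by (simp add: kusuoka_form_def)
    show "?m w = (\<Sum>i=1..M. ?m (w @ [i]))" for w
      using sum_kusuoka_form_snoc[OF eig(1), of Q' w] l by (simp add: sum_divide_distrib[symmetric])
  qed
  then obtain \<mu> where prob: "prob_space \<mu>" and sets: "sets \<mu> = sets (shift_borel M)"
    and cyl: "\<And>n w. w \<in> words M n \<Longrightarrow> measure \<mu> (cylinder M w) = ?m w" by blast
  interpret prob_space \<mu> by fact
  have space: "space \<mu> = full_shift M" using sets_eq_imp_space_eq[OF sets] by simp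
  have shift: "shift \<in> measurable \<mu> \<mu>"
    using shift_measurable by (simp add: measurable_cong_sets[OF sets sets])
  have union: "measure \<mu> (cylinders M n S) = (\<Sum>w\<in>words M n \<inter> S. ?m w)" for n S
    unfolding measure_cylinders[OF finite_measure_axioms sets] by (intro sum.cong refl) (auto intro: cyl)
  have "distr \<mu> \<mu> shift = \<mu>"
  proof (rule measure_eqI_cylinders[symmetric, OF finite_measure_axioms sets])
    show "sets (distr \<mu> \<mu> shift) = sets (shift_borel M)" using sets by simp
    fix n S
    have C: "cylinders M n S \<in> sets \<mu>" by (simp add: sets cylinders_sets)
    have "measure (distr \<mu> \<mu> shift) (cylinders M n S) = measure \<mu> (cylinders M (Suc n) {w. drop 1 w \<in> S})"
      using measure_distr[OF shift C] shift_iter_preimage[of 1 M n S] by (simp add: space)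
    also have "\<dots> = (\<Sum>w\<in>words M (Suc n) \<inter> {w. drop 1 w \<in> S}. ?m w)" by (rule union)
    also have "\<dots> = (\<Sum>w\<in>words M (Suc n). if drop 1 w \<in> S then ?m w else 0)"
      using finite_words by (simp add: sum.inter_restrict)
    also have "\<dots> = (\<Sum>i=1..M. \<Sum>w\<in>words M n. if w \<in> S then ?m (i # w) else 0)"
      by (simp add: sum_words_Suc)
    also have "\<dots> = (\<Sum>w\<in>words M n. if w \<in> S then (\<Sum>i=1..M. ?m (i # w)) else 0)"
      by (subst sum.swap) (auto intro!: sum.cong)
    also have "\<dots> = (\<Sum>w\<in>words M n. if w \<in> S then ?m w else 0)"
    proof (intro sum.cong refl if_cong)
      fix w
      show "(\<Sum>i=1..M. ?m (i # w)) = ?m w"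
        using sum_kusuoka_form_Cons[OF eig(2), of Q w] l by (simp add: sum_divide_distrib[symmetric])
    qed
    also have "\<dots> = measure \<mu> (cylinders M n S)"
      using finite_words by (simp add: union sum.inter_restrict)
    finally show "emeasure \<mu> (cylinders M n S) = emeasure (distr \<mu> \<mu> shift) (cylinders M n S)"
      using finite_measure.emeasure_eq_measure[OF prob_space.finite_measure[OF prob_space_distr[OF shift]]]
        emeasure_eq_measure by simp
  qed
  then have inv: "\<mu> \<in> invariant_measures M"
    using prob shift sets by (simp add: invariant_measures_iff measure_preserving_def measure_preserving_axioms_def)
  show ?thesis
    unfolding is_kusuoka_measure_def p Let_def
  proof (intro exI conjI allI impI ballI)
    show "\<mu> \<in> invariant_measures M" by (rule inv)
    show "positive_definite Q" "positive_definite Q'" "trace (Q ** Q') = 1" using Q tr by auto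
    show "transfer_op M A Q = exp (real_of_ereal (ereal (ln l))) *\<^sub>R Q"
      "dual_transfer_op M A Q' = exp (real_of_ereal (ereal (ln l))) *\<^sub>R Q'"
      using eig l by auto
    fix n w assume w: "w \<in> words M n"
    have "exp (- real n * ln l) = 1 / l ^ n"
      using l by (simp add: exp_minus exp_of_nat_mult inverse_eq_divide)
    then show "measure \<mu> (cylinder M w) = exp (- real n * real_of_ereal (ereal (ln l))) *
        trace (Q' ** transpose (mat_prod A w) ** Q ** mat_prod A w)"
      using cyl[OF w] w by (simp add: kusuoka_form_def words_def)
  qed
qed

text \<open>
  The pair \<open>Q, Q'\<close> here is an arbitrary one admitted by the definition of the Kusuoka measure. Every
  Kusuoka measure is thus the only equilibrium state, which also shows that there is only one
  Kusuoka measure.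
\<close>

lemma kusuoka_gibbs:
  fixes A :: "nat \<Rightarrow> real ^ 'd ^ 'd"
  assumes irr: "irreducible_tuple M A" and kus: "is_kusuoka_measure M A \<mu>"
  shows "\<exists>l C. irreducible_gibbs \<mu> M A l C"
proof -
  define p where "p = real_of_ereal (pressure M A 2)"
  obtain Q Q' where inv: "\<mu> \<in> invariant_measures M" and Q: "positive_definite Q" "positive_definite Q'"
    and tr: "trace (Q ** Q') = 1"
    and cyl: "\<And>n w. n \<ge> 1 \<Longrightarrow> w \<in> words M n \<Longrightarrow>
       measure \<mu> (cylinder M w) = exp (- real n * p) * kusuoka_form Q Q' (mat_prod A w)"
    using kus unfolding is_kusuoka_measure_def Let_def p_def[symmetric] kusuoka_form_def by blast
  interpret \<mu>: shift_system \<mu> M using inv by (simp add: shift_system_iff)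
  have cyl': "measure \<mu> (cylinder M w) = kusuoka_form Q Q' (mat_prod A w) / exp p ^ n" if w: "w \<in> words M n" for n w
  proof (cases "n \<ge> 1")
    case True
    have "exp (- real n * p) = 1 / exp p ^ n" by (simp add: exp_minus exp_of_nat_mult inverse_eq_divide)
    then show ?thesis using cyl[OF True w] by simp
  next
    case False
    then have n: "n = 0" by simp
    moreover have "w = []" using w unfolding n by (simp add: words_def)
    moreover have "cylinder M [] = space \<mu>" by (simp add: cylinder_def \<mu>.space_\<nu>)
    ultimately show ?thesis using tr trace_mul_sym[of Q Q'] \<mu>.prob_space by (simp add: kusuoka_form_def)
  qed
  obtain C where C: "C > 0" "\<And>X. kusuoka_form Q Q' X \<le> C * (mat_norm X)\<^sup>2"
      "\<And>X. (mat_norm X)\<^sup>2 \<le> C * kusuoka_form Q Q' X"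
    using kusuoka_form_comparable[OF Q] by blast
  have "irreducible_gibbs \<mu> M A (exp p) C"
  proof unfold_locales
    fix n w assume w: "w \<in> words M n"
    show "measure \<mu> (cylinder M w) \<le> C * ((mat_norm (mat_prod A w))\<^sup>2 / exp p ^ n)"
      using divide_right_mono[OF C(2), of "exp p ^ n" "mat_prod A w"] by (simp add: cyl'[OF w])
    show "(mat_norm (mat_prod A w))\<^sup>2 / exp p ^ n \<le> C * measure \<mu> (cylinder M w)"
      using divide_right_mono[OF C(3), of "exp p ^ n" "mat_prod A w"] by (simp add: cyl'[OF w])
  qed (use C irr in auto)
  then show ?thesis by blast
qed

theorem theorem16:
  fixes M :: nat and A :: "nat \<Rightarrow> real ^ 'd ^ 'd"
  assumes "M \<ge> 2"
    and "irreducible_tuple M A"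
    and "pressure M A 2 > -\<infinity>"
  shows "(\<exists>!\<mu>. is_kusuoka_measure M A \<mu>) \<and>
         (\<forall>\<mu>. is_kusuoka_measure M A \<mu> \<longleftrightarrow> equilibrium_state M A 2 \<mu>)"
proof -
  have unique: "equilibrium_state M A 2 \<nu> \<longleftrightarrow> \<nu> = \<mu>" if "is_kusuoka_measure M A \<mu>" for \<mu> \<nu>
    using kusuoka_gibbs[OF assms(2) that] irreducible_gibbs.equilibrium_state_iff by blast
  obtain \<mu> where \<mu>: "is_kusuoka_measure M A \<mu>"
    using exists_kusuoka_measure[OF assms(2,3)] by blast
  have "is_kusuoka_measure M A \<nu> \<longleftrightarrow> \<nu> = \<mu>" for \<nu>
    using \<mu> unique[OF \<mu>, of \<nu>] unique[of \<nu> \<nu>] by blast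
  then show ?thesis using unique[OF \<mu>] by auto
qed

end
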